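(* Let $N\ge3$ and $M\ge 6$ be integers and $\mu\in\{1,-1\}$. There exists $\epsilon_0>0$, depending only on $N,M$, such that for every $0<\epsilon\le\epsilon_0$ and every (global) solution $f$ to the Vlasov--Poisson system with the potential $-\frac{|x|^2}{2}$ arising from $\epsilon$-small data, with scattering state $\bar f_\infty$, the following holds for every compactly supported test function $\bar\varphi\in C^\infty(\mathbb R^2_s\times\mathbb R^2_u)$ and every $\bar u\in\mathbb R^2$. The distribution $e^{2t}\bar f(t,s,u)$ converges weakly to $\big(\int\bar f_\infty(s,0)\,\mathrm ds\big)\delta_{s=0}(s)$, that is, $$\lim_{t\to\infty}e^{2t}\int_{\mathbb R^2_s\times\mathbb R^2_u}\bar f(t,s,u)\,\bar\varphi(s,u)\,\mathrm ds\,\mathrm du=\int_{\mathbb R^2_s}\bar f_\infty(s,0)\,\mathrm ds\int_{\mathbb R^2_u}\bar\varphi(0,u)\,\mathrm du .$$ Moreover, $e^{2t}\bar f(t,s,u+\bar ue^t)$ converges weakly to $\big(\int\bar f_\infty(s,\bar u)\,\mathrm ds\big)\delta_{s=0}(s)$, that is, $$\lim_{t\to\infty}e^{2t}\int_{\mathbb R^2_s\times\mathbb R^2_u}\bar f(t,s,u+\bar ue^t)\,\bar\varphi(s,u)\,\mathrm ds\,\mathrm du=\int_{\mathbb R^2_s}\bar f_\infty(s,\bar u)\,\mathrm ds\int_{\mathbb R^2_u}\bar\varphi(0,u)\,\mathrm du .$$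
   Context: The Vlasov--Poisson system with the potential $-\frac{|x|^2}{2}$ in dimension two is $$\partial_tf+v\cdot\nabla_xf+x\cdot\nabla_vf-\mu\nabla_x\phi\cdot\nabla_vf=0,\quad \Delta_x\phi=\rho(f),\quad \rho(f)(t,x)=\int_{\mathbb R^2_v}f(t,x,v)\,\mathrm dv,\quad f(0,x,v)=f_0(x,v),$$ for $t\ge0$, $x,v\in\mathbb R^2$, with $\phi=\frac1{2\pi}\log|\cdot|*_x\rho(f)$. Notation: $\langle y\rangle=(1+|y|^2)^{1/2}$; $s=\frac{x-v}{2}$, $u=\frac{x+v}{2}$; $\bar f(t,s,u)=f(t,x,v)$ with $x=s+u$, $v=u-s$. The measure $\delta_{s=0}(s)$ on $\mathbb R^2_s\times\mathbb R^2_u$ acts by $\bar\varphi\mapsto\int_{\mathbb R^2_u}\bar\varphi(0,u)\,\mathrm du$. $\epsilon$-small data: $f_0:\mathbb R^2_x\times\mathbb R^2_v\to[0,\infty)$ of class $C^N$ with $\sum_{|\beta|+|\kappa|\le N}\sup_{(s,u)}\langle s\rangle^{M+|\beta|}\langle u\rangle^{M+|\kappa|}|\partial_s^\beta\partial_u^\kappa\bar f_0|(s,u)\le\epsilon$. For $\epsilon_0$ small the solution is global. Scattering state: set $Q_\infty(u)=\lim_{t\to\infty}4e^{2t}\int_{\mathbb R^2_s}\bar f(t,s,e^tu)\,\mathrm ds$ (the limit exists), let $\phi_{\mathrm{asymp}}=\frac1{2\pi}\log|\cdot|*Q_\infty$, so $\Delta_u\phi_{\mathrm{asymp}}=Q_\infty$,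 let $S_{\mathscr C}(t,s,u)=e^{-t}\big(s+\frac12\mu t\nabla_u\phi_{\mathrm{asymp}}(u)\big)$, and $\bar f_\infty(s,u)=\lim_{t\to\infty}\bar f(t,S_{\mathscr C}(t,s,u),e^tu)$ (the limit exists uniformly). *)

theory Defs
  imports "HOL-Analysis.Analysis"
begin

section \<open>Differential operators and regularity classes\<close>

definition dir_deriv :: "'a::euclidean_space \<Rightarrow> ('a \<Rightarrow> real) \<Rightarrow> 'a \<Rightarrow> real" where
  "dir_deriv b g = (\<lambda>x. frechet_derivative g (at x) b)"

definition grad :: "('a::euclidean_space \<Rightarrow> real) \<Rightarrow> 'a \<Rightarrow> 'a" where
  "grad g x = (\<Sum>b\<in>Basis. dir_deriv b g x *\<^sub>R b)"

definition laplacian :: "('a::euclidean_space \<Rightarrow> real) \<Rightarrow> 'a \<Rightarrow> real" where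
  "laplacian g x = (\<Sum>b\<in>Basis. dir_deriv b (dir_deriv b g) x)"

primrec C_class :: "nat \<Rightarrow> ('a::euclidean_space \<Rightarrow> real) \<Rightarrow> bool" where
  "C_class 0 = (\<lambda>g. continuous_on UNIV g)"
| "C_class (Suc k) = (\<lambda>g. (\<forall>x. g differentiable (at x)) \<and> (\<forall>b\<in>Basis. C_class k (dir_deriv b g)))"

definition test_function :: "('a::euclidean_space \<Rightarrow> real) \<Rightarrow> bool" where
  "test_function g \<longleftrightarrow> (\<forall>k. C_class k g) \<and> compact (closure {x. g x \<noteq> 0})"

text \<open>Continuous differentiability in all variables on the closed half space
  \<open>{0..} \<times> UNIV\<close> (one-sided in time at \<open>t = 0\<close>).\<close>

definition C1_half_space :: "(real \<Rightarrow> 'a::euclidean_space \<Rightarrow> real) \<Rightarrow> bool" where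
  "C1_half_space g \<longleftrightarrow>
    (\<exists>D :: real \<times> 'a \<Rightarrow> (real \<times> 'a) \<Rightarrow>\<^sub>L real.
       (\<forall>p\<in>{0..} \<times> UNIV.
          ((\<lambda>(t, x). g t x) has_derivative blinfun_apply (D p)) (at p within {0..} \<times> UNIV)) \<and>
       continuous_on ({0..} \<times> UNIV) D)"


section \<open>Phase space\<close>

text \<open>\<open>bar g\<close> is \<open>g\<close> expressed in the coordinates \<open>s = (x - v) / 2\<close>, \<open>u = (x + v) / 2\<close>.\<close>

definition bar :: "(real^2 \<Rightarrow> real^2 \<Rightarrow> real) \<Rightarrow> real^2 \<Rightarrow> real^2 \<Rightarrow> real" where
  "bar g s u = g (s + u) (u - s)"

definition jbracket :: "'a::real_normed_vector \<Rightarrow> real" where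
  "jbracket y = sqrt (1 + (norm y)\<^sup>2)"

text \<open>\<open>mixed_deriv \<beta> \<kappa> g = \<partial>\<^sub>s\<^sup>\<beta> \<partial>\<^sub>u\<^sup>\<kappa> g\<close> for multi-indices \<open>\<beta>, \<kappa> \<in> \<nat>\<^sup>2\<close>.\<close>

definition mixed_deriv ::
  "nat \<times> nat \<Rightarrow> nat \<times> nat \<Rightarrow> ((real^2) \<times> (real^2) \<Rightarrow> real) \<Rightarrow> (real^2) \<times> (real^2) \<Rightarrow> real" where
  "mixed_deriv \<beta> \<kappa> g =
     (dir_deriv (axis 1 1, 0) ^^ fst \<beta>) ((dir_deriv (axis 2 1, 0) ^^ snd \<beta>)
       ((dir_deriv (0, axis 1 1) ^^ fst \<kappa>) ((dir_deriv (0, axis 2 1) ^^ snd \<kappa>) g)))"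

definition mi_order :: "nat \<times> nat \<Rightarrow> nat" where
  "mi_order \<beta> = fst \<beta> + snd \<beta>"

text \<open>The suprema are taken in the extended nonnegative reals, so that smallness of the sum
  includes finiteness of each of them.\<close>

definition small_data :: "nat \<Rightarrow> nat \<Rightarrow> real \<Rightarrow> (real^2 \<Rightarrow> real^2 \<Rightarrow> real) \<Rightarrow> bool" where
  "small_data N M \<epsilon> f0 \<longleftrightarrow>
     (\<forall>x v. 0 \<le> f0 x v) \<and>
     C_class N (\<lambda>(x, v). f0 x v) \<and>
     (\<Sum>(\<beta>, \<kappa>) \<in> {(\<beta>, \<kappa>). mi_order \<beta> + mi_order \<kappa> \<le> N}.
        SUP (s, u). ennreal (jbracket s ^ (M + mi_order \<beta>) * jbracket u ^ (M + mi_order \<kappa>) *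
          \<bar>mixed_deriv \<beta> \<kappa> (\<lambda>(s, u). bar f0 s u) (s, u)\<bar>)) \<le> ennreal \<epsilon>"


section \<open>The Vlasov--Poisson system with the potential $-|x|^2/2$\<close>

definition density :: "(real^2 \<Rightarrow> real^2 \<Rightarrow> real) \<Rightarrow> real^2 \<Rightarrow> real" where
  "density g x = (LINT v|lborel. g x v)"

text \<open>Convolution with \<open>(1 / 2\<pi>) log |\<cdot>|\<close>; the value of \<open>ln\<close> at \<open>0\<close> only matters on a null set.\<close>

definition log_potential :: "(real^2 \<Rightarrow> real) \<Rightarrow> real^2 \<Rightarrow> real" where
  "log_potential \<rho> x = 1 / (2 * pi) * (LINT y|lborel. ln (norm (x - y)) * \<rho> y)"

text \<open>Global classical solutions, in the usual sense for Vlasov--Poisson systems (e.g. Rein):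
  \<open>f\<close> is \<open>C\<^sup>1\<close>; the density \<open>\<rho>\<close> and the potential \<open>\<phi>\<close> exist (the integrals defining
  them converge absolutely) and are \<open>C\<^sup>1\<close> in \<open>(t, x)\<close>; \<open>\<phi>\<close> is twice continuously
  differentiable in \<open>x\<close>; the field \<open>\<nabla>\<^sub>x\<phi>\<close> is bounded on compact time intervals; and the
  equations hold pointwise. Values of \<open>f\<close> at negative times are irrelevant.\<close>

definition VP_solution ::
  "real \<Rightarrow> (real^2 \<Rightarrow> real^2 \<Rightarrow> real) \<Rightarrow> (real \<Rightarrow> real^2 \<Rightarrow> real^2 \<Rightarrow> real) \<Rightarrow> bool" where
  "VP_solution \<mu> f0 f \<longleftrightarrow>
    (let \<rho> = (\<lambda>t. density (f t)); \<phi> = (\<lambda>t. log_potential (\<rho> t)) in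
      C1_half_space (\<lambda>t (x, v). f t x v) \<and>
      (\<forall>t\<ge>0. \<forall>x. integrable lborel (\<lambda>v. f t x v)) \<and>
      (\<forall>t\<ge>0. \<forall>x. integrable lborel (\<lambda>y. ln (norm (x - y)) * \<rho> t y)) \<and>
      C1_half_space \<rho> \<and> C1_half_space \<phi> \<and>
      (\<forall>t\<ge>0. C_class 2 (\<phi> t)) \<and>
      (\<forall>b\<in>Basis. \<forall>c\<in>Basis.
         continuous_on ({0..} \<times> UNIV) (\<lambda>(t, x). dir_deriv c (dir_deriv b (\<phi> t)) x)) \<and>
      (\<forall>T. \<exists>C. \<forall>t\<in>{0..T}. \<forall>x. norm (grad (\<phi> t) x) \<le> C) \<and>
      (\<forall>t\<ge>0. \<forall>x v.
         vector_derivative (\<lambda>\<tau>. f \<tau> x v) (at t within {0..})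
         + v \<bullet> grad (\<lambda>y. f t y v) x + x \<bullet> grad (f t x) v
         - \<mu> * (grad (\<phi> t) x \<bullet> grad (f t x) v) = 0) \<and>
      (\<forall>t\<ge>0. \<forall>x. laplacian (\<phi> t) x = \<rho> t x) \<and>
      (\<forall>x v. f 0 x v = f0 x v))"


section \<open>The scattering state\<close>

definition Q_inf :: "(real \<Rightarrow> real^2 \<Rightarrow> real^2 \<Rightarrow> real) \<Rightarrow> real^2 \<Rightarrow> real" where
  "Q_inf f u = Lim at_top (\<lambda>t. 4 * exp (2 * t) * (LINT s|lborel. bar (f t) s (exp t *\<^sub>R u)))"

definition phi_asymp :: "(real \<Rightarrow> real^2 \<Rightarrow> real^2 \<Rightarrow> real) \<Rightarrow> real^2 \<Rightarrow> real" where
  "phi_asymp f = log_potential (Q_inf f)"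

definition S_corr ::
  "real \<Rightarrow> (real \<Rightarrow> real^2 \<Rightarrow> real^2 \<Rightarrow> real) \<Rightarrow> real \<Rightarrow> real^2 \<Rightarrow> real^2 \<Rightarrow> real^2" where
  "S_corr \<mu> f t s u = exp (- t) *\<^sub>R (s + (1 / 2 * \<mu> * t) *\<^sub>R grad (phi_asymp f) u)"

definition f_inf ::
  "real \<Rightarrow> (real \<Rightarrow> real^2 \<Rightarrow> real^2 \<Rightarrow> real) \<Rightarrow> real^2 \<Rightarrow> real^2 \<Rightarrow> real" where
  "f_inf \<mu> f s u = Lim at_top (\<lambda>t. bar (f t) (S_corr \<mu> f t s u) (exp t *\<^sub>R u))"

end

theory Submission
  imports Defs "HOL-Real_Asymp.Real_Asymp"
begin

text \<open>In the coordinates \<open>s\<close>, \<open>u\<close> the linear flow contracts \<open>s\<close> like \<open>e\<^sup>-\<^sup>t\<close> and expands \<open>u\<close> like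
  \<open>e\<^sup>t\<close>, so the object to follow is the profile \<open>F(t,s,u) = bar (f t) (e\<^sup>-\<^sup>t s) (e\<^sup>t u)\<close>. Rescaling
  \<open>s\<close> in the integral turns \<open>e\<^sup>2\<^sup>t \<integral>\<integral> bar (f t) s (u + e\<^sup>t w) \<psi>(s,u)\<close> into
  \<open>\<integral>\<integral> F(t, s, w + e\<^sup>-\<^sup>t u) \<psi>(e\<^sup>-\<^sup>t s, u)\<close>: in the limit \<open>\<psi>\<close> is seen only at \<open>s = 0\<close> and \<open>F\<close> only at \<open>u = w\<close>.
  The profile itself does not converge, since its mass drifts in \<open>s\<close> linearly in time. But the
  integral over \<open>s\<close> does not notice translations, so it suffices that \<open>F(t, s + c(t,w), w)\<close> converges
  with an integrable majorant for some shift \<open>c\<close>; the same limit, translated by a constant, is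
  then the scattering state.

  Put \<open>H(t,y) = e\<^sup>t \<nabla>\<phi>(t, e\<^sup>t y)\<close> and \<open>Q(t,y) = e\<^sup>2\<^sup>t \<rho>(t, e\<^sup>t y) = 4 \<integral> F(t, s, y - e\<^sup>-\<^sup>2\<^sup>t s) ds\<close>. Then \<open>H\<close> is
  the convolution of \<open>Q\<close> with the gradient of the logarithmic kernel, and the profile is constant
  along \<open>\<sigma>' = (\<mu>/2) H(t, \<nu> + e\<^sup>-\<^sup>2\<^sup>t \<sigma>)\<close>, \<open>\<nu>' = -(\<mu>/2) e\<^sup>-\<^sup>2\<^sup>t H(t, \<nu> + e\<^sup>-\<^sup>2\<^sup>t \<sigma>)\<close>. The natural shift is
  \<open>c(t,w) = (\<mu>/2) \<integral>\<^sub>0\<^sup>t H(r,w) dr\<close> (\<open>drift\<close> below).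

  Only one regularity property of \<open>H\<close> enters the estimates, and it follows from the size of \<open>Q\<close> alone: for every
  \<open>\<eta> \<in> (0,1]\<close>, \<open>|H(t,y) - H(t,y')| \<le> k (\<eta> + (1 + log(1/\<eta>)) |y - y'|)\<close> with \<open>k\<close> small
  (\<open>field_log_lipschitz\<close>). Since \<open>\<eta>\<close> may be chosen as the situation requires, this replaces a bound
  for the Hessian of \<open>\<phi>\<close>, which would require control of derivatives of \<open>F\<close>. With \<open>\<eta> = e\<^sup>-\<^sup>2\<^sup>t\<close>, a trajectory whose
  \<open>\<nu>\<close>-component ends near \<open>w\<close> follows \<open>s + c(t,w)\<close> up to a small multiple of \<open>1 + |s|\<close>, uniformly in time
  (\<open>shadowing\<close>). With \<open>\<eta> = e\<^sup>-\<^sup>T\<close> on \<open>[0,T]\<close>, two trajectories separate backwards in time by a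
  small power of \<open>e\<^sup>T\<close> only (\<open>backward_stability\<close>), while all the differences that occur are
  of the size of a larger negative power of \<open>e\<^sup>T\<close>.

  Shadowing yields \<open>F(t, s + c(t,y), y - e\<^sup>-\<^sup>2\<^sup>t (s + c(t,y))) \<le> C \<epsilon> (1 + |s|)\<^sup>-\<^sup>3 (1 + |y|)\<^sup>-\<^sup>3\<close>, hence a
  bound for \<open>Q\<close>, hence the smallness of \<open>H\<close> from which it was derived; a continuity argument closes
  the circle (\<open>good_step\<close>, \<open>profile_density_le\<close>). Shadowing and stability together show that
  \<open>F(t, s + c(t,w), w)\<close> is exponentially Cauchy, so \<open>Q\<close> and \<open>H\<close> converge exponentially
  (\<open>density_rate\<close>, \<open>field_rate\<close>). Therefore \<open>c(t,w)\<close> differs from \<open>(\<mu>/2) t \<nabla>\<phi>\<^sub>a\<^sub>s\<^sub>y\<^sub>m\<^sub>p(w)\<close> by a convergent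
  quantity, which identifies the scattering state (\<open>scattering_limit\<close>), and dominated convergence
  gives the weak limits (\<open>concentration_limit\<close>).\<close>

section \<open>The gradient of the logarithmic potential in the plane\<close>

text \<open>Polar coordinates for radial integrands: both sides integrate \<open>g\<close> against a measure on the line that gives the half line up to \<open>a\<close> the area of a disc of radius \<open>a\<close>.\<close>

lemma nn_integral_radial_plane:
  fixes g :: "real \<Rightarrow> ennreal"
  assumes [measurable]: "g \<in> borel_measurable borel"
  shows "(\<integral>\<^sup>+y. g (norm (y::real^2)) \<partial>lborel) =
         (\<integral>\<^sup>+r. ennreal (2 * pi * r) * indicator {0..} r * g r \<partial>lborel)"
proof -
  let ?M = "distr (lborel :: (real^2) measure) borel norm"
  let ?N = "Nonnegative_Lebesgue_Integration.density lborel (\<lambda>r. ennreal (2 * pi * r) * indicator {0..} r)"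
  have M: "emeasure ?M {..a} = (if a \<ge> 0 then ennreal (pi * a^2) else 0)" for a :: real
  proof -
    have "emeasure ?M {..a} = emeasure lborel {y::real^2. norm y \<le> a}"
      by (subst emeasure_distr) (auto intro!: arg_cong[where f="emeasure lborel"])
    also have "{y::real^2. norm y \<le> a} = (if a \<ge> 0 then cball 0 a else {})"
      by (auto intro: order_trans[OF norm_ge_zero])
    finally show ?thesis
      by (auto simp: emeasure_cball unit_ball_vol_2)
  qed
  have N: "emeasure ?N {..a} = (if a \<ge> 0 then ennreal (pi * a^2) else 0)" for a :: real
  proof -
    have eq: "emeasure ?N {..a} = (\<integral>\<^sup>+r. ennreal (2 * pi * r) * indicator {0..a} r \<partial>lborel)"
      by (subst emeasure_density) (auto intro!: nn_integral_cong split: split_indicator)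
    show ?thesis
    proof (cases "a \<ge> 0")
      case True
      have "(\<integral>\<^sup>+r. ennreal (2 * pi * r) * indicator {0..a} r \<partial>lborel) = ennreal (pi * a^2 - pi * 0^2)"
        by (rule nn_integral_FTC_Icc[where F="\<lambda>r. pi * r^2"])
          (use True in \<open>auto intro!: derivative_eq_intros\<close>)
      then show ?thesis using True eq by simp
    next
      case False
      then show ?thesis using eq by simp
    qed
  qed
  have "?M = ?N"
  proof (rule measure_eqI_generator_eq[where E="range atMost" and \<Omega>=UNIV and A="\<lambda>n::nat. {..real n}"])
    show "Int_stable (range (atMost :: real \<Rightarrow> _))"
      by (auto simp: Int_stable_def)
    show "emeasure ?M X = emeasure ?N X" if "X \<in> range atMost" for X
      using that M N by auto
    show "sets ?M = sigma_sets UNIV (range atMost)" "sets ?N = sigma_sets UNIV (range atMost)"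
      by (auto simp: borel_eq_atMost)
    show "(\<Union>i::nat. {..real i}) = UNIV"
      using real_arch_simple by auto
    show "emeasure ?M {..real i} \<noteq> \<infinity>" for i :: nat
      by (subst M) auto
  qed auto
  then have "(\<integral>\<^sup>+r. g r \<partial>?M) = (\<integral>\<^sup>+r. g r \<partial>?N)"
    by simp
  then show ?thesis
    by (simp add: nn_integral_distr nn_integral_density)
qed

lemma nn_integral_reflect_translate:
  fixes g :: "'a::euclidean_space \<Rightarrow> ennreal"
  assumes [measurable]: "g \<in> borel_measurable borel"
  shows "(\<integral>\<^sup>+y. g (x - y) \<partial>lborel) = (\<integral>\<^sup>+y. g y \<partial>lborel)"
proof -
  have "lborel = distr lborel borel (\<lambda>y. x - y)"
    by (subst lborel_affine[of "-1" x]) (auto simp: density_1)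
  then have "(\<integral>\<^sup>+y. g y \<partial>lborel) = (\<integral>\<^sup>+y. g y \<partial>distr lborel borel (\<lambda>y. x - y))"
    by (rule arg_cong)
  then show ?thesis by (simp add: nn_integral_distr)
qed

lemma has_bochner_integral_radial:
  fixes g :: "real \<Rightarrow> real" and x :: "real^2"
  assumes [measurable]: "g \<in> borel_measurable borel" and "\<And>r. 0 \<le> r \<Longrightarrow> 0 \<le> g r"
    and "(\<integral>\<^sup>+r. ennreal (2 * pi * r) * indicator {0..} r * ennreal (g r) \<partial>lborel) = ennreal c" and "0 \<le> c"
  shows "has_bochner_integral lborel (\<lambda>y. g (norm (x - y))) c"
proof (rule has_bochner_integral_nn_integral)
  show "(\<integral>\<^sup>+y. ennreal (g (norm (x - y))) \<partial>lborel) = ennreal c"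
    using nn_integral_reflect_translate[of "\<lambda>y. ennreal (g (norm y))" x]
      nn_integral_radial_plane[of "\<lambda>r. ennreal (g r)"] assms by simp
qed (use assms in auto)

lemma has_bochner_integral_inverse_norm:
  fixes x :: "real^2"
  assumes "0 \<le> \<eta>"
  shows "has_bochner_integral lborel (\<lambda>y. indicator {..<\<eta>} (norm (x - y)) / norm (x - y)) (2 * pi * \<eta>)"
proof (rule has_bochner_integral_radial[where g="\<lambda>r. indicator {..<\<eta>} r / r"])
  have "(\<integral>\<^sup>+r. ennreal (2 * pi * r) * indicator {0..} r * ennreal (indicator {..<\<eta>} r / r) \<partial>lborel)
      = (\<integral>\<^sup>+r. ennreal (2 * pi) * indicator {0..\<eta>} r \<partial>lborel)"
  proof (rule nn_integral_cong_AE)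
    have "AE r in lborel. r \<noteq> 0 \<and> r \<noteq> \<eta>"
      by (intro AE_conjI AE_lborel_singleton)
    then show "AE r in lborel. ennreal (2 * pi * r) * indicator {0..} r * ennreal (indicator {..<\<eta>} r / r)
      = ennreal (2 * pi) * indicator {0..\<eta>} r"
      by eventually_elim (auto split: split_indicator simp: ennreal_mult[symmetric])
  qed
  also have "\<dots> = ennreal (2 * pi * \<eta>)"
    using assms by (simp add: nn_integral_cmult_indicator ennreal_mult)
  finally show "(\<integral>\<^sup>+r. ennreal (2 * pi * r) * indicator {0..} r * ennreal (indicator {..<\<eta>} r / r) \<partial>lborel)
      = ennreal (2 * pi * \<eta>)" .
qed (use assms in \<open>auto split: split_indicator\<close>)

lemma has_bochner_integral_inverse_norm_square:
  fixes x :: "real^2"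
  assumes "0 < \<eta>" "\<eta> \<le> 1"
  shows "has_bochner_integral lborel (\<lambda>y. indicator {\<eta>..<1} (norm (x - y)) / (norm (x - y))\<^sup>2)
           (2 * pi * ln (1 / \<eta>))"
proof (rule has_bochner_integral_radial[where g="\<lambda>r. indicator {\<eta>..<1} r / r\<^sup>2"])
  have "(\<integral>\<^sup>+r. ennreal (2 * pi * r) * indicator {0..} r * ennreal (indicator {\<eta>..<1} r / r\<^sup>2) \<partial>lborel)
      = (\<integral>\<^sup>+r. ennreal (2 * pi / r) * indicator {\<eta>..1} r \<partial>lborel)"
  proof (rule nn_integral_cong_AE)
    have "AE r in lborel. r \<noteq> (1::real)"
      by (intro AE_lborel_singleton)
    then show "AE r in lborel. ennreal (2 * pi * r) * indicator {0..} r * ennreal (indicator {\<eta>..<1} r / r\<^sup>2)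
      = ennreal (2 * pi / r) * indicator {\<eta>..1} r"
      by eventually_elim
        (use assms in \<open>auto split: split_indicator simp: ennreal_mult[symmetric] power2_eq_square\<close>)
  qed
  also have "\<dots> = ennreal (2 * pi * ln 1 - 2 * pi * ln \<eta>)"
    by (rule nn_integral_FTC_Icc)
      (use assms in \<open>auto intro!: derivative_eq_intros simp: field_simps\<close>)
  finally show "(\<integral>\<^sup>+r. ennreal (2 * pi * r) * indicator {0..} r * ennreal (indicator {\<eta>..<1} r / r\<^sup>2) \<partial>lborel)
      = ennreal (2 * pi * ln (1 / \<eta>))"
    using assms by (simp add: ln_div)
qed (use assms in \<open>auto split: split_indicator\<close>)

text \<open>The exponent is larger than 2, so that the weight is integrable in the plane, and it is half of \<open>6 - 1\<close>: the geometric mean of the growth \<open>1 + |s|\<close> and of the decay \<open>(1 + |s|)\<^sup>-\<^sup>6\<close> is this weight.\<close>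

definition tail_weight :: "'a::real_normed_vector \<Rightarrow> real" where
  "tail_weight y = (1 + norm y) powr (- 5 / 2)"

lemma tail_weight_nonneg: "0 \<le> tail_weight y"
  and tail_weight_le_1: "tail_weight y \<le> 1"
  using powr_mono[of "- 5 / 2" 0 "1 + norm y"] by (auto simp: tail_weight_def split: if_splits)

lemma borel_measurable_tail_weight [measurable]:
  "(tail_weight :: 'a::{real_normed_vector, second_countable_topology} \<Rightarrow> real) \<in> borel_measurable borel"
  unfolding tail_weight_def[abs_def] by measurable

lemma integrable_tail_weight: "integrable lborel (tail_weight :: real^2 \<Rightarrow> real)"
proof -
  have "(\<integral>\<^sup>+y. ennreal (tail_weight (y::real^2)) \<partial>lborel)
      = (\<integral>\<^sup>+r. ennreal (2 * pi * r) * indicator {0..} r * ennreal ((1 + r) powr (- 5 / 2)) \<partial>lborel)"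
    using nn_integral_radial_plane[of "\<lambda>r. ennreal ((1 + r) powr (- 5 / 2))"]
    by (simp add: tail_weight_def)
  also have "\<dots> \<le> (\<integral>\<^sup>+r. ennreal (2 * pi * (1 + r) powr (- 3 / 2)) * indicator {0..} r \<partial>lborel)"
  proof (rule nn_integral_mono)
    fix r :: real
    have "2 * pi * r * (1 + r) powr (- 5 / 2) \<le> 2 * pi * (1 + r) powr (- 3 / 2)" if "0 \<le> r"
    proof -
      have "r * (1 + r) powr (- 5 / 2) \<le> (1 + r) powr 1 * (1 + r) powr (- 5 / 2)"
        using that by (intro mult_right_mono) auto
      also have "\<dots> = (1 + r) powr (- 3 / 2)"
        using that by (subst powr_add[symmetric]) simp
      finally show ?thesis by (simp add: mult.assoc)
    qed
    then show "ennreal (2 * pi * r) * indicator {0..} r * ennreal ((1 + r) powr (- 5 / 2))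
        \<le> ennreal (2 * pi * (1 + r) powr (- 3 / 2)) * indicator {0..} r"
      by (auto split: split_indicator simp: ennreal_mult[symmetric] intro!: ennreal_leI)
  qed
  also have "\<dots> = ennreal (0 - (- 4 * pi * (1 + 0) powr (- 1 / 2)))"
  proof (rule nn_integral_FTC_atLeast)
    show "((\<lambda>r::real. - 4 * pi * (1 + r) powr (- 1 / 2)) \<longlongrightarrow> 0) at_top"
      by real_asymp
    show "((\<lambda>r. - 4 * pi * (1 + r) powr (- 1 / 2)) has_real_derivative 2 * pi * (1 + x) powr (- 3 / 2)) (at x)"
      if "0 \<le> x" for x :: real
    proof -
      have "((\<lambda>r. - 4 * pi * (1 + r) powr (- 1 / 2)) has_real_derivative 2 * pi * (1 + x) powr (- 1 / 2 - 1)) (at x)"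
        using that by (auto intro!: derivative_eq_intros)
      then show ?thesis by simp
    qed
  qed auto
  also have "\<dots> < \<infinity>" by simp
  finally have "(\<integral>\<^sup>+y. ennreal (tail_weight (y::real^2)) \<partial>lborel) < \<infinity>" .
  then show ?thesis
    by (intro integrableI_nonneg) (auto simp: tail_weight_nonneg)
qed


text \<open>The gradient of \<open>(1 / 2\<pi>) log |\<cdot>|\<close>; at the origin the division by zero makes it \<open>0\<close>.\<close>

definition grad_kernel :: "real^2 \<Rightarrow> real^2" where
  "grad_kernel a = (1 / (2 * pi * (norm a)\<^sup>2)) *\<^sub>R a"

definition field :: "(real^2 \<Rightarrow> real) \<Rightarrow> real^2 \<Rightarrow> real^2" where
  "field \<rho> x = (LINT y|lborel. \<rho> y *\<^sub>R grad_kernel (x - y))"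

text \<open>One constant for both the size and the modulus of continuity of the field of a density below \<^const>\<open>tail_weight\<close>.\<close>

definition field_const :: real where
  "field_const = 4 + (LINT y|lborel. tail_weight (y::real^2))"

lemma tail_mass_nonneg: "0 \<le> (LINT y|lborel. tail_weight (y::real^2))"
  by (intro integral_nonneg_AE) (auto simp: tail_weight_nonneg)

lemma field_const_ge_4: "4 \<le> field_const"
  using tail_mass_nonneg by (simp add: field_const_def)

lemma norm_grad_kernel: "norm (grad_kernel a) = 1 / (2 * pi * norm a)"
  by (simp add: grad_kernel_def power2_eq_square)

lemma borel_measurable_grad_kernel [measurable]: "grad_kernel \<in> borel_measurable borel"
  unfolding grad_kernel_def[abs_def] by measurable

text \<open>Near \<open>x\<close> the weight is at most 1 and the kernel is integrable; away from \<open>x\<close> the kernel is bounded and the weight is integrable.\<close>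

lemma field_integrand:
  assumes [measurable]: "\<rho> \<in> borel_measurable borel" and q: "\<And>y. \<bar>\<rho> y\<bar> \<le> q * tail_weight y"
  shows integrable_field_integrand: "integrable lborel (\<lambda>y. \<rho> y *\<^sub>R grad_kernel (x - y))"
    and norm_field_le: "norm (field \<rho> x) \<le> q * field_const"
proof -
  have q0: "0 \<le> q"
    using q[of 0] by (auto simp: tail_weight_def)
  let ?I = "\<lambda>y. indicator {..<1} (norm (x - y)) / norm (x - y)"
  let ?g = "\<lambda>y. q * (?I y / (2 * pi) + tail_weight y)"
  have hI: "has_bochner_integral lborel ?I (2 * pi * 1)"
    by (rule has_bochner_integral_inverse_norm) simp
  have "has_bochner_integral lborel ?g (q * (2 * pi * 1 / (2 * pi) + (LINT y|lborel. tail_weight (y::real^2))))"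
    by (intro has_bochner_integral_mult_right has_bochner_integral_add has_bochner_integral_divide_zero hI
        has_bochner_integral_integrable integrable_tail_weight)
  then have hg: "has_bochner_integral lborel ?g (q * (1 + (LINT y|lborel. tail_weight (y::real^2))))"
    by simp
  have le: "norm (\<rho> y *\<^sub>R grad_kernel (x - y)) \<le> ?g y" for y
  proof (cases "norm (x - y) < 1")
    case True
    have "\<bar>\<rho> y\<bar> \<le> q"
      using q[of y] mult_left_mono[OF tail_weight_le_1[of y] q0] by simp
    then have "\<bar>\<rho> y\<bar> * (1 / (2 * pi * norm (x - y))) \<le> q * (1 / (2 * pi * norm (x - y)))"
      by (intro mult_right_mono) auto
    also have "\<dots> \<le> ?g y"
      using True q0 tail_weight_nonneg[of y] by (auto simp: distrib_left field_simps)
    finally show ?thesis by (simp add: norm_grad_kernel)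
  next
    case False
    have "1 * 1 \<le> (2 * pi) * norm (x - y)"
      using False pi_gt3 by (intro mult_mono) auto
    then have "1 / (2 * pi * norm (x - y)) \<le> 1" by simp
    then have "\<bar>\<rho> y\<bar> * (1 / (2 * pi * norm (x - y))) \<le> (q * tail_weight y) * 1"
      using q q0 tail_weight_nonneg[of y] by (intro mult_mono) auto
    then show ?thesis using False by (simp add: norm_grad_kernel)
  qed
  show int: "integrable lborel (\<lambda>y. \<rho> y *\<^sub>R grad_kernel (x - y))"
    by (rule Bochner_Integration.integrable_bound[OF integrable.intros[OF hg]])
      (simp, intro AE_I2, subst real_norm_def, rule order_trans[OF le abs_ge_self])
  have "norm (field \<rho> x) \<le> (LINT y|lborel. norm (\<rho> y *\<^sub>R grad_kernel (x - y)))"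
    unfolding field_def by (rule integral_norm_bound)
  also have "\<dots> \<le> (LINT y|lborel. ?g y)"
    using hg le by (intro integral_mono integrable_norm int) (auto simp: has_bochner_integral_iff)
  also have "\<dots> = q * (1 + (LINT y|lborel. tail_weight (y::real^2)))"
    using hg by (simp add: has_bochner_integral_iff)
  also have "\<dots> \<le> q * field_const"
    unfolding field_const_def using q0 by (intro mult_left_mono) auto
  finally show "norm (field \<rho> x) \<le> q * field_const" .
qed


text \<open>Up to the factor \<open>2\<pi>\<close> the kernel is the inversion in the unit circle, which distorts distances by exactly this factor.\<close>

lemma norm_grad_kernel_diff:
  assumes "a \<noteq> 0" "b \<noteq> 0"
  shows "norm (grad_kernel a - grad_kernel b) = norm (a - b) / (2 * pi * norm a * norm b)"
proof -
  have "(norm (grad_kernel a - grad_kernel b))\<^sup>2 = (norm (a - b) / (2 * pi * norm a * norm b))\<^sup>2"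
  proof -
    have "(norm (grad_kernel a - grad_kernel b))\<^sup>2 =
       (norm (grad_kernel a))\<^sup>2 - 2 * (grad_kernel a \<bullet> grad_kernel b) + (norm (grad_kernel b))\<^sup>2"
      by (simp add: power2_norm_eq_inner inner_diff_left inner_diff_right inner_commute)
    also have "\<dots> = 1 / (2 * pi)\<^sup>2 * (1 / (norm a)\<^sup>2 - 2 * (a \<bullet> b) / ((norm a)\<^sup>2 * (norm b)\<^sup>2) + 1 / (norm b)\<^sup>2)"
      unfolding norm_grad_kernel by (simp add: grad_kernel_def power_mult_distrib power_divide power2_eq_square field_simps)
    also have "\<dots> = 1 / (2 * pi)\<^sup>2 * ((norm a)\<^sup>2 - 2 * (a \<bullet> b) + (norm b)\<^sup>2) / ((norm a)\<^sup>2 * (norm b)\<^sup>2)"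
      using assms by (simp add: field_simps)
    also have "(norm a)\<^sup>2 - 2 * (a \<bullet> b) + (norm b)\<^sup>2 = (norm (a - b))\<^sup>2"
      by (simp add: power2_norm_eq_inner inner_diff_left inner_diff_right inner_commute)
    finally show ?thesis by (simp add: power_mult_distrib power_divide mult.assoc)
  qed
  then show ?thesis
    by (rule power2_eq_imp_eq) auto
qed

text \<open>Within distance \<open>\<eta>\<close> of the singularity the two kernels are estimated separately; farther away the distance formula gives \<open>d / (|a| |b|) \<le> d / |a|\<^sup>2 + d / |b|\<^sup>2\<close>. The summand 1 takes care of the region outside the unit disc.\<close>

lemma grad_kernel_diff_le:
  fixes a b :: "real^2" and d :: real
  assumes \<eta>: "0 < \<eta>" "\<eta> \<le> 1"
  defines "T \<equiv> \<lambda>a::real^2. 2 * (indicator {..<\<eta>} (norm a) / norm a)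
     + d * (indicator {\<eta>..<1} (norm a) / (norm a)\<^sup>2 + 1)"
  assumes d: "d = norm (a - b)"
  shows "norm (grad_kernel a - grad_kernel b) \<le> (T a + T b) / (2 * pi)"
proof -
  have zero_kernel: "grad_kernel 0 = 0" by (simp add: grad_kernel_def)
  have d0: "0 \<le> d" using d by simp
  have T0: "0 \<le> T c" for c
    using d0 by (auto simp: T_def)
  have Tsmall: "2 / norm c \<le> T c" if "norm c < \<eta>" for c
    using that d0 by (auto simp: T_def)
  have Tlarge: "d / (norm c)\<^sup>2 \<le> T c" if "\<eta> \<le> norm c" for c
  proof (cases "norm c < 1")
    case True
    then show ?thesis using that d0 by (simp add: T_def distrib_left)
  next
    case False
    then have "1 \<le> (norm c)\<^sup>2" by simp
    then have "d / (norm c)\<^sup>2 \<le> d"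
      using d0 by (simp add: divide_le_eq mult_left_le[of _ d] mult_le_cancel_left1)
    moreover have "T c = 2 * (indicator {..<\<eta>} (norm c) / norm c) + d"
      unfolding T_def using False by simp
    moreover have "0 \<le> 2 * (indicator {..<\<eta>} (norm c) / norm c)"
      by (intro mult_nonneg_nonneg divide_nonneg_nonneg) auto
    ultimately show ?thesis by linarith
  qed
  have main: "2 * pi * norm (grad_kernel a - grad_kernel b) \<le> T a + T b"
    if ab: "norm a \<le> norm b" and d: "d = norm (a - b)" for a b
  proof -
    consider "a = 0" | "a \<noteq> 0" "norm a < \<eta>" | "\<eta> \<le> norm a"
      by fastforce
    then show ?thesis
    proof cases
      case 1
      have "1 / norm b \<le> T b"
      proof (cases "norm b < \<eta>")
        case True
        have "1 / norm b \<le> 2 / norm b" by (intro divide_right_mono) auto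
        then show ?thesis using Tsmall[OF True] by linarith
      next
        case False
        then have "d / (norm b)\<^sup>2 \<le> T b" by (intro Tlarge) simp
        moreover have "d / (norm b)\<^sup>2 = 1 / norm b"
        proof -
          have "d = norm b" using d 1 by simp
          then show ?thesis by (simp add: power2_eq_square)
        qed
        ultimately show ?thesis by simp
      qed
      then show ?thesis using 1 T0[of a] norm_grad_kernel[of b] zero_kernel by simp
    next
      case 2
      then have "b \<noteq> 0" using ab by auto
      have "norm (a - b) / (norm a * norm b) \<le> (norm a + norm b) / (norm a * norm b)"
        by (intro divide_right_mono norm_triangle_ineq4) auto
      also have "\<dots> = 1 / norm a + 1 / norm b"
        using 2 \<open>b \<noteq> 0\<close> by (simp add: add_divide_distrib)
      also have "\<dots> \<le> 1 / norm a + 1 / norm a"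
        using ab 2 \<open>b \<noteq> 0\<close> by (intro add_left_mono divide_left_mono) auto
      also have "\<dots> = 2 / norm a" by simp
      finally show ?thesis
        using 2 \<open>b \<noteq> 0\<close> Tsmall[OF 2(2)] T0[of b] by (simp add: norm_grad_kernel_diff)
    next
      case 3
      then have nz: "a \<noteq> 0" "b \<noteq> 0" "\<eta> \<le> norm b" using ab \<eta> by auto
      then have "2 * pi * norm (grad_kernel a - grad_kernel b) = d * ((1 / norm a) * (1 / norm b))"
        using d by (simp add: norm_grad_kernel_diff)
      also have "\<dots> \<le> d * ((1 / norm a)\<^sup>2 + (1 / norm b)\<^sup>2)"
      proof (rule mult_left_mono[OF _ d0])
        have "0 \<le> (1 / norm a) * (1 / norm b)" by simp
        then show "(1 / norm a) * (1 / norm b) \<le> (1 / norm a)\<^sup>2 + (1 / norm b)\<^sup>2"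
          using sum_squares_bound[of "1 / norm a" "1 / norm b"] by linarith
      qed
      also have "\<dots> = d / (norm a)\<^sup>2 + d / (norm b)\<^sup>2"
        by (simp add: distrib_left power_divide)
      also have "\<dots> \<le> T a + T b"
        using 3 nz(3) by (intro add_mono Tlarge)
      finally show ?thesis .
    qed
  qed
  have "2 * pi * norm (grad_kernel a - grad_kernel b) \<le> T a + T b"
  proof (cases "norm a \<le> norm b")
    case True
    then show ?thesis using main[of a b] d by simp
  next
    case False
    then show ?thesis
      using main[of b a] d by (simp add: norm_minus_commute[of "grad_kernel b"] norm_minus_commute[of b] add.commute)
  qed
  then show ?thesis by (simp add: field_simps)
qed

lemma has_bochner_integral_local_weight:
  fixes x :: "real^2"
  assumes "0 < \<eta>" "\<eta> \<le> 1"
  shows "has_bochner_integral lborel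
    (\<lambda>y. A * (indicator {..<\<eta>} (norm (x - y)) / norm (x - y))
       + B * (indicator {\<eta>..<1} (norm (x - y)) / (norm (x - y))\<^sup>2 + tail_weight y))
    (A * (2 * pi * \<eta>) + B * (2 * pi * ln (1 / \<eta>) + (LINT y|lborel. tail_weight (y::real^2))))"
  using assms
  by (intro has_bochner_integral_mult_right has_bochner_integral_add has_bochner_integral_inverse_norm
      has_bochner_integral_inverse_norm_square has_bochner_integral_integrable integrable_tail_weight) auto

text \<open>The disc of radius \<open>\<eta>\<close> around the singularity contributes a multiple of \<open>\<eta>\<close>, and the annulus between \<open>\<eta>\<close> and 1, where the difference of the kernels is of order \<open>d / r\<^sup>2\<close>, contributes the logarithm. Minimising over \<open>\<eta>\<close> would give the usual log-Lipschitz modulus; a free \<open>\<eta>\<close> keeps the bound linear in the distance.\<close>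

lemma field_log_lipschitz:
  assumes [measurable]: "\<rho> \<in> borel_measurable borel" and q: "\<And>y. \<bar>\<rho> y\<bar> \<le> q * tail_weight y"
    and \<eta>: "0 < \<eta>" "\<eta> \<le> 1"
  shows "norm (field \<rho> x1 - field \<rho> x2)
    \<le> q * field_const * (\<eta> + (1 + ln (1 / \<eta>)) * norm (x1 - x2))"
proof -
  define d where "d = norm (x1 - x2)"
  have d0: "0 \<le> d" by (simp add: d_def)
  have q0: "0 \<le> q"
    using q[of 0] by (auto simp: tail_weight_def)
  define U where "U = (\<lambda>x (y::real^2). 2 * (indicator {..<\<eta>} (norm (x - y)) / norm (x - y))
       + d * (indicator {\<eta>..<1} (norm (x - y)) / (norm (x - y))\<^sup>2 + tail_weight y))"
  define m where "m = (LINT y|lborel. tail_weight (y::real^2))"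
  have hU: "has_bochner_integral lborel (U x) (2 * (2 * pi * \<eta>) + d * (2 * pi * ln (1 / \<eta>) + m))" for x
    unfolding U_def m_def by (rule has_bochner_integral_local_weight[OF \<eta>])
  have hUU: "has_bochner_integral lborel (\<lambda>y. q * ((U x1 y + U x2 y) / (2 * pi)))
     (q * (((2 * (2 * pi * \<eta>) + d * (2 * pi * ln (1 / \<eta>) + m)) + (2 * (2 * pi * \<eta>) + d * (2 * pi * ln (1 / \<eta>) + m))) / (2 * pi)))"
    by (intro has_bochner_integral_mult_right has_bochner_integral_divide_zero has_bochner_integral_add hU)
  have le: "norm (\<rho> y *\<^sub>R grad_kernel (x1 - y) - \<rho> y *\<^sub>R grad_kernel (x2 - y)) \<le> q * ((U x1 y + U x2 y) / (2 * pi))" for y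
  proof -
    let ?T = "\<lambda>a::real^2. 2 * (indicator {..<\<eta>} (norm a) / norm a)
     + d * (indicator {\<eta>..<1} (norm a) / (norm a)\<^sup>2 + 1)"
    have w: "0 \<le> tail_weight y" "tail_weight y \<le> 1"
      by (auto simp: tail_weight_nonneg tail_weight_le_1)
    have TU: "tail_weight y * ?T (x - y) \<le> U x y" for x
    proof -
      have 1: "tail_weight y * (2 * (indicator {..<\<eta>} (norm (x - y)) / norm (x - y)))
         \<le> 2 * (indicator {..<\<eta>} (norm (x - y)) / norm (x - y))"
        using w by (intro mult_left_le_one_le) auto
      have 2: "tail_weight y * (d * (indicator {\<eta>..<1} (norm (x - y)) / (norm (x - y))\<^sup>2))
         \<le> d * (indicator {\<eta>..<1} (norm (x - y)) / (norm (x - y))\<^sup>2)"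
        using w d0 by (intro mult_left_le_one_le) auto
      show ?thesis unfolding U_def using 1 2 by (simp add: algebra_simps)
    qed
    have "norm (\<rho> y *\<^sub>R grad_kernel (x1 - y) - \<rho> y *\<^sub>R grad_kernel (x2 - y))
       = \<bar>\<rho> y\<bar> * norm (grad_kernel (x1 - y) - grad_kernel (x2 - y))"
      by (simp flip: scaleR_diff_right)
    also have "\<dots> \<le> (q * tail_weight y) * ((?T (x1 - y) + ?T (x2 - y)) / (2 * pi))"
      using q w q0 by (intro mult_mono grad_kernel_diff_le[OF \<eta>]) (auto simp: d_def)
    also have "\<dots> = q * ((tail_weight y * ?T (x1 - y) + tail_weight y * ?T (x2 - y)) / (2 * pi))"
      by (simp add: field_simps)
    also have "\<dots> \<le> q * ((U x1 y + U x2 y) / (2 * pi))"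
      using q0 TU[of x1] TU[of x2] by (intro mult_left_mono divide_right_mono add_mono) auto
    finally show ?thesis .
  qed
  have int: "integrable lborel (\<lambda>y. \<rho> y *\<^sub>R grad_kernel (x - y))" for x
    by (rule integrable_field_integrand) (use q in auto)
  have "field \<rho> x1 - field \<rho> x2 = (LINT y|lborel. \<rho> y *\<^sub>R grad_kernel (x1 - y) - \<rho> y *\<^sub>R grad_kernel (x2 - y))"
    unfolding field_def by (rule Bochner_Integration.integral_diff[symmetric]) (rule int)+
  also have "norm \<dots> \<le> (LINT y|lborel. norm (\<rho> y *\<^sub>R grad_kernel (x1 - y) - \<rho> y *\<^sub>R grad_kernel (x2 - y)))"
    by (rule integral_norm_bound)
  also have "\<dots> \<le> (LINT y|lborel. q * ((U x1 y + U x2 y) / (2 * pi)))"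
    using le by (intro integral_mono integrable_norm Bochner_Integration.integrable_diff int integrable.intros[OF hUU])
  also have "\<dots> = q * (4 * \<eta> + d * (2 * ln (1 / \<eta>) + m / pi))"
    using hUU by (simp add: has_bochner_integral_iff field_simps)
  also have "\<dots> \<le> q * (field_const * (\<eta> + (1 + ln (1 / \<eta>)) * d))"
  proof (intro mult_left_mono q0)
    have m: "0 \<le> m" "field_const = 4 + m"
      using tail_mass_nonneg by (auto simp: m_def field_const_def)
    have l: "0 \<le> ln (1 / \<eta>)" using \<eta> by simp
    have "m / pi \<le> m"
      using m pi_gt3 by (simp add: divide_le_eq mult_le_cancel_left1)
    then have "2 * ln (1 / \<eta>) + m / pi \<le> field_const * (1 + ln (1 / \<eta>))"
      using m(1) l mult_nonneg_nonneg[OF m(1) l] unfolding m(2) distrib_left distrib_right by linarith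
    then have "d * (2 * ln (1 / \<eta>) + m / pi) \<le> d * (field_const * (1 + ln (1 / \<eta>)))"
      using d0 by (rule mult_left_mono)
    moreover have "4 * \<eta> \<le> field_const * \<eta>"
      using field_const_ge_4 \<eta> by (intro mult_right_mono) auto
    ultimately show "4 * \<eta> + d * (2 * ln (1 / \<eta>) + m / pi) \<le> field_const * (\<eta> + (1 + ln (1 / \<eta>)) * d)"
      by (simp add: algebra_simps)
  qed
  finally show ?thesis by (simp add: d_def mult.assoc)
qed


text \<open>Crude first-order bound, from \<open>ln z \<le> z - 1\<close> alone, for the region where \<open>h\<close> is not small compared with \<open>a\<close>.\<close>

lemma ln_norm_remainder_near:
  fixes a h :: "real^2"
  assumes "a \<noteq> 0" "a + h \<noteq> 0"
  shows "\<bar>ln (norm (a + h)) - ln (norm a) - h \<bullet> a / (norm a)\<^sup>2\<bar> \<le> norm h * (2 / norm a + 1 / norm (a + h))"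
proof -
  have tri: "\<bar>norm (a + h) - norm a\<bar> \<le> norm h"
    using norm_triangle_ineq3[of "a + h" a] by simp
  have "ln (norm (a + h)) - ln (norm a) \<le> norm h / norm a"
  proof -
    have "ln (norm (a + h) / norm a) \<le> norm (a + h) / norm a - 1"
      using assms by (intro ln_le_minus_one) auto
    also have "\<dots> = (norm (a + h) - norm a) / norm a"
      using assms by (simp add: field_simps)
    also have "\<dots> \<le> norm h / norm a"
      using tri by (intro divide_right_mono) auto
    finally show ?thesis using assms by (simp add: ln_div)
  qed
  moreover have "ln (norm a) - ln (norm (a + h)) \<le> norm h / norm (a + h)"
  proof -
    have "ln (norm a / norm (a + h)) \<le> norm a / norm (a + h) - 1"
      using assms by (intro ln_le_minus_one) auto
    also have "\<dots> = (norm a - norm (a + h)) / norm (a + h)"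
      using assms by (simp add: field_simps)
    also have "\<dots> \<le> norm h / norm (a + h)"
      using tri by (intro divide_right_mono) auto
    finally show ?thesis using assms by (simp add: ln_div)
  qed
  moreover have "\<bar>h \<bullet> a / (norm a)\<^sup>2\<bar> \<le> norm h / norm a"
  proof -
    have "\<bar>h \<bullet> a\<bar> / (norm a)\<^sup>2 \<le> (norm h * norm a) / (norm a)\<^sup>2"
      by (intro divide_right_mono Cauchy_Schwarz_ineq2) auto
    then show ?thesis using assms by (simp add: power2_eq_square)
  qed
  moreover have "0 \<le> norm h / norm a" "0 \<le> norm h / norm (a + h)" by auto
  moreover have "norm h * (2 / norm a + 1 / norm (a + h)) = 2 * (norm h / norm a) + norm h / norm (a + h)"
    by (simp add: distrib_left)
  ultimately show ?thesis by linarith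
qed

text \<open>Second-order bound: \<open>|a + h|\<^sup>2 / |a|\<^sup>2 = 1 + \<xi>\<close> with \<open>\<xi> = 2 h \<bullet> a / |a|\<^sup>2 + |h|\<^sup>2 / |a|\<^sup>2\<close>, and \<open>ln (1 + \<xi>)\<close> lies between \<open>\<xi> / (1 + \<xi>)\<close> and \<open>\<xi>\<close>.\<close>

lemma ln_norm_remainder_far:
  fixes a h :: "real^2"
  assumes "a \<noteq> 0" "2 * norm h \<le> norm a"
  shows "\<bar>ln (norm (a + h)) - ln (norm a) - h \<bullet> a / (norm a)\<^sup>2\<bar> \<le> 13 * (norm h)\<^sup>2 / (norm a)\<^sup>2"
proof -
  define \<delta> where "\<delta> = norm h / norm a"
  define \<xi> where "\<xi> = 2 * (h \<bullet> a / (norm a)\<^sup>2) + \<delta>\<^sup>2"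
  have arith: "\<bar>l / 2 - (x - d) / 2\<bar> \<le> 13 * d" if "l \<le> x" "x - 4 * X \<le> l" "X \<le> 25 / 4 * d" "0 \<le> d" for l x X d :: real
    using that by (auto simp: abs_le_iff field_simps)
  have \<delta>: "0 \<le> \<delta>" "\<delta> \<le> 1 / 2"
    using assms by (auto simp: \<delta>_def field_simps)
  have inner: "\<bar>h \<bullet> a / (norm a)\<^sup>2\<bar> \<le> \<delta>"
  proof -
    have "\<bar>h \<bullet> a\<bar> / (norm a)\<^sup>2 \<le> (norm h * norm a) / (norm a)\<^sup>2"
      by (intro divide_right_mono Cauchy_Schwarz_ineq2) auto
    then show ?thesis using assms by (simp add: power2_eq_square \<delta>_def)
  qed
  have pos: "1 / 2 * norm a \<le> norm (a + h)"
    using norm_triangle_ineq2[of a "- h"] assms by simp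
  have "norm a > 0" using assms by simp
  have eq: "1 + \<xi> = (norm (a + h) / norm a)\<^sup>2"
  proof -
    have "(norm (a + h))\<^sup>2 = (norm a)\<^sup>2 + 2 * (h \<bullet> a) + (norm h)\<^sup>2"
      by (simp add: power2_norm_eq_inner inner_add_left inner_add_right inner_commute)
    then show ?thesis using assms by (simp add: \<xi>_def \<delta>_def power_divide field_simps)
  qed
  have "1 / 2 \<le> norm (a + h) / norm a"
    using pos \<open>norm a > 0\<close> by (simp add: field_simps)
  then have quarter: "1 / 4 \<le> 1 + \<xi>"
    unfolding eq using power_mono[of "1/2" "norm (a + h) / norm a" 2] by (simp add: power_divide)
  have ln_eq: "ln (norm (a + h)) - ln (norm a) = ln (1 + \<xi>) / 2"
  proof -
    have "a + h \<noteq> 0" using pos \<open>norm a > 0\<close> by auto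
    then show ?thesis unfolding eq using \<open>norm a > 0\<close> by (simp add: ln_realpow ln_div)
  qed
  have "ln (1 + \<xi>) \<le> \<xi>"
    using ln_le_minus_one[of "1 + \<xi>"] quarter by simp
  moreover have "\<xi> - 4 * \<xi>\<^sup>2 \<le> ln (1 + \<xi>)"
  proof -
    have "- ln (1 + \<xi>) \<le> 1 / (1 + \<xi>) - 1"
      using ln_le_minus_one[of "1 / (1 + \<xi>)"] quarter by (simp add: ln_div)
    then have "1 - 1 / (1 + \<xi>) \<le> ln (1 + \<xi>)" by simp
    moreover have "1 - 1 / (1 + \<xi>) = \<xi> - \<xi>\<^sup>2 / (1 + \<xi>)"
      using quarter by (simp add: field_simps power2_eq_square)
    moreover have "\<xi>\<^sup>2 / (1 + \<xi>) \<le> \<xi>\<^sup>2 / (1 / 4)"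
      using quarter by (intro divide_left_mono) auto
    ultimately show ?thesis by simp
  qed
  moreover have "\<xi>\<^sup>2 \<le> (5 / 2 * \<delta>)\<^sup>2"
  proof -
    have "\<delta>\<^sup>2 \<le> 1 / 2 * \<delta>"
      using mult_right_mono[OF \<delta>(2) \<delta>(1)] by (simp add: power2_eq_square)
    then have "\<bar>\<xi>\<bar> \<le> 5 / 2 * \<delta>"
      using inner \<delta> zero_le_power2[of \<delta>] unfolding \<xi>_def abs_le_iff by linarith
    then have "\<bar>\<xi>\<bar>\<^sup>2 \<le> (5 / 2 * \<delta>)\<^sup>2" by (rule power_mono) simp
    then show ?thesis by simp
  qed
  ultimately have "ln (1 + \<xi>) \<le> \<xi>" "\<xi> - 4 * \<xi>\<^sup>2 \<le> ln (1 + \<xi>)" "\<xi>\<^sup>2 \<le> 25 / 4 * \<delta>\<^sup>2"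
    by (simp_all add: power_mult_distrib power_divide)
  then have "\<bar>ln (1 + \<xi>) / 2 - (\<xi> - \<delta>\<^sup>2) / 2\<bar> \<le> 13 * \<delta>\<^sup>2"
    using zero_le_power2[of \<delta>] arith by blast
  moreover have "(\<xi> - \<delta>\<^sup>2) / 2 = h \<bullet> a / (norm a)\<^sup>2"
    by (simp add: \<xi>_def)
  ultimately show ?thesis
    unfolding ln_eq by (simp add: \<delta>_def power_divide)
qed

text \<open>The remainder of the first-order expansion of the logarithm is integrated with the crude bound on the disc of radius \<open>2|h|\<close> and with the second-order bound outside; the total is of order \<open>|h|\<^sup>2 log (1 / |h|)\<close>.\<close>

lemma log_potential_has_derivative:
  assumes [measurable]: "\<rho> \<in> borel_measurable borel" and q: "\<And>y. \<bar>\<rho> y\<bar> \<le> q * tail_weight y"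
    and int: "\<And>x. integrable lborel (\<lambda>y. ln (norm (x - y)) * \<rho> y)"
  shows "(log_potential \<rho> has_derivative (\<lambda>h. h \<bullet> field \<rho> x)) (at x)"
proof -
  have q0: "0 \<le> q"
    using q[of 0] by (auto simp: tail_weight_def)
  define m where "m = (LINT y|lborel. tail_weight (y::real^2))"
  have bound: "norm (log_potential \<rho> (x + h) - log_potential \<rho> x - h \<bullet> field \<rho> x)
      \<le> q * (norm h)\<^sup>2 * (14 * pi + 26 * pi * ln (1 / (2 * norm h)) + 13 * m)"
    if h: "h \<noteq> 0" "norm h \<le> 1 / 3" for h
  proof -
    define r where "r = norm h"
    have r: "0 < r" "r \<le> 1 / 3" using h by (auto simp: r_def)
    define R where "R = (\<lambda>y. ln (norm (x + h - y)) - ln (norm (x - y)) - h \<bullet> (x - y) / (norm (x - y))\<^sup>2)"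
    define U where "U = (\<lambda>y. (2 * r) * (indicator {..<2 * r} (norm (x - y)) / norm (x - y))
       + (13 * r\<^sup>2) * (indicator {2 * r..<1} (norm (x - y)) / (norm (x - y))\<^sup>2 + tail_weight y)
       + r * (indicator {..<3 * r} (norm (x + h - y)) / norm (x + h - y)))"
    have hU: "has_bochner_integral lborel U ((2 * r) * (2 * pi * (2 * r)) + (13 * r\<^sup>2) * (2 * pi * ln (1 / (2 * r)) + m)
        + r * (2 * pi * (3 * r)))"
      unfolding U_def m_def
      by (rule has_bochner_integral_add, rule has_bochner_integral_local_weight)
        (use r in \<open>auto intro!: has_bochner_integral_mult_right simp del: times_divide_eq_right intro: has_bochner_integral_inverse_norm[of "3 * r" "x + h", simplified]\<close>)
    have intR: "has_bochner_integral lborel (\<lambda>y. \<rho> y * R y)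
        (2 * pi * (log_potential \<rho> (x + h) - log_potential \<rho> x - h \<bullet> field \<rho> x))"
    proof -
      have 1: "has_bochner_integral lborel (\<lambda>y. ln (norm (z - y)) * \<rho> y) (2 * pi * log_potential \<rho> z)" for z
        using int[of z] by (simp add: has_bochner_integral_iff log_potential_def)
      have 2: "has_bochner_integral lborel (\<lambda>y. 2 * pi * (h \<bullet> (\<rho> y *\<^sub>R grad_kernel (x - y)))) (2 * pi * (h \<bullet> field \<rho> x))"
        unfolding field_def
        by (intro has_bochner_integral_mult_right has_bochner_integral_inner_right has_bochner_integral_integrable
            integrable_field_integrand) (use q in auto)
      have eq: "ln (norm (x + h - y)) * \<rho> y - ln (norm (x - y)) * \<rho> y
          - 2 * pi * (h \<bullet> (\<rho> y *\<^sub>R grad_kernel (x - y))) = \<rho> y * R y" for y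
      proof -
        have "2 * pi * (h \<bullet> (\<rho> y *\<^sub>R grad_kernel (x - y))) = \<rho> y * (h \<bullet> (x - y) / (norm (x - y))\<^sup>2)"
          by (simp add: grad_kernel_def del: inner_diff_right)
        then show ?thesis unfolding R_def by (simp only: right_diff_distrib mult.commute[of _ "\<rho> y"])
      qed
      have "has_bochner_integral lborel
         (\<lambda>y. ln (norm (x + h - y)) * \<rho> y - ln (norm (x - y)) * \<rho> y - 2 * pi * (h \<bullet> (\<rho> y *\<^sub>R grad_kernel (x - y))))
         (2 * pi * log_potential \<rho> (x + h) - 2 * pi * log_potential \<rho> x - 2 * pi * (h \<bullet> field \<rho> x))"
        by (intro has_bochner_integral_diff 1 2)
      then show ?thesis
        unfolding eq by (simp only: right_diff_distrib)
    qed
    have le: "AE y in lborel. norm (\<rho> y * R y) \<le> q * U y"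
    proof -
      have "AE y in lborel. y \<noteq> x \<and> y \<noteq> x + h"
        by (intro AE_conjI AE_lborel_singleton)
      then show ?thesis
      proof eventually_elim
        case (elim y)
        have a: "x - y \<noteq> 0" "x - y + h \<noteq> 0" using elim by (auto simp: algebra_simps)
        have eq: "x + h - y = x - y + h" by simp
        have w: "0 \<le> tail_weight y" "tail_weight y \<le> 1"
          by (auto simp: tail_weight_nonneg tail_weight_le_1)
        have "tail_weight y * \<bar>R y\<bar> \<le> U y"
        proof (cases "2 * r \<le> norm (x - y)")
          case True
          have R: "\<bar>R y\<bar> \<le> 13 * r\<^sup>2 / (norm (x - y))\<^sup>2"
            using ln_norm_remainder_far[of "x - y" h] a True by (simp add: R_def eq r_def)
          show ?thesis
          proof (cases "norm (x - y) < 1")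
            case True
            have "tail_weight y * \<bar>R y\<bar> \<le> \<bar>R y\<bar>" using w by (intro mult_left_le_one_le) auto
            also have "\<dots> \<le> U y"
              unfolding U_def using R True \<open>2 * r \<le> norm (x - y)\<close> r w
              by (auto simp: distrib_left intro!: add_increasing2)
            finally show ?thesis .
          next
            case False
            then have "1 \<le> (norm (x - y))\<^sup>2" by simp
            then have "13 * r\<^sup>2 / (norm (x - y))\<^sup>2 \<le> 13 * r\<^sup>2"
              by (simp add: divide_le_eq mult_le_cancel_left1)
            then have "tail_weight y * \<bar>R y\<bar> \<le> tail_weight y * (13 * r\<^sup>2)"
              using R w by (intro mult_left_mono) auto
            also have "\<dots> \<le> U y"
              unfolding U_def using r w False by (auto intro!: add_increasing2)
            finally show ?thesis .
          qed
        next
          case False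
          have "norm (x - y + h) < 3 * r"
            using False norm_triangle_ineq[of "x - y" h] by (simp add: r_def)
          have "tail_weight y * \<bar>R y\<bar> \<le> \<bar>R y\<bar>" using w by (intro mult_left_le_one_le) auto
          also have "\<dots> \<le> r * (2 / norm (x - y) + 1 / norm (x - y + h))"
            using ln_norm_remainder_near[OF a] by (simp add: R_def eq r_def)
          also have "\<dots> \<le> U y"
          proof -
            have "0 \<le> 13 * r\<^sup>2 * tail_weight y" using w by simp
            then show ?thesis
              unfolding U_def eq using False \<open>norm (x - y + h) < 3 * r\<close>
                by (simp add: distrib_left mult.commute mult.left_commute)
          qed
          finally show ?thesis .
        qed
        then have "q * (tail_weight y * \<bar>R y\<bar>) \<le> q * U y" using q0 by (rule mult_left_mono)
        moreover have "\<bar>\<rho> y\<bar> * \<bar>R y\<bar> \<le> (q * tail_weight y) * \<bar>R y\<bar>"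
          using q by (intro mult_right_mono) auto
        ultimately show ?case by (simp add: abs_mult mult.assoc)
      qed
    qed
    define L where "L = log_potential \<rho> (x + h) - log_potential \<rho> x - h \<bullet> field \<rho> x"
    have "2 * pi * \<bar>L\<bar> = \<bar>LINT y|lborel. \<rho> y * R y\<bar>"
      using intR by (simp add: has_bochner_integral_iff L_def abs_mult)
    also have "\<dots> \<le> (LINT y|lborel. norm (\<rho> y * R y))"
      using integral_norm_bound[of lborel "\<lambda>y. \<rho> y * R y"] by simp
    also have "\<dots> \<le> (LINT y|lborel. q * U y)"
      by (rule integral_mono_AE[OF _ _ le])
        (use intR hU in \<open>auto simp: has_bochner_integral_iff simp del: norm_mult real_norm_def intro: integrable_norm\<close>)
    also have "\<dots> = q * r\<^sup>2 * (14 * pi + 26 * pi * ln (1 / (2 * r)) + 13 * m)"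
      using hU by (simp add: has_bochner_integral_iff power2_eq_square algebra_simps)
    finally have *: "2 * pi * \<bar>L\<bar> \<le> q * r\<^sup>2 * (14 * pi + 26 * pi * ln (1 / (2 * r)) + 13 * m)" .
    have "1 * \<bar>L\<bar> \<le> 2 * pi * \<bar>L\<bar>"
      using pi_gt3 by (intro mult_right_mono) auto
    with * show ?thesis by (simp add: L_def r_def)
  qed
  have lim: "((\<lambda>h. q * norm h * (14 * pi + 26 * pi * ln (1 / (2 * norm h)) + 13 * m)) \<longlongrightarrow> 0) (at (0::real^2))"
  proof (rule filterlim_compose[where g="\<lambda>r. q * r * (14 * pi + 26 * pi * ln (1 / (2 * r)) + 13 * m)"])
    show "((\<lambda>r. q * r * (14 * pi + 26 * pi * ln (1 / (2 * r)) + 13 * m)) \<longlongrightarrow> 0) (at_right 0)"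
      by real_asymp
    show "filterlim norm (at_right 0) (at (0::real^2))"
      by (auto simp: filterlim_at eventually_at intro!: tendsto_norm_zero exI[of _ 1])
  qed
  show ?thesis
    unfolding has_derivative_at
  proof
    show "bounded_linear (\<lambda>h. h \<bullet> field \<rho> x)" by (rule bounded_linear_inner_left)
    show "(\<lambda>h. norm (log_potential \<rho> (x + h) - log_potential \<rho> x - h \<bullet> field \<rho> x) / norm h) \<midarrow>0\<rightarrow> 0"
    proof (rule Lim_null_comparison[OF _ lim])
      show "\<forall>\<^sub>F h in at 0. norm (norm (log_potential \<rho> (x + h) - log_potential \<rho> x - h \<bullet> field \<rho> x) / norm h)
          \<le> q * norm h * (14 * pi + 26 * pi * ln (1 / (2 * norm h)) + 13 * m)"
        unfolding eventually_at
      proof (intro exI[of _ "1/3"] conjI ballI impI)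
        fix h :: "real^2" assume h: "h \<noteq> 0 \<and> dist h 0 < 1 / 3"
        then show "norm (norm (log_potential \<rho> (x + h) - log_potential \<rho> x - h \<bullet> field \<rho> x) / norm h)
          \<le> q * norm h * (14 * pi + 26 * pi * ln (1 / (2 * norm h)) + 13 * m)"
          using bound[of h] by (simp add: divide_le_eq power2_eq_square mult_ac)
      qed auto
    qed
  qed
qed

section \<open>Existence of trajectories\<close>

text \<open>Picard--Lindeloef by Banach's fixed point theorem, without any restriction on the length of the interval.\<close>

lemma ode_exists_lipschitz:
  fixes g :: "real \<Rightarrow> 'a::euclidean_space \<Rightarrow> 'a"
  assumes T: "0 \<le> T"
    and cont: "continuous_on ({0..T} \<times> UNIV) (\<lambda>(t, x). g t x)"
    and bnd: "\<And>t x. t \<in> {0..T} \<Longrightarrow> norm (g t x) \<le> C"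
    and lip: "\<And>t x y. t \<in> {0..T} \<Longrightarrow> norm (g t x - g t y) \<le> L * norm (x - y)"
    and L: "0 \<le> L"
  shows "\<exists>z. z 0 = z0 \<and> (\<forall>t\<in>{0..T}. (z has_vector_derivative g t (z t)) (at t within {0..T}))"
proof -
  \<comment> \<open>The unknown is \<open>e\<^sup>-\<^sup>\<gamma>\<^sup>t z(t)\<close>: for this weight the Picard operator contracts the supremum norm with factor 1/2.\<close>
  define \<gamma> where "\<gamma> = 2 * (L + 1)"
  have \<gamma>: "0 < \<gamma>" using L by (simp add: \<gamma>_def)
  \<comment> \<open>Clamping the time lets bounded continuous functions on the whole line serve as the Banach space.\<close>
  define c where "c = (\<lambda>t. max 0 (min T t))"
  have c: "c t \<in> {0..T}" for t using T by (auto simp: c_def)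
  have c_id: "c t = t" if "t \<in> {0..T}" for t using that by (auto simp: c_def)
  have C: "0 \<le> C" using order_trans[OF norm_ge_zero bnd[of 0 0]] T by auto
  have gcont: "continuous_on {0..T} (\<lambda>r. g r (exp (\<gamma> * r) *\<^sub>R apply_bcontfun w r))" for w :: "real \<Rightarrow>\<^sub>C 'a"
    by (rule continuous_on_compose2[OF cont, where f="\<lambda>r. (r, exp (\<gamma> * r) *\<^sub>R apply_bcontfun w r)", simplified])
      (auto intro!: continuous_intros)
  define I where "I = (\<lambda>(w :: real \<Rightarrow>\<^sub>C 'a) t. integral {0..t} (\<lambda>r. g r (exp (\<gamma> * r) *\<^sub>R apply_bcontfun w r)))"
  have int: "(\<lambda>r. g r (exp (\<gamma> * r) *\<^sub>R apply_bcontfun w r)) integrable_on {0..t}" if "t \<in> {0..T}" for w t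
    using that by (intro integrable_continuous_real continuous_on_subset[OF gcont]) auto
  have Icont: "continuous_on {0..T} (I w)" for w
    unfolding I_def using int[of T w] T by (intro indefinite_integral_continuous_1) auto
  have Ibnd: "norm (I w t) \<le> C * T" if "t \<in> {0..T}" for w t
  proof -
    have "norm (I w t) \<le> integral {0..t} (\<lambda>r. C)"
      unfolding I_def using that bnd by (intro integral_norm_bound_integral int) auto
    also have "\<dots> \<le> C * T" using that C by (simp add: mult.commute mult_left_mono)
    finally show ?thesis .
  qed
  define \<Phi>0 where "\<Phi>0 = (\<lambda>w t. exp (- \<gamma> * c t) *\<^sub>R (z0 + I w (c t)))"
  have \<Phi>0: "\<Phi>0 w \<in> bcontfun" for w
  proof (rule bcontfun_normI)
    have "continuous_on UNIV c" unfolding c_def by (intro continuous_intros)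
    then show "continuous_on UNIV (\<Phi>0 w)"
      unfolding \<Phi>0_def
      by (intro continuous_intros continuous_on_compose2[OF Icont, where f=c]) (use c in auto)
    fix t
    have "norm (\<Phi>0 w t) = exp (- \<gamma> * c t) * norm (z0 + I w (c t))" by (simp add: \<Phi>0_def)
    also have "\<dots> \<le> 1 * (norm z0 + C * T)"
      using c[of t] \<gamma> Ibnd[OF c, of w t]
      by (intro mult_mono order_trans[OF norm_triangle_ineq] add_mono) auto
    finally show "norm (\<Phi>0 w t) \<le> norm z0 + C * T" by simp
  qed
  define \<Phi> where "\<Phi> = (\<lambda>w. Bcontfun (\<Phi>0 w))"
  have ap: "apply_bcontfun (\<Phi> w) t = \<Phi>0 w t" for w t
    by (simp add: \<Phi>_def Bcontfun_inverse \<Phi>0)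
  have contr: "dist (\<Phi> w1) (\<Phi> w2) \<le> 1 / 2 * dist w1 w2" for w1 w2
  proof (rule dist_bound)
    fix t
    define d where "d = dist w1 w2"
    have d: "0 \<le> d" by (simp add: d_def)
    have "norm (I w1 (c t) - I w2 (c t)) \<le> integral {0..c t} (\<lambda>r. L * d * exp (\<gamma> * r))"
    proof -
      have "I w1 (c t) - I w2 (c t) = integral {0..c t} (\<lambda>r. g r (exp (\<gamma> * r) *\<^sub>R apply_bcontfun w1 r) - g r (exp (\<gamma> * r) *\<^sub>R apply_bcontfun w2 r))"
        unfolding I_def by (rule integral_diff[symmetric]) (use int c in auto)
      also have "norm \<dots> \<le> integral {0..c t} (\<lambda>r. L * d * exp (\<gamma> * r))"
      proof (rule integral_norm_bound_integral)
        show "(\<lambda>r. L * d * exp (\<gamma> * r)) integrable_on {0..c t}"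
          by (intro integrable_continuous_real continuous_intros)
        fix r assume r: "r \<in> {0..c t}"
        then have "norm (g r (exp (\<gamma> * r) *\<^sub>R apply_bcontfun w1 r) - g r (exp (\<gamma> * r) *\<^sub>R apply_bcontfun w2 r))
           \<le> L * norm (exp (\<gamma> * r) *\<^sub>R apply_bcontfun w1 r - exp (\<gamma> * r) *\<^sub>R apply_bcontfun w2 r)"
          using c[of t] by (intro lip) auto
        also have "\<dots> = L * (exp (\<gamma> * r) * dist (apply_bcontfun w1 r) (apply_bcontfun w2 r))"
          by (simp add: dist_norm flip: scaleR_diff_right)
        also have "\<dots> \<le> L * (exp (\<gamma> * r) * d)"
          unfolding d_def using L by (intro mult_left_mono dist_bounded) auto
        finally show "norm (g r (exp (\<gamma> * r) *\<^sub>R apply_bcontfun w1 r) - g r (exp (\<gamma> * r) *\<^sub>R apply_bcontfun w2 r))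
           \<le> L * d * exp (\<gamma> * r)" by (simp add: mult_ac)
      qed (use int c in \<open>auto intro!: integrable_diff\<close>)
      finally show ?thesis .
    qed
    also have "\<dots> = L * d * ((exp (\<gamma> * c t) - 1) / \<gamma>)"
    proof (rule integral_unique)
      have "((\<lambda>r. L * d * exp (\<gamma> * r)) has_integral L * d * (exp (\<gamma> * c t) / \<gamma>) - L * d * (exp (\<gamma> * 0) / \<gamma>)) {0..c t}"
        using c[of t] \<gamma>
        by (intro fundamental_theorem_of_calculus)
          (auto intro!: derivative_eq_intros simp flip: has_real_derivative_iff_has_vector_derivative)
      then show "((\<lambda>r. L * d * exp (\<gamma> * r)) has_integral L * d * ((exp (\<gamma> * c t) - 1) / \<gamma>)) {0..c t}"
        by (simp add: diff_divide_distrib right_diff_distrib)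
    qed
    also have "\<dots> \<le> L * d * (exp (\<gamma> * c t) / \<gamma>)"
      using L d \<gamma> by (intro mult_left_mono divide_right_mono) auto
    finally have *: "norm (I w1 (c t) - I w2 (c t)) \<le> L * d * (exp (\<gamma> * c t) / \<gamma>)" .
    have "dist (apply_bcontfun (\<Phi> w1) t) (apply_bcontfun (\<Phi> w2) t) = exp (- \<gamma> * c t) * norm (I w1 (c t) - I w2 (c t))"
      by (simp add: ap \<Phi>0_def dist_norm flip: scaleR_diff_right)
    also have "\<dots> \<le> exp (- \<gamma> * c t) * (L * d * (exp (\<gamma> * c t) / \<gamma>))"
      using * by (intro mult_left_mono) auto
    also have "\<dots> = (L / \<gamma>) * d"
      by (simp add: exp_minus field_simps)
    also have "\<dots> \<le> 1 / 2 * d"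
      using L \<gamma> d by (intro mult_right_mono) (auto simp: \<gamma>_def field_simps)
    finally show "dist (apply_bcontfun (\<Phi> w1) t) (apply_bcontfun (\<Phi> w2) t) \<le> 1 / 2 * dist w1 w2"
      by (simp add: d_def)
  qed
  have "\<exists>!w. \<Phi> w = w"
    by (rule banach_fix_type[of "1/2"]) (use contr in auto)
  then obtain w where w: "\<Phi> w = w" by auto
  define z where "z = (\<lambda>t. exp (\<gamma> * t) *\<^sub>R apply_bcontfun w t)"
  have z: "z t = z0 + I w t" if "t \<in> {0..T}" for t
  proof -
    have "apply_bcontfun w t = exp (- \<gamma> * t) *\<^sub>R (z0 + I w t)"
      using ap[of w t] c_id[OF that] by (simp add: w \<Phi>0_def)
    then show ?thesis by (simp add: z_def flip: exp_add)
  qed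
  have "(z has_vector_derivative g t (z t)) (at t within {0..T})" if t: "t \<in> {0..T}" for t
  proof -
    have "(I w has_vector_derivative g t (z t)) (at t within {0..T})"
      unfolding I_def z_def by (rule integral_has_vector_derivative[OF gcont t])
    then have "((\<lambda>t. z0 + I w t) has_vector_derivative g t (z t)) (at t within {0..T})"
      by (auto intro!: derivative_eq_intros)
    then show ?thesis
      by (rule has_vector_derivative_transform[OF t z, rotated])
  qed
  moreover have "z 0 = z0"
    using z[of 0] T by (simp add: I_def)
  ultimately show ?thesis by blast
qed

text \<open>A bounded field moves a point by at most \<open>C T\<close>, so composing it with the projection onto a large ball makes it globally Lipschitz without changing the solution. Time is reversed because trajectories are prescribed at their end.\<close>

lemma ode_exists_terminal:
  fixes g :: "real \<Rightarrow> 'a::euclidean_space \<Rightarrow> 'a"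
  assumes T: "0 \<le> T"
    and cont: "continuous_on ({0..T} \<times> UNIV) (\<lambda>(t, x). g t x)"
    and bnd: "\<And>t x. t \<in> {0..T} \<Longrightarrow> norm (g t x) \<le> C"
    and lip: "\<And>R. \<exists>L. \<forall>t\<in>{0..T}. \<forall>x\<in>cball 0 R. \<forall>y\<in>cball 0 R. norm (g t x - g t y) \<le> L * norm (x - y)"
  shows "\<exists>z. z T = z1 \<and> (\<forall>t\<in>{0..T}. (z has_vector_derivative g t (z t)) (at t within {0..T}))"
proof -
  have C: "0 \<le> C" using order_trans[OF norm_ge_zero bnd[of 0 0]] T by auto
  define R where "R = norm z1 + C * T"
  have R: "0 \<le> R" using C T by (simp add: R_def)
  obtain L0 where L0: "\<forall>t\<in>{0..T}. \<forall>x\<in>cball 0 R. \<forall>y\<in>cball 0 R. norm (g t x - g t y) \<le> L0 * norm (x - y)"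
    using lip by blast
  define L where "L = max 0 L0"
  define pr where "pr = closest_point (cball (0::'a) R)"
  have pr_in: "pr x \<in> cball 0 R" for x
    unfolding pr_def using R by (intro closest_point_in_set) auto
  have pr_id: "pr x = x" if "x \<in> cball 0 R" for x
    unfolding pr_def using that by (rule closest_point_self)
  have pr_lip: "norm (pr x - pr y) \<le> norm (x - y)" for x y
    using closest_point_lipschitz[of "cball (0::'a) R" x y] R by (simp add: pr_def dist_norm)
  have pr_cont: "continuous_on UNIV pr"
    unfolding pr_def using R by (intro continuous_on_closest_point) auto
  define h where "h = (\<lambda>t x. - g (T - t) (pr x))"
  have "\<exists>z. z 0 = z1 \<and> (\<forall>t\<in>{0..T}. (z has_vector_derivative h t (z t)) (at t within {0..T}))"
  proof (rule ode_exists_lipschitz[OF T, of h C L])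
    have "continuous_on ({0..T} \<times> UNIV) (\<lambda>p. (\<lambda>(t, x). g t x) (T - fst p, pr (snd p)))"
      by (rule continuous_on_compose2[OF cont])
        (auto intro!: continuous_intros continuous_on_compose2[OF pr_cont])
    then show "continuous_on ({0..T} \<times> UNIV) (\<lambda>(t, x). h t x)"
      by (auto simp: h_def case_prod_beta intro!: continuous_intros)
    show "norm (h t x) \<le> C" if "t \<in> {0..T}" for t x
      using that bnd by (simp add: h_def)
    show "norm (h t x - h t y) \<le> L * norm (x - y)" if "t \<in> {0..T}" for t x y
    proof -
      have "norm (h t x - h t y) = norm (g (T - t) (pr x) - g (T - t) (pr y))"
        by (simp add: h_def norm_minus_commute)
      also have "\<dots> \<le> L0 * norm (pr x - pr y)"
        using L0 that pr_in by auto
      also have "\<dots> \<le> L * norm (pr x - pr y)"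
        by (intro mult_right_mono) (auto simp: L_def)
      also have "\<dots> \<le> L * norm (x - y)"
        by (intro mult_left_mono pr_lip) (auto simp: L_def)
      finally show ?thesis .
    qed
  qed (simp add: L_def)
  then obtain y where y0: "y 0 = z1"
    and y: "\<And>t. t \<in> {0..T} \<Longrightarrow> (y has_vector_derivative h t (y t)) (at t within {0..T})" by blast
  have y_in: "y t \<in> cball 0 R" if t: "t \<in> {0..T}" for t
  proof -
    have "norm (y t - y 0) \<le> C * norm (t - 0)"
    proof (rule differentiable_bound[of "{0..T}"])
      show "(y has_derivative (\<lambda>s. s *\<^sub>R h r (y r))) (at r within {0..T})" if "r \<in> {0..T}" for r
        using y[OF that] by (simp add: has_vector_derivative_def)
      show "onorm (\<lambda>s. s *\<^sub>R h r (y r)) \<le> C" if "r \<in> {0..T}" for r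
        using that bnd by (intro onorm_le) (auto simp: h_def mult.commute[of C] intro!: mult_left_mono)
    qed (use t T in auto)
    also have "\<dots> \<le> C * T" using t C by (auto intro: mult_left_mono)
    finally show ?thesis
      using norm_triangle_sub[of "y t" z1] by (simp add: R_def y0 algebra_simps)
  qed
  define z where "z = (\<lambda>t. y (T - t))"
  have "(z has_vector_derivative g t (z t)) (at t within {0..T})" if t: "t \<in> {0..T}" for t
  proof -
    have im: "(\<lambda>t. T - t) ` {0..T} = {0..T}" by (auto simp: image_iff intro: bexI[of _ "T - _"])
    have "((y \<circ> (\<lambda>t. T - t)) has_vector_derivative (- 1) *\<^sub>R h (T - t) (y (T - t))) (at t within {0..T})"
    proof (rule vector_diff_chain_within)
      show "((\<lambda>t. T - t) has_vector_derivative - 1) (at t within {0..T})"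
        by (auto intro!: derivative_eq_intros)
      show "(y has_vector_derivative h (T - t) (y (T - t))) (at (T - t) within (\<lambda>t. T - t) ` {0..T})"
        unfolding im using t by (intro y) auto
    qed
    moreover have "(- 1) *\<^sub>R h (T - t) (y (T - t)) = g t (z t)"
      using pr_id[OF y_in[of "T - t"]] t by (simp add: h_def z_def)
    ultimately show ?thesis by (simp add: z_def comp_def)
  qed
  moreover have "z T = z1" by (simp add: z_def y0)
  ultimately show ?thesis by blast
qed

section \<open>Trajectories in a small log-Lipschitz field\<close>

lemma vector_increment_le:
  fixes f :: "real \<Rightarrow> 'a::real_normed_vector"
  assumes "0 \<le> a" "a \<le> b" "b \<le> T"
    and f: "\<And>t. t \<in> {0..T} \<Longrightarrow> (f has_vector_derivative f' t) (at t within {0..T})"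
    and \<phi>: "\<And>t. (\<phi> has_real_derivative \<phi>' t) (at t)"
    and le: "\<And>t. a < t \<Longrightarrow> t < b \<Longrightarrow> norm (f' t) \<le> \<phi>' t"
  shows "norm (f b - f a) \<le> \<phi> b - \<phi> a"
proof (cases "a = b")
  case False
  have "continuous_on {0..T} f"
    using f by (rule continuous_on_vector_derivative)
  then have "continuous_on {a..b} f"
    by (rule continuous_on_subset) (use assms in auto)
  moreover have "continuous_on {a..b} \<phi>"
    using \<phi> by (intro DERIV_continuous_on) (auto intro: has_field_derivative_at_within)
  moreover have "(f has_vector_derivative f' t) (at t)" if "a < t" "t < b" for t
    using f[of t] that assms by (simp add: at_within_Icc_at)
  ultimately show ?thesis
    by (intro differentiable_bound_general[where f'=f' and \<phi>'=\<phi>'])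
      (use assms False in \<open>auto simp flip: has_real_derivative_iff_has_vector_derivative\<close>)
qed simp

text \<open>The characteristics of the Vlasov equation with the linear flow divided out: if \<open>S\<close>, \<open>U\<close> are the \<open>s\<close>- and \<open>u\<close>-components of a characteristic, then \<open>\<sigma> = e\<^sup>t S\<close>, \<open>\<nu> = e\<^sup>-\<^sup>t U\<close>, and \<open>\<nu> + e\<^sup>-\<^sup>2\<^sup>t \<sigma>\<close> is the position \<open>S + U\<close> in units of \<open>e\<^sup>t\<close>.\<close>

definition trajectory ::
  "real \<Rightarrow> (real \<Rightarrow> real^2 \<Rightarrow> real^2) \<Rightarrow> real \<Rightarrow> (real \<Rightarrow> real^2) \<Rightarrow> (real \<Rightarrow> real^2) \<Rightarrow> bool" where
  "trajectory \<mu> H T \<sigma> \<nu> \<longleftrightarrow> (\<forall>t\<in>{0..T}.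
     (\<sigma> has_vector_derivative (\<mu> / 2) *\<^sub>R H t (\<nu> t + exp (- 2 * t) *\<^sub>R \<sigma> t)) (at t within {0..T}) \<and>
     (\<nu> has_vector_derivative (- (\<mu> / 2) * exp (- 2 * t)) *\<^sub>R H t (\<nu> t + exp (- 2 * t) *\<^sub>R \<sigma> t)) (at t within {0..T}))"

lemma trajectory_restrict:
  assumes "trajectory \<mu> H T \<sigma> \<nu>" "T' \<le> T"
  shows "trajectory \<mu> H T' \<sigma> \<nu>"
  using assms unfolding trajectory_def
  by (auto intro: has_vector_derivative_within_subset[of _ _ _ "{0..T}"])

lemma ln_one_over_exp: "ln (1 / exp (- x)) = (x :: real)"
  by (simp add: ln_div)

text \<open>The displacement in \<open>\<sigma>\<close> of an ideal particle that sits at \<open>w\<close> forever. It is the main part of the displacement of every trajectory near \<open>w\<close>, because \<open>\<nu>\<close> is almost constant.\<close>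

definition drift :: "real \<Rightarrow> (real \<Rightarrow> real^2 \<Rightarrow> real^2) \<Rightarrow> real^2 \<Rightarrow> real \<Rightarrow> real^2" where
  "drift \<mu> H w t = (\<mu> / 2) *\<^sub>R integral {0..t} (\<lambda>r. H r w)"

lemma drift_derivative:
  assumes "continuous_on {0..T} (\<lambda>r. H r w)" "t \<in> {0..T}"
  shows "(drift \<mu> H w has_vector_derivative (\<mu> / 2) *\<^sub>R H t w) (at t within {0..T})"
  unfolding drift_def using integral_has_vector_derivative[OF assms]
  by (auto intro!: derivative_eq_intros)

text \<open>The bounds are required before the time \<open>T\<close> only, so that they can be used for a bootstrap that has been carried out up to \<open>T\<close>.\<close>

locale small_field =
  fixes \<mu> k T :: real and H :: "real \<Rightarrow> real^2 \<Rightarrow> real^2"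
  assumes mu: "\<bar>\<mu>\<bar> = 1" and T: "0 \<le> T" and k: "0 \<le> k" "k \<le> 1 / 1000"
    and H_le: "\<And>t y. 0 \<le> t \<Longrightarrow> t < T \<Longrightarrow> norm (H t y) \<le> k"
    and H_log_lipschitz: "\<And>t \<eta> y1 y2. 0 \<le> t \<Longrightarrow> t < T \<Longrightarrow> 0 < \<eta> \<Longrightarrow> \<eta> \<le> 1 \<Longrightarrow>
      norm (H t y1 - H t y2) \<le> k * (\<eta> + (1 + ln (1 / \<eta>)) * norm (y1 - y2))"
    and H_cont: "\<And>w. continuous_on {0..T} (\<lambda>t. H t w)"
begin

lemma norm_drift_le:
  assumes "t \<in> {0..T}"
  shows "norm (drift \<mu> H w t) \<le> k / 2 * t"
proof -
  have "norm (drift \<mu> H w t - drift \<mu> H w 0) \<le> k / 2 * t - k / 2 * 0"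
  proof (rule vector_increment_le[where T=T and \<phi>'="\<lambda>_. k / 2"])
    show "norm ((\<mu> / 2) *\<^sub>R H r w) \<le> k / 2" if "0 < r" "r < t" for r
      using H_le[of r w] that assms mu by simp
  qed (use assms in \<open>auto intro!: drift_derivative H_cont derivative_eq_intros\<close>)
  then show ?thesis by (simp add: drift_def)
qed

lemma norm_nu_increment_le:
  assumes tr: "trajectory \<mu> H T \<sigma> \<nu>" and \<tau>: "\<tau> \<in> {0..T}"
  shows "norm (\<nu> \<tau> - \<nu> T) \<le> 1 / 4 * exp (- 2 * \<tau>)"
proof -
  have "norm (\<nu> T - \<nu> \<tau>) \<le> - (k / 4) * exp (- 2 * T) - (- (k / 4) * exp (- 2 * \<tau>))"
  proof (rule vector_increment_le[where T=T and \<phi>'="\<lambda>r. k / 2 * exp (- 2 * r)"])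
    show "(\<nu> has_vector_derivative (- (\<mu> / 2) * exp (- 2 * t)) *\<^sub>R H t (\<nu> t + exp (- 2 * t) *\<^sub>R \<sigma> t)) (at t within {0..T})"
      if "t \<in> {0..T}" for t
      using tr that unfolding trajectory_def by blast
    show "norm ((- (\<mu> / 2) * exp (- 2 * t)) *\<^sub>R H t (\<nu> t + exp (- 2 * t) *\<^sub>R \<sigma> t)) \<le> k / 2 * exp (- 2 * t)"
      if "\<tau> < t" "t < T" for t
      using H_le[of t "\<nu> t + exp (- 2 * t) *\<^sub>R \<sigma> t"] that \<tau> mu
      by (simp add: abs_mult)
  qed (use \<tau> in \<open>auto intro!: derivative_eq_intros\<close>)
  also have "\<dots> \<le> k / 4 * exp (- 2 * \<tau>)"
    using k by (simp add: mult_nonneg_nonneg)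
  also have "\<dots> \<le> 1 / 4 * exp (- 2 * \<tau>)"
    using k by (intro mult_right_mono) auto
  finally show ?thesis by (simp add: norm_minus_commute)
qed

text \<open>The deviation \<open>e\<close> from the path \<open>s + drift\<close> has derivative \<open>(\<mu>/2) (H(r,y) - H(r,w))\<close>, and \<open>y - w\<close> is exponentially small up to a factor \<open>B + |s| + max |e|\<close>. The factor \<open>1 + 2r\<close> that comes from the logarithm is harmless against \<open>e\<^sup>-\<^sup>r\<close>, so \<open>e\<close> varies by at most a small multiple of that factor.\<close>

lemma shadowing:
  assumes tr: "trajectory \<mu> H T \<sigma> \<nu>" and B: "0 \<le> B"
    and \<nu>: "norm (\<nu> T - w) \<le> exp (- T) * (B + norm s)" and \<tau>: "\<tau> \<in> {0..T}"
  defines "e \<equiv> \<lambda>t. \<sigma> t - s - drift \<mu> H w t"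
  shows "norm (e \<tau>) \<le> norm (e T) + 5 * k * exp (- \<tau> / 2) * (2 * B + 4 * norm s + 2 + 2 * norm (e T))"
proof -
  define y where "y = (\<lambda>t. \<nu> t + exp (- 2 * t) *\<^sub>R \<sigma> t)"
  have e': "(e has_vector_derivative (\<mu> / 2) *\<^sub>R (H t (y t) - H t w)) (at t within {0..T})" if "t \<in> {0..T}" for t
    using tr that drift_derivative[where \<mu>=\<mu> and w=w and H=H, OF H_cont that] unfolding e_def trajectory_def y_def
    by (auto intro!: derivative_eq_intros simp: scaleR_diff_right)
  have "continuous_on {0..T} e"
    using e' by (rule continuous_on_vector_derivative)
  then have "continuous_on {0..T} (\<lambda>t. norm (e t))"
    by (intro continuous_intros)
  \<comment> \<open>The maximum of \<open>|e|\<close> is estimated in terms of itself, with a small factor.\<close>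
  then obtain m where m: "m \<in> {0..T}" "\<And>t. t \<in> {0..T} \<Longrightarrow> norm (e t) \<le> norm (e m)"
    using continuous_attains_sup[of "{0..T}" "\<lambda>t. norm (e t)"] T by auto
  define X where "X = B + 2 * norm s + 1 + norm (e m)"
  have X: "1 \<le> X" using B by (simp add: X_def)
  have y_w: "norm (y t - w) \<le> exp (- t) * X" if t: "t \<in> {0..T}" for t
  proof -
    have e1: "exp (- 2 * t) \<le> exp (- t)" "t * exp (- 2 * t) \<le> exp (- t)"
    proof -
      have "t * exp (- 2 * t) \<le> exp t * exp (- 2 * t)"
        using exp_ge_add_one_self[of t] by (intro mult_right_mono) (linarith, simp)
      also have "\<dots> = exp (- t)" by (simp flip: exp_add)
      finally show "t * exp (- 2 * t) \<le> exp (- t)" .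
    qed (use t in simp)
    have "y t - w = (\<nu> t - \<nu> T) + (\<nu> T - w) + exp (- 2 * t) *\<^sub>R (e t + s + drift \<mu> H w t)"
      by (simp add: y_def e_def)
    also have "norm \<dots> \<le> norm (\<nu> t - \<nu> T) + norm (\<nu> T - w) + exp (- 2 * t) * (norm (e t) + norm s + norm (drift \<mu> H w t))"
      using norm_triangle_ineq[of "e t + s" "drift \<mu> H w t"] norm_triangle_ineq[of "e t" s]
      by (intro order_trans[OF norm_triangle_ineq] add_mono norm_triangle_ineq) (auto intro!: mult_left_mono)
    also have "\<dots> \<le> 1 / 4 * exp (- t) + exp (- t) * (B + norm s) + (exp (- t) * (norm (e m) + norm s) + 1 / 2 * exp (- t))"
    proof (intro add_mono)
      show "norm (\<nu> t - \<nu> T) \<le> 1 / 4 * exp (- t)"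
        using norm_nu_increment_le[OF tr t] e1(1) by linarith
      show "norm (\<nu> T - w) \<le> exp (- t) * (B + norm s)"
        using t B by (intro order_trans[OF \<nu>] mult_right_mono) auto
      have "exp (- 2 * t) * (norm (e t) + norm s + norm (drift \<mu> H w t))
         \<le> exp (- 2 * t) * ((norm (e m) + norm s) + 1 / 2 * t)"
      proof (intro mult_left_mono add_mono)
        have "k / 2 * t \<le> 1 / 2 * t" using k t by (intro mult_right_mono) auto
        then show "norm (drift \<mu> H w t) \<le> 1 / 2 * t" using norm_drift_le[OF t, of w] by simp
      qed (use m t in auto)
      also have "\<dots> = exp (- 2 * t) * (norm (e m) + norm s) + 1 / 2 * (t * exp (- 2 * t))"
        by (simp add: algebra_simps)
      also have "\<dots> \<le> exp (- t) * (norm (e m) + norm s) + 1 / 2 * exp (- t)"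
        using e1 by (intro add_mono mult_right_mono mult_left_mono) auto
      finally show "exp (- 2 * t) * (norm (e t) + norm s + norm (drift \<mu> H w t))
         \<le> exp (- t) * (norm (e m) + norm s) + 1 / 2 * exp (- t)" .
    qed
    also have "\<dots> \<le> exp (- t) * X"
      by (simp add: X_def algebra_simps)
    finally show ?thesis .
  qed
  have incr: "norm (e t - e T) \<le> 5 * k * exp (- t / 2) * X" if t: "t \<in> {0..T}" for t
  proof -
    have "norm (e T - e t) \<le> - (5 * k * X) * exp (- T / 2) - (- (5 * k * X) * exp (- t / 2))"
    proof (rule vector_increment_le[where T=T and \<phi>'="\<lambda>r. 5 / 2 * k * X * exp (- r / 2)", OF _ _ _ e'])
      fix r assume r: "t < r" "r < T"
      then have r': "r \<in> {0..T}" and r0: "0 < r" using t by auto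
      have "norm (H r (y r) - H r w) \<le> k * (exp (- 2 * r) + (1 + ln (1 / exp (- 2 * r))) * norm (y r - w))"
        by (rule H_log_lipschitz) (use r0 r in auto)
      also have "\<dots> \<le> k * (exp (- 2 * r) + (1 + 2 * r) * (exp (- r) * X))"
        using k y_w[OF r'] r0 ln_one_over_exp[of "2 * r"] by (intro mult_left_mono mult_mono add_mono) auto
      also have "\<dots> \<le> k * (exp (- r / 2) * X + 4 * exp (r / 2) * (exp (- r) * X))"
      proof (intro mult_left_mono add_mono mult_right_mono)
        have "exp (- 2 * r) * 1 \<le> exp (- r / 2) * X"
          using r0 X by (intro mult_mono) auto
        then show "exp (- 2 * r) \<le> exp (- r / 2) * X" by simp
        show "1 + 2 * r \<le> 4 * exp (r / 2)"
          using exp_ge_add_one_self[of "r / 2"] by linarith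
      qed (use k X in auto)
      also have "4 * exp (r / 2) * (exp (- r) * X) = 4 * exp (- r / 2) * X"
        by (simp add: mult.assoc[symmetric] exp_add[symmetric])
      finally have *: "norm (H r (y r) - H r w) \<le> 5 * k * X * exp (- r / 2)"
        by (simp add: algebra_simps)
      show "norm ((\<mu> / 2) *\<^sub>R (H r (y r) - H r w)) \<le> 5 / 2 * k * X * exp (- r / 2)"
        using * mu by simp
    qed (use t in \<open>auto intro!: derivative_eq_intros\<close>)
    also have "\<dots> \<le> 5 * k * exp (- t / 2) * X"
      using k X by (simp add: mult_ac)
    finally show ?thesis by (simp add: norm_minus_commute)
  qed
  have "norm (e m) \<le> norm (e T) + 5 * k * X"
  proof -
    have "5 * k * exp (- m / 2) * X \<le> 5 * k * 1 * X"
      using m k X by (intro mult_right_mono mult_left_mono) auto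
    then show ?thesis
      using incr[OF m(1)] norm_triangle_sub[of "e m" "e T"] by simp
  qed
  moreover have "5 * k * X \<le> 1 / 200 * X"
    using k X by (intro mult_right_mono) auto
  ultimately have "200 * norm (e m) \<le> 200 * norm (e T) + X"
    by simp
  then have X_le: "X \<le> 2 * B + 4 * norm s + 2 + 2 * norm (e T)"
    using B norm_ge_zero[of s] norm_ge_zero[of "e T"] unfolding X_def by linarith
  have "norm (e \<tau>) \<le> norm (e T) + 5 * k * exp (- \<tau> / 2) * X"
    using incr[OF \<tau>] norm_triangle_sub[of "e \<tau>" "e T"] by simp
  also have "\<dots> \<le> norm (e T) + 5 * k * exp (- \<tau> / 2) * (2 * B + 4 * norm s + 2 + 2 * norm (e T))"
    using k X_le by (intro add_left_mono mult_left_mono) auto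
  finally show ?thesis .
qed

text \<open>At time 0 the drift vanishes, so a trajectory that ends near \<open>s + drift\<close> starts near \<open>s\<close>, and decay of the data in \<open>\<sigma> 0\<close> becomes decay in \<open>s\<close>.\<close>

lemma shadowing_start:
  assumes tr: "trajectory \<mu> H T \<sigma> \<nu>" and B: "0 \<le> B"
    and \<nu>: "norm (\<nu> T - w) \<le> exp (- T) * (B + norm s)"
    and \<sigma>: "norm (\<sigma> T - s - drift \<mu> H w T) \<le> 1"
  shows "1 + norm s \<le> (3 + B) * (1 + norm (\<sigma> 0))"
proof -
  let ?eT = "norm (\<sigma> T - s - drift \<mu> H w T)"
  have "norm (\<sigma> 0 - s) \<le> ?eT + 5 * k * (2 * B + 4 * norm s + 2 + 2 * ?eT)"
    using shadowing[OF tr B \<nu>, of 0] T by (simp add: drift_def)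
  also have "\<dots> \<le> 1 + 1 / 200 * (2 * B + 4 * norm s + 2 + 2 * 1)"
    using k B \<sigma> by (intro add_mono mult_mono) auto
  finally have "200 * norm (\<sigma> 0 - s) \<le> 204 + 2 * B + 4 * norm s" by (simp add: field_simps)
  moreover have "norm s \<le> norm (\<sigma> 0) + norm (\<sigma> 0 - s)"
    using norm_triangle_ineq4[of "\<sigma> 0" "\<sigma> 0 - s"] by simp
  ultimately have "1 + norm s \<le> (3 + B) + 3 * norm (\<sigma> 0)"
    using B norm_ge_zero[of "\<sigma> 0"] by linarith
  also have "\<dots> \<le> (3 + B) * (1 + norm (\<sigma> 0))"
    using mult_nonneg_nonneg[OF B norm_ge_zero[of "\<sigma> 0"]] by (simp add: algebra_simps)
  finally show ?thesis .
qed

text \<open>Gronwall's inequality for a quadratic functional, so that only differentiable functions occur. Taking \<open>\<eta> = e\<^sup>-\<^sup>T\<close>, the logarithm equals \<open>T\<close>, and the small field turns the factor \<open>e\<^sup>T\<close> into a small power of it. The weight \<open>e\<^sup>t\<^sup>/\<^sup>2\<close> on the \<open>\<nu>\<close>-difference makes the part of the growth rate that carries the logarithm integrable in time.\<close>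

lemma backward_stability:
  assumes tr1: "trajectory \<mu> H T \<sigma>1 \<nu>1" and tr2: "trajectory \<mu> H T \<sigma>2 \<nu>2"
  defines "N \<equiv> norm (\<sigma>1 T - \<sigma>2 T) + exp (T / 2) * norm (\<nu>1 T - \<nu>2 T) + exp (- T)"
  shows "norm (\<sigma>1 0 - \<sigma>2 0) \<le> N * exp ((T + 1) / 200)"
    and "norm (\<nu>1 0 - \<nu>2 0) \<le> N * exp ((T + 1) / 200)"
proof -
  define \<Delta>\<sigma> where "\<Delta>\<sigma> = (\<lambda>t. \<sigma>1 t - \<sigma>2 t)"
  define \<Delta>\<nu> where "\<Delta>\<nu> = (\<lambda>t. \<nu>1 t - \<nu>2 t)"
  define y1 where "y1 = (\<lambda>t. \<nu>1 t + exp (- 2 * t) *\<^sub>R \<sigma>1 t)"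
  define y2 where "y2 = (\<lambda>t. \<nu>2 t + exp (- 2 * t) *\<^sub>R \<sigma>2 t)"
  define \<omega> where "\<omega> = (\<lambda>t. H t (y1 t) - H t (y2 t))"
  \<comment> \<open>The constant \<open>(e\<^sup>-\<^sup>T)\<^sup>2\<close> makes \<open>\<eta> = e\<^sup>-\<^sup>T\<close> at most the square root of the functional, so that the inhomogeneous term of the modulus of continuity is absorbed.\<close>
  define M where "M = (\<lambda>t. (\<Delta>\<sigma> t \<bullet> \<Delta>\<sigma> t) + exp t * (\<Delta>\<nu> t \<bullet> \<Delta>\<nu> t) + (exp (- T))\<^sup>2)"
  define M' where "M' = (\<lambda>t. 2 * (\<Delta>\<sigma> t \<bullet> (\<mu> / 2) *\<^sub>R \<omega> t) + exp t * (\<Delta>\<nu> t \<bullet> \<Delta>\<nu> t)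
      + exp t * (2 * (\<Delta>\<nu> t \<bullet> (- (\<mu> / 2) * exp (- 2 * t)) *\<^sub>R \<omega> t)))"
  \<comment> \<open>The derivative of \<open>g\<close> bounds the relative decrease of the functional, so \<open>M e\<^sup>g\<close> is nondecreasing.\<close>
  define g where "g = (\<lambda>t. 2 * k * t - 8 * k * (1 + T) * exp (- t / 2))"
  have d\<sigma>: "(\<Delta>\<sigma> has_vector_derivative (\<mu> / 2) *\<^sub>R \<omega> t) (at t within {0..T})" if "t \<in> {0..T}" for t
    using tr1 tr2 that unfolding \<Delta>\<sigma>_def trajectory_def \<omega>_def y1_def y2_def
    by (auto intro!: derivative_eq_intros simp: scaleR_diff_right)
  have d\<nu>: "(\<Delta>\<nu> has_vector_derivative (- (\<mu> / 2) * exp (- 2 * t)) *\<^sub>R \<omega> t) (at t within {0..T})" if "t \<in> {0..T}" for t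
    using tr1 tr2 that unfolding \<Delta>\<nu>_def trajectory_def \<omega>_def y1_def y2_def
    by (auto intro!: derivative_eq_intros simp: scaleR_diff_right)
  have c\<sigma>: "continuous_on {0..T} \<Delta>\<sigma>" and c\<nu>: "continuous_on {0..T} \<Delta>\<nu>"
    by (rule continuous_on_vector_derivative, erule d\<sigma>)
      (rule continuous_on_vector_derivative, erule d\<nu>)
  have dM: "(M has_real_derivative M' t) (at t)" if "0 < t" "t < T" for t
  proof -
    have sq: "((\<lambda>t. f t \<bullet> f t) has_real_derivative 2 * (f t \<bullet> f')) (at t)"
      if "(f has_vector_derivative f') (at t)" for f :: "real \<Rightarrow> real^2" and f'
    proof -
      have "(f has_derivative (\<lambda>h. h *\<^sub>R f')) (at t)"
        using that by (simp add: has_vector_derivative_def)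
      from has_derivative_inner[OF this this] show ?thesis
        unfolding has_field_derivative_def
        by (rule has_derivative_eq_rhs) (simp add: fun_eq_iff inner_commute[of f'])
    qed
    have "(\<Delta>\<sigma> has_vector_derivative (\<mu> / 2) *\<^sub>R \<omega> t) (at t)"
      "(\<Delta>\<nu> has_vector_derivative (- (\<mu> / 2) * exp (- 2 * t)) *\<^sub>R \<omega> t) (at t)"
      using d\<sigma>[of t] d\<nu>[of t] that by (simp_all add: at_within_Icc_at)
    note d = this[THEN sq]
    have "(M has_real_derivative 2 * (\<Delta>\<sigma> t \<bullet> (\<mu> / 2) *\<^sub>R \<omega> t) + (exp t * (\<Delta>\<nu> t \<bullet> \<Delta>\<nu> t)
      + 2 * (\<Delta>\<nu> t \<bullet> (- (\<mu> / 2) * exp (- 2 * t)) *\<^sub>R \<omega> t) * exp t) + 0) (at t)"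
      unfolding M_def by (rule DERIV_add[OF DERIV_add[OF d(1) DERIV_mult[OF DERIV_exp d(2)]] DERIV_const])
    then show ?thesis
      unfolding M'_def by (simp add: algebra_simps)
  qed
  have exp2: "exp t * exp (- 2 * t) = exp (- t)" for t :: real by (simp flip: exp_add)
  have M'_ge: "- (2 * k * (1 + 2 * (1 + T) * exp (- t / 2))) * M t \<le> M' t" if t: "0 < t" "t < T" for t
  proof -
    define R where "R = sqrt (M t)"
    have M0: "0 \<le> M t" by (simp add: M_def)
    have R: "0 \<le> R" "R * R = M t" using M0 by (auto simp: R_def)
    have \<sigma>R: "norm (\<Delta>\<sigma> t) \<le> R"
      unfolding R_def by (rule real_le_rsqrt) (simp add: M_def power2_norm_eq_inner)
    have \<nu>R: "exp (t / 2) * norm (\<Delta>\<nu> t) \<le> R"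
    proof -
      have "(exp (t / 2) * norm (\<Delta>\<nu> t))\<^sup>2 = exp t * (\<Delta>\<nu> t \<bullet> \<Delta>\<nu> t)"
        by (simp add: power_mult_distrib power2_norm_eq_inner exp_double[symmetric])
      then show ?thesis
        unfolding R_def by (intro real_le_rsqrt) (simp add: M_def)
    qed
    have \<eta>R: "exp (- T) \<le> R"
      unfolding R_def by (rule real_le_rsqrt) (simp add: M_def)
    have \<nu>R': "norm (\<Delta>\<nu> t) \<le> exp (- t / 2) * R"
    proof -
      have "norm (\<Delta>\<nu> t) = exp (- t / 2) * (exp (t / 2) * norm (\<Delta>\<nu> t))"
        by (simp add: mult.assoc[symmetric] exp_add[symmetric])
      also have "\<dots> \<le> exp (- t / 2) * R" using \<nu>R by (intro mult_left_mono) auto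
      finally show ?thesis .
    qed
    have yy: "norm (y1 t - y2 t) \<le> 2 * exp (- t / 2) * R"
    proof -
      have "y1 t - y2 t = \<Delta>\<nu> t + exp (- 2 * t) *\<^sub>R \<Delta>\<sigma> t"
        by (simp add: y1_def y2_def \<Delta>\<nu>_def \<Delta>\<sigma>_def algebra_simps)
      then have "norm (y1 t - y2 t) \<le> norm (\<Delta>\<nu> t) + exp (- 2 * t) * norm (\<Delta>\<sigma> t)"
        using norm_triangle_ineq[of "\<Delta>\<nu> t" "exp (- 2 * t) *\<^sub>R \<Delta>\<sigma> t"] by simp
      also have "\<dots> \<le> exp (- t / 2) * R + exp (- t / 2) * R"
        using \<nu>R' \<sigma>R t by (intro add_mono mult_mono) auto
      finally show ?thesis by (simp add: mult_ac)
    qed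
    have \<omega>: "norm (\<omega> t) \<le> k * (1 + 2 * (1 + T) * exp (- t / 2)) * R"
    proof -
      have "norm (\<omega> t) \<le> k * (exp (- T) + (1 + ln (1 / exp (- T))) * norm (y1 t - y2 t))"
        unfolding \<omega>_def by (rule H_log_lipschitz) (use t in auto)
      also have "\<dots> \<le> k * (R + (1 + T) * (2 * exp (- t / 2) * R))"
        unfolding ln_one_over_exp using k \<eta>R mult_left_mono[OF yy, of "1 + T"] T
        by (intro mult_left_mono add_mono) auto
      finally show ?thesis by (simp add: algebra_simps)
    qed
    have "- (norm (\<Delta>\<sigma> t) * norm (\<omega> t)) \<le> 2 * (\<Delta>\<sigma> t \<bullet> (\<mu> / 2) *\<^sub>R \<omega> t)"
    proof -
      have "\<bar>2 * (\<Delta>\<sigma> t \<bullet> (\<mu> / 2) *\<^sub>R \<omega> t)\<bar> = \<bar>\<Delta>\<sigma> t \<bullet> \<omega> t\<bar>"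
        using mu by (simp add: abs_mult)
      then show ?thesis using Cauchy_Schwarz_ineq2[of "\<Delta>\<sigma> t" "\<omega> t"] by linarith
    qed
    moreover have "- (exp (- t) * norm (\<Delta>\<nu> t) * norm (\<omega> t)) \<le> exp t * (2 * (\<Delta>\<nu> t \<bullet> (- (\<mu> / 2) * exp (- 2 * t)) *\<^sub>R \<omega> t))"
    proof -
      have "\<bar>exp t * (2 * (\<Delta>\<nu> t \<bullet> (- (\<mu> / 2) * exp (- 2 * t)) *\<^sub>R \<omega> t))\<bar> = (exp t * exp (- 2 * t)) * \<bar>\<Delta>\<nu> t \<bullet> \<omega> t\<bar>"
        using mu by (simp add: abs_mult)
      also have "\<dots> = exp (- t) * \<bar>\<Delta>\<nu> t \<bullet> \<omega> t\<bar>" by (simp only: exp2)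
      also have "\<dots> \<le> exp (- t) * (norm (\<Delta>\<nu> t) * norm (\<omega> t))"
        by (intro mult_left_mono Cauchy_Schwarz_ineq2) auto
      finally show ?thesis by (simp add: mult.assoc)
    qed
    moreover have "0 \<le> exp t * (\<Delta>\<nu> t \<bullet> \<Delta>\<nu> t)" by simp
    ultimately have "- ((norm (\<Delta>\<sigma> t) + exp (- t) * norm (\<Delta>\<nu> t)) * norm (\<omega> t)) \<le> M' t"
      unfolding M'_def distrib_right by linarith
    moreover have "(norm (\<Delta>\<sigma> t) + exp (- t) * norm (\<Delta>\<nu> t)) * norm (\<omega> t)
       \<le> (R + R) * (k * (1 + 2 * (1 + T) * exp (- t / 2)) * R)"
    proof (rule mult_mono[OF _ \<omega>])
      have "exp (- t) * norm (\<Delta>\<nu> t) \<le> exp (t / 2) * norm (\<Delta>\<nu> t)"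
        using t by (intro mult_right_mono) auto
      then show "norm (\<Delta>\<sigma> t) + exp (- t) * norm (\<Delta>\<nu> t) \<le> R + R"
        using \<nu>R \<sigma>R by simp
    qed (use R in auto)
    moreover have "(R + R) * (k * (1 + 2 * (1 + T) * exp (- t / 2)) * R) = 2 * k * (1 + 2 * (1 + T) * exp (- t / 2)) * (R * R)"
      by (simp add: algebra_simps)
    ultimately have "- (2 * k * (1 + 2 * (1 + T) * exp (- t / 2)) * (R * R)) \<le> M' t"
      by linarith
    then show ?thesis unfolding R(2) by simp
  qed
  have "M 0 * exp (g 0) \<le> M T * exp (g T)"
  proof (cases "T = 0")
    case False
    show ?thesis
    proof (rule DERIV_nonneg_imp_increasing_open[where f="\<lambda>t. M t * exp (g t)"])
      show "continuous_on {0..T} (\<lambda>t. M t * exp (g t))"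
        unfolding M_def g_def by (intro continuous_intros c\<sigma> c\<nu>) auto
      fix t assume t: "0 < t" "t < T"
      have "(g has_real_derivative 2 * k + 4 * k * (1 + T) * exp (- t / 2)) (at t)"
        unfolding g_def by (auto intro!: derivative_eq_intros)
      from DERIV_mult[OF dM[OF t] DERIV_fun_exp[OF this]]
      have "((\<lambda>t. M t * exp (g t)) has_real_derivative
          M' t * exp (g t) + exp (g t) * (2 * k + 4 * k * (1 + T) * exp (- t / 2)) * M t) (at t)" .
      moreover have "0 \<le> M' t * exp (g t) + exp (g t) * (2 * k + 4 * k * (1 + T) * exp (- t / 2)) * M t"
      proof -
        have "0 \<le> exp (g t) * (M' t + (2 * k * (1 + 2 * (1 + T) * exp (- t / 2))) * M t)"
          using M'_ge[OF t] by (intro mult_nonneg_nonneg) auto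
        then show ?thesis by (simp add: algebra_simps)
      qed
      ultimately show "\<exists>y. ((\<lambda>t. M t * exp (g t)) has_real_derivative y) (at t) \<and> 0 \<le> y" by blast
    qed (use T in auto)
  qed simp
  then have *: "M 0 * exp (g 0) * exp (- g 0) \<le> M T * exp (g T) * exp (- g 0)"
    by (rule mult_right_mono) simp
  have half: "(exp ((T + 1) / 200))\<^sup>2 = exp ((T + 1) / 100)"
    unfolding exp_double[symmetric] by (rule arg_cong[of _ _ exp]) simp
  from * have "M 0 \<le> M T * exp (g T - g 0)"
    by (simp add: mult.assoc flip: exp_add)
  also have "\<dots> \<le> M T * exp ((T + 1) / 100)"
  proof (intro mult_left_mono)
    have "g T - g 0 \<le> 2 * k * T + 8 * k * (1 + T)"
      using k T by (simp add: g_def algebra_simps)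
    also have "\<dots> \<le> (T + 1) / 100"
      using k T mult_right_mono[OF k(2) T] by (simp add: algebra_simps)
    finally show "exp (g T - g 0) \<le> exp ((T + 1) / 100)" by simp
  qed (simp add: M_def)
  also have "M T \<le> N\<^sup>2"
  proof -
    let ?a = "norm (\<Delta>\<sigma> T)" and ?b = "exp (T / 2) * norm (\<Delta>\<nu> T)" and ?c = "exp (- T)"
    have "M T = ?a\<^sup>2 + ?b\<^sup>2 + ?c\<^sup>2"
      by (simp add: M_def power_mult_distrib power2_norm_eq_inner exp_double[symmetric])
    also have "\<dots> \<le> (?a + ?b + ?c)\<^sup>2"
      by (simp add: power2_sum algebra_simps)
    finally show ?thesis by (simp add: N_def \<Delta>\<sigma>_def \<Delta>\<nu>_def)
  qed
  then have "M T * exp ((T + 1) / 100) \<le> (N * exp ((T + 1) / 200))\<^sup>2"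
    using half by (simp add: power_mult_distrib)
  finally have M0: "M 0 \<le> (N * exp ((T + 1) / 200))\<^sup>2" .
  have N0: "0 \<le> N * exp ((T + 1) / 200)" by (simp add: N_def)
  have "(norm (\<Delta>\<sigma> 0))\<^sup>2 \<le> M 0" "(norm (\<Delta>\<nu> 0))\<^sup>2 \<le> M 0"
    by (simp_all add: M_def power2_norm_eq_inner)
  then have "(norm (\<Delta>\<sigma> 0))\<^sup>2 \<le> (N * exp ((T + 1) / 200))\<^sup>2" "(norm (\<Delta>\<nu> 0))\<^sup>2 \<le> (N * exp ((T + 1) / 200))\<^sup>2"
    using M0 by linarith+
  then show "norm (\<sigma>1 0 - \<sigma>2 0) \<le> N * exp ((T + 1) / 200)" "norm (\<nu>1 0 - \<nu>2 0) \<le> N * exp ((T + 1) / 200)"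
    using N0 by (auto simp: \<Delta>\<sigma>_def \<Delta>\<nu>_def intro: power2_le_imp_le)
qed

end

section \<open>The bootstrap for the density\<close>

lemma inverse_cube_le_tail_weight: "1 / (1 + norm y) ^ 3 \<le> tail_weight y"
proof -
  have "1 / (1 + norm y) ^ 3 = (1 + norm y) powr (- 3)"
    by (simp add: powr_minus_divide powr_numeral add_pos_nonneg)
  also have "\<dots> \<le> tail_weight y"
    unfolding tail_weight_def by (intro powr_mono) auto
  finally show ?thesis .
qed

lemma integral_translate:
  fixes f :: "'a::euclidean_space \<Rightarrow> 'b::{banach, second_countable_topology}"
  assumes [measurable]: "f \<in> borel_measurable borel"
  shows "(LINT s|lborel. f (s + c)) = (LINT s|lborel. f s)"
proof -
  have "(LINT s|lborel. f s) = (LINT s|distr lborel borel ((+) c). f s)"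
    by (simp add: lborel_distr_plus)
  also have "\<dots> = (LINT s|lborel. f (c + s))"
    by (rule integral_distr) auto
  finally show ?thesis by (simp add: add.commute)
qed

text \<open>For the profile of a solution this is \<open>e\<^sup>2\<^sup>t \<rho>(t, e\<^sup>t y)\<close>: the points with position \<open>e\<^sup>t y\<close> are those with \<open>u = y - e\<^sup>-\<^sup>2\<^sup>t s\<close> in profile coordinates.\<close>

definition profile_density :: "(real \<Rightarrow> real^2 \<Rightarrow> real^2 \<Rightarrow> real) \<Rightarrow> real \<Rightarrow> real^2 \<Rightarrow> real" where
  "profile_density F t y = 4 * (LINT s|lborel. F t s (y - exp (- 2 * t) *\<^sub>R s))"

text \<open>Here \<open>55296 = 4 \<cdot> 4\<^sup>3 \<cdot> 6\<^sup>3\<close>; the cubes are the losses when the weights in \<open>\<sigma> 0\<close> and \<open>\<nu> 0\<close> are exchanged for weights in \<open>s\<close> and \<open>y\<close>.\<close>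

definition density_const :: "real \<Rightarrow> real" where
  "density_const K = 55296 * K * field_const"

text \<open>All that the asymptotic analysis has to know about a solution. The last assumption is conditional because the gradient of the potential is known to be the convolution integral only once the density decays.\<close>

locale profile_flow =
  fixes \<mu> K L :: real and F :: "real \<Rightarrow> real^2 \<Rightarrow> real^2 \<Rightarrow> real" and H :: "real \<Rightarrow> real^2 \<Rightarrow> real^2"
  assumes mu: "\<bar>\<mu>\<bar> = 1" and K: "0 \<le> K" "density_const K * field_const \<le> 1 / 1000" and L: "0 \<le> L"
    and F_cont: "\<And>t. 0 \<le> t \<Longrightarrow> continuous_on UNIV (\<lambda>(s, u). F t s u)"
    and F0_nonneg: "\<And>s u. 0 \<le> F 0 s u"
    and F0_le: "\<And>s u. F 0 s u \<le> K / ((1 + norm s) ^ 6 * (1 + norm u) ^ 6)"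
    and F0_lipschitz: "\<And>s1 u1 s2 u2. \<bar>F 0 s1 u1 - F 0 s2 u2\<bar> \<le> L * (norm (s1 - s2) + norm (u1 - u2))"
    and H_cont: "continuous_on ({0..} \<times> UNIV) (\<lambda>(t, y). H t y)"
    and H_crude: "\<And>T. \<exists>C. \<forall>t\<in>{0..T}. \<forall>y. norm (H t y) \<le> C"
    and trajectory_ex: "\<And>t s u. 0 \<le> t \<Longrightarrow> \<exists>\<sigma> \<nu>. trajectory \<mu> H t \<sigma> \<nu> \<and> \<sigma> t = s \<and> \<nu> t = u \<and>
       (\<forall>r\<in>{0..t}. F r (\<sigma> r) (\<nu> r) = F t s u)"
    and H_field: "\<And>t A. 0 \<le> t \<Longrightarrow> (\<And>y. \<bar>profile_density F t y\<bar> \<le> A / (1 + norm y) ^ 3) \<Longrightarrow>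
       H t = field (profile_density F t)"
begin

text \<open>The two sizes that the bootstrap propagates: \<open>A0\<close> for the density with its weight and, through \<^const>\<open>field_const\<close>, \<open>k0\<close> for the field.\<close>

abbreviation "A0 \<equiv> density_const K"

abbreviation "k0 \<equiv> A0 * field_const"

lemma A0_nonneg: "0 \<le> A0" and k0_nonneg: "0 \<le> k0"
  using K field_const_ge_4 by (auto simp: density_const_def)

lemma H_cont_time: "continuous_on {0..T} (\<lambda>r. H r w)"
  by (rule continuous_on_compose2[OF H_cont, where f="\<lambda>r. (r, w)", simplified])
    (auto intro!: continuous_intros)

lemma F_nonneg: "0 \<le> t \<Longrightarrow> 0 \<le> F t s u"
proof -
  assume t: "0 \<le> t"
  obtain \<sigma> \<nu> where "\<forall>r\<in>{0..t}. F r (\<sigma> r) (\<nu> r) = F t s u"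
    using trajectory_ex[OF t, of s u] by blast
  then have "F t s u = F 0 (\<sigma> 0) (\<nu> 0)" using t by auto
  then show ?thesis using F0_nonneg by simp
qed

lemma F_measurable:
  assumes "0 \<le> t" and [measurable]: "f \<in> borel_measurable M" "g \<in> borel_measurable M"
  shows "(\<lambda>x. F t (f x) (g x)) \<in> borel_measurable M"
proof -
  have [measurable]: "(\<lambda>(s, u). F t s u) \<in> borel_measurable borel"
    by (rule borel_measurable_continuous_onI[OF F_cont[OF assms(1)]])
  have "(\<lambda>x. (\<lambda>(s, u). F t s u) (f x, g x)) \<in> borel_measurable M"
    by measurable
  then show ?thesis by simp
qed

lemma profile_density_nonneg: "0 \<le> t \<Longrightarrow> 0 \<le> profile_density F t y"
  unfolding profile_density_def by (auto intro!: integral_nonneg_AE F_nonneg)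

lemma profile_density_measurable:
  assumes "0 \<le> t"
  shows "profile_density F t \<in> borel_measurable borel"
proof -
  have "(\<lambda>(y, s). F t s (y - exp (- 2 * t) *\<^sub>R s)) \<in> borel_measurable (borel \<Otimes>\<^sub>M lborel)"
    unfolding case_prod_beta by (intro F_measurable assms) measurable
  then have "(\<lambda>y. LINT s|lborel. F t s (y - exp (- 2 * t) *\<^sub>R s)) \<in> borel_measurable borel"
    by (rule lborel.borel_measurable_lebesgue_integral)
  then show ?thesis
    unfolding profile_density_def[abs_def] by measurable
qed

lemma profile_density_shift:
  assumes "0 \<le> t"
  shows "profile_density F t y = 4 * (LINT s|lborel. F t (s + c) (y - exp (- 2 * t) *\<^sub>R (s + c)))"
proof -
  have "(\<lambda>s. F t s (y - exp (- 2 * t) *\<^sub>R s)) \<in> borel_measurable borel"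
    by (intro F_measurable assms) measurable
  from integral_translate[OF this, of c] show ?thesis
    by (simp add: profile_density_def)
qed

definition good_until :: "real \<Rightarrow> bool" where
  "good_until T \<longleftrightarrow> (\<forall>t y. 0 \<le> t \<longrightarrow> t < T \<longrightarrow> profile_density F t y \<le> A0 / (1 + norm y) ^ 3)"

lemma density_bound_tail:
  assumes "0 \<le> t" "\<And>y. profile_density F t y \<le> A0 / (1 + norm y) ^ 3"
  shows "\<bar>profile_density F t y\<bar> \<le> A0 * tail_weight y"
proof -
  have "\<bar>profile_density F t y\<bar> \<le> A0 * (1 / (1 + norm y) ^ 3)"
    using assms profile_density_nonneg[OF assms(1), of y] by simp
  also have "\<dots> \<le> A0 * tail_weight y"
    by (intro mult_left_mono inverse_cube_le_tail_weight A0_nonneg)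
  finally show ?thesis .
qed

lemma small_field_if_good:
  assumes "good_until T" "0 \<le> T"
  shows "small_field \<mu> k0 T H"
proof
  fix t :: real assume t: "0 \<le> t" "t < T"
  then have good: "profile_density F t y \<le> A0 / (1 + norm y) ^ 3" for y
    using assms by (auto simp: good_until_def)
  then have "\<bar>profile_density F t y\<bar> \<le> A0 / (1 + norm y) ^ 3" for y
    using profile_density_nonneg[OF t(1), of y] by simp
  then have H: "H t = field (profile_density F t)"
    using t by (intro H_field) auto
  note tail = density_bound_tail[OF t(1) good]
  show "norm (H t y) \<le> k0" for y
    unfolding H by (rule norm_field_le[OF profile_density_measurable tail]) (use t in auto)
  show "norm (H t y1 - H t y2) \<le> k0 * (\<eta> + (1 + ln (1 / \<eta>)) * norm (y1 - y2))"
    if "0 < \<eta>" "\<eta> \<le> 1" for \<eta> y1 y2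
    unfolding H by (rule field_log_lipschitz[OF profile_density_measurable tail]) (use t that in auto)
qed (use assms mu K k0_nonneg H_cont_time in auto)

lemma density_estimate:
  assumes t: "0 \<le> t"
    and F: "\<And>s. F t (s + c) (y - exp (- 2 * t) *\<^sub>R (s + c)) \<le> 13824 * K / ((1 + norm s) ^ 3 * (1 + norm y) ^ 3)"
  shows "profile_density F t y \<le> A0 / (1 + norm y) ^ 3"
proof -
  let ?m = "LINT s|lborel. tail_weight (s::real^2)"
  let ?C = "13824 * K / (1 + norm y) ^ 3"
  have C: "0 \<le> ?C" using K by simp
  have le: "F t (s + c) (y - exp (- 2 * t) *\<^sub>R (s + c)) \<le> ?C * tail_weight s" for s
  proof -
    have "F t (s + c) (y - exp (- 2 * t) *\<^sub>R (s + c)) \<le> ?C * (1 / (1 + norm s) ^ 3)"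
      using F[of s] by (simp add: mult.commute)
    also have "\<dots> \<le> ?C * tail_weight s"
      by (intro mult_left_mono inverse_cube_le_tail_weight C)
    finally show ?thesis .
  qed
  have "(LINT s|lborel. F t (s + c) (y - exp (- 2 * t) *\<^sub>R (s + c))) \<le> (LINT s|lborel. ?C * tail_weight (s::real^2))"
  proof (rule integral_mono)
    show "integrable lborel (\<lambda>s. F t (s + c) (y - exp (- 2 * t) *\<^sub>R (s + c)))"
    proof (rule Bochner_Integration.integrable_bound)
      show "integrable lborel (\<lambda>s::real^2. ?C * tail_weight s)"
        by (intro integrable_mult_right integrable_tail_weight)
      show "AE s in lborel. norm (F t (s + c) (y - exp (- 2 * t) *\<^sub>R (s + c))) \<le> norm (?C * tail_weight s)"
        unfolding real_norm_def abs_of_nonneg[OF F_nonneg[OF t]]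
        by (intro AE_I2 order_trans[OF le abs_ge_self])
      show "(\<lambda>s. F t (s + c) (y - exp (- 2 * t) *\<^sub>R (s + c))) \<in> borel_measurable lborel"
        by (intro F_measurable t) measurable
    qed
  qed (use le integrable_tail_weight in \<open>auto intro: integrable_mult_right\<close>)
  also have "\<dots> = ?C * ?m" by simp
  also have "\<dots> \<le> ?C * field_const"
    unfolding field_const_def by (intro mult_left_mono C) simp
  finally show ?thesis
    unfolding profile_density_shift[OF t, of y c] by (simp add: density_const_def)
qed

text \<open>On \<open>[T, T + h)\<close> nothing is known about the field except that it is bounded, but for short times this moves the trajectories so little that shadowing can still be applied on \<open>[0, T]\<close>. The decay of order 6 of the data in \<open>\<sigma> 0\<close> pays for three powers of \<open>1 + |s|\<close> and, together with the decay in \<open>\<nu> 0\<close>, for three powers of \<open>1 + |y|\<close>.\<close>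

lemma good_step:
  assumes good: "good_until T" and T: "0 \<le> T"
  shows "\<exists>h>0. good_until (T + h)"
proof -
  interpret small_field \<mu> k0 T H
    by (rule small_field_if_good[OF good T])
  obtain C0 where C0: "\<And>t y. t \<in> {0..T + 1} \<Longrightarrow> norm (H t y) \<le> C0"
    using H_crude[of "T + 1"] by blast
  define C where "C = max 1 C0"
  have C: "1 \<le> C" "\<And>t y. t \<in> {0..T + 1} \<Longrightarrow> norm (H t y) \<le> C"
    using C0 by (auto simp: C_def intro: max.coboundedI2)
  \<comment> \<open>Within time \<open>h\<close> a velocity of at most \<open>C / 2\<close> covers at most \<open>e\<^sup>-\<^sup>T / 8\<close>.\<close>
  define h where "h = exp (- T) / (4 * C)"
  have h: "0 < h" "C * h = exp (- T) / 4" "h \<le> 1"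
  proof -
    have "exp (- T) / (4 * C) \<le> 1 / 1"
      using C T by (intro frac_le) auto
    then show "h \<le> 1" by (simp add: h_def)
  qed (use C in \<open>auto simp: h_def\<close>)
  have step: "profile_density F t y \<le> A0 / (1 + norm y) ^ 3" if t: "T \<le> t" "t < T + h" for t y
  proof (rule density_estimate[where c="drift \<mu> H y t"])
    show t0: "0 \<le> t" using t T by simp
    fix s
    define c where "c = drift \<mu> H y t"
    define u where "u = y - exp (- 2 * t) *\<^sub>R (s + c)"
    obtain \<sigma> \<nu> where tr: "trajectory \<mu> H t \<sigma> \<nu>" and fin: "\<sigma> t = s + c" "\<nu> t = u"
      and F: "\<And>r. r \<in> {0..t} \<Longrightarrow> F r (\<sigma> r) (\<nu> r) = F t (s + c) u"
      using trajectory_ex[OF t0] by blast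
    have tT: "C / 2 * t - C / 2 * T \<le> 1 / 8 * exp (- T)" "exp (- T) \<le> 1"
    proof -
      have "C / 2 * t - C / 2 * T = C / 2 * (t - T)" by (simp add: algebra_simps)
      also have "\<dots> \<le> C / 2 * h" using C t by (intro mult_left_mono) auto
      also have "\<dots> = 1 / 8 * exp (- T)" using h by simp
      finally show "C / 2 * t - C / 2 * T \<le> 1 / 8 * exp (- T)" .
    qed (use T in simp)
    have Hr: "norm (H r x) \<le> C" if "T < r" "r < t" for r x
      using that t T h by (intro C) auto
    have inc: "norm (\<sigma> t - \<sigma> T) \<le> C / 2 * t - C / 2 * T" "norm (\<nu> t - \<nu> T) \<le> C / 2 * t - C / 2 * T"
      "norm (drift \<mu> H y t - drift \<mu> H y T) \<le> C / 2 * t - C / 2 * T"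
    proof -
      show "norm (\<sigma> t - \<sigma> T) \<le> C / 2 * t - C / 2 * T"
      proof (rule vector_increment_le[where T=t and \<phi>'="\<lambda>_. C / 2"])
        show "(\<sigma> has_vector_derivative (\<mu> / 2) *\<^sub>R H r (\<nu> r + exp (- 2 * r) *\<^sub>R \<sigma> r)) (at r within {0..t})"
          if "r \<in> {0..t}" for r using tr that by (simp add: trajectory_def)
      qed (use t T mu Hr in \<open>auto intro!: derivative_eq_intros\<close>)
      show "norm (\<nu> t - \<nu> T) \<le> C / 2 * t - C / 2 * T"
      proof (rule vector_increment_le[where T=t and \<phi>'="\<lambda>_. C / 2"])
        show "(\<nu> has_vector_derivative (- (\<mu> / 2) * exp (- 2 * r)) *\<^sub>R H r (\<nu> r + exp (- 2 * r) *\<^sub>R \<sigma> r)) (at r within {0..t})"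
          if "r \<in> {0..t}" for r using tr that by (simp add: trajectory_def)
        show "norm ((- (\<mu> / 2) * exp (- 2 * r)) *\<^sub>R H r (\<nu> r + exp (- 2 * r) *\<^sub>R \<sigma> r)) \<le> C / 2"
          if "T < r" "r < t" for r
        proof -
          have "exp (- 2 * r) * norm (H r (\<nu> r + exp (- 2 * r) *\<^sub>R \<sigma> r)) \<le> 1 * C"
            using that T Hr[OF that] by (intro mult_mono) auto
          then show ?thesis using mu by (simp add: abs_mult)
        qed
      qed (use t T in \<open>auto intro!: derivative_eq_intros\<close>)
      show "norm (drift \<mu> H y t - drift \<mu> H y T) \<le> C / 2 * t - C / 2 * T"
      proof (rule vector_increment_le[where T=t and \<phi>'="\<lambda>_. C / 2"])
        show "(drift \<mu> H y has_vector_derivative (\<mu> / 2) *\<^sub>R H r y) (at r within {0..t})" if "r \<in> {0..t}" for r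
          by (rule drift_derivative[OF H_cont_time that])
      qed (use t T mu Hr in \<open>auto intro!: derivative_eq_intros\<close>)
    qed
    have \<sigma>T: "norm (\<sigma> T - s - drift \<mu> H y T) \<le> 1"
    proof -
      have eq: "\<sigma> T - s - drift \<mu> H y T = (drift \<mu> H y t - drift \<mu> H y T) - (\<sigma> t - \<sigma> T)"
        by (simp add: fin c_def)
      have "norm (\<sigma> T - s - drift \<mu> H y T) \<le> norm (drift \<mu> H y t - drift \<mu> H y T) + norm (\<sigma> t - \<sigma> T)"
        unfolding eq by (rule norm_triangle_ineq4)
      then show ?thesis using inc tT by linarith
    qed
    have \<nu>T: "norm (\<nu> T - y) \<le> exp (- T) * (1 + norm s)"
    proof -
      have "norm (drift \<mu> H y T) \<le> k0 / 2 * T" using T by (intro norm_drift_le) auto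
      then have c_le: "norm c \<le> k0 / 2 * T + 1 / 8"
        using inc(3) tT norm_triangle_sub[of c "drift \<mu> H y T"] unfolding c_def by linarith
      have "k0 / 2 * T \<le> 1 / 2 * exp T"
        using k0_nonneg K T exp_ge_add_one_self[of T] by (intro mult_mono) linarith+
      then have "exp (- T) * (k0 / 2 * T) \<le> exp (- T) * (1 / 2 * exp T)"
        by (intro mult_left_mono) auto
      then have kT: "exp (- T) * (k0 / 2 * T) \<le> 1 / 2"
        by (simp add: exp_minus)
      have eq: "\<nu> T - y = (\<nu> T - \<nu> t) - exp (- 2 * t) *\<^sub>R (s + c)"
        by (simp add: fin u_def)
      have "norm (\<nu> T - y) \<le> norm (\<nu> t - \<nu> T) + exp (- 2 * t) * norm (s + c)"
        unfolding eq norm_minus_commute[of "\<nu> t"]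
        by (rule order_trans[OF norm_triangle_ineq4]) simp
      also have "\<dots> \<le> 1 / 8 * exp (- T) + exp (- T) * (exp (- T) * (norm s + (k0 / 2 * T + 1 / 8)))"
      proof (intro add_mono)
        have "exp (- 2 * t) * norm (s + c) \<le> exp (- 2 * T) * (norm s + (k0 / 2 * T + 1 / 8))"
          using t c_le norm_triangle_ineq[of s c] by (intro mult_mono) auto
        also have "exp (- 2 * T) = exp (- T) * exp (- T)" by (simp flip: exp_add)
        finally show "exp (- 2 * t) * norm (s + c) \<le> exp (- T) * (exp (- T) * (norm s + (k0 / 2 * T + 1 / 8)))"
          by (simp add: mult.assoc)
      qed (use inc tT in linarith)
      also have "\<dots> \<le> 1 / 8 * exp (- T) + exp (- T) * (norm s + (1 / 2 + 1 / 8))"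
      proof (intro add_left_mono mult_left_mono)
        have "exp (- T) * norm s \<le> 1 * norm s" "exp (- T) * (1 / 8) \<le> 1 * (1 / 8)"
          using tT(2) by (intro mult_right_mono; simp)+
        then show "exp (- T) * (norm s + (k0 / 2 * T + 1 / 8)) \<le> norm s + (1 / 2 + 1 / 8)"
          using kT unfolding distrib_left by linarith
      qed simp
      also have "\<dots> \<le> exp (- T) * (1 + norm s)"
        by (simp add: algebra_simps)
      finally show ?thesis .
    qed
    have trT: "trajectory \<mu> H T \<sigma> \<nu>" using trajectory_restrict[OF tr] t by simp
    have s_le: "1 + norm s \<le> 4 * (1 + norm (\<sigma> 0))"
      using shadowing_start[OF trT _ \<nu>T \<sigma>T] by simp
    have y_le: "1 + norm y \<le> 6 * ((1 + norm (\<sigma> 0)) * (1 + norm (\<nu> 0)))"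
    proof -
      have "4 * norm (\<nu> 0 - \<nu> T) \<le> 1"
        using norm_nu_increment_le[OF trT, of 0] T by simp
      moreover have "norm (\<nu> T - y) \<le> 1 + norm s"
        using \<nu>T mult_right_mono[OF tT(2), of "1 + norm s"] by simp
      moreover have "norm y \<le> norm (\<nu> 0) + norm (\<nu> 0 - \<nu> T) + norm (\<nu> T - y)"
        using norm_triangle_ineq4[of "\<nu> 0" "(\<nu> 0 - \<nu> T) + (\<nu> T - y)"]
          norm_triangle_ineq[of "\<nu> 0 - \<nu> T" "\<nu> T - y"] by simp
      ultimately have "1 + norm y \<le> 6 + 4 * norm (\<sigma> 0) + norm (\<nu> 0)"
        using s_le by (simp add: algebra_simps)
      also have "\<dots> \<le> 6 * ((1 + norm (\<sigma> 0)) * (1 + norm (\<nu> 0)))"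
        using mult_nonneg_nonneg[OF norm_ge_zero[of "\<sigma> 0"] norm_ge_zero[of "\<nu> 0"]]
          norm_ge_zero[of "\<sigma> 0"] norm_ge_zero[of "\<nu> 0"] by (simp add: algebra_simps)
      finally show ?thesis .
    qed
    have "(1 + norm s) ^ 3 * (1 + norm y) ^ 3 \<le> (4 * (1 + norm (\<sigma> 0))) ^ 3 * (6 * ((1 + norm (\<sigma> 0)) * (1 + norm (\<nu> 0)))) ^ 3"
      using s_le y_le by (intro mult_mono power_mono) auto
    also have "\<dots> = 13824 * ((1 + norm (\<sigma> 0)) ^ 6 * (1 + norm (\<nu> 0)) ^ 3)"
    proof -
      have "(4 * a) ^ 3 * (6 * (a * b)) ^ 3 = 13824 * (a ^ 6 * b ^ 3)" for a b :: real
        by (simp add: power_mult_distrib eval_nat_numeral)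
      then show ?thesis .
    qed
    also have "\<dots> \<le> 13824 * ((1 + norm (\<sigma> 0)) ^ 6 * (1 + norm (\<nu> 0)) ^ 6)"
      by (intro mult_left_mono power_increasing) auto
    finally have W: "(1 + norm s) ^ 3 * (1 + norm y) ^ 3 \<le> 13824 * ((1 + norm (\<sigma> 0)) ^ 6 * (1 + norm (\<nu> 0)) ^ 6)" .
    have pos: "0 < (1 + norm s) ^ 3 * (1 + norm y) ^ 3" "0 < (1 + norm (\<sigma> 0)) ^ 6 * (1 + norm (\<nu> 0)) ^ 6"
      by (auto intro!: mult_pos_pos zero_less_power add_pos_nonneg)
    have "F t (s + c) u = F 0 (\<sigma> 0) (\<nu> 0)" using F[of 0] t0 by simp
    also have "\<dots> \<le> K / ((1 + norm (\<sigma> 0)) ^ 6 * (1 + norm (\<nu> 0)) ^ 6)" by (rule F0_le)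
    also have "\<dots> = 13824 * K / (13824 * ((1 + norm (\<sigma> 0)) ^ 6 * (1 + norm (\<nu> 0)) ^ 6))" by simp
    also have "\<dots> \<le> 13824 * K / ((1 + norm s) ^ 3 * (1 + norm y) ^ 3)"
      using K pos by (intro divide_left_mono[OF W]) auto
    finally show "F t (s + drift \<mu> H y t) (y - exp (- 2 * t) *\<^sub>R (s + drift \<mu> H y t))
        \<le> 13824 * K / ((1 + norm s) ^ 3 * (1 + norm y) ^ 3)"
      by (simp add: u_def c_def)
  qed
  have "good_until (T + h)"
    using good step by (auto simp: good_until_def)
  then show ?thesis using h by blast
qed

text \<open>The infimum of the times at which the bound fails contradicts the preceding step.\<close>

lemma profile_density_le:
  assumes "0 \<le> t"
  shows "profile_density F t y \<le> A0 / (1 + norm y) ^ 3"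
proof (rule ccontr)
  assume not: "\<not> ?thesis"
  define S where "S = {t. 0 \<le> t \<and> (\<exists>y. \<not> profile_density F t y \<le> A0 / (1 + norm y) ^ 3)}"
  have S: "t \<in> S" "bdd_below S" using assms not by (auto simp: S_def bdd_below_def)
  define b where "b = Inf S"
  have b0: "0 \<le> b" unfolding b_def using S by (intro cInf_greatest) (auto simp: S_def)
  have "good_until b"
    using S cInf_lower[of _ S] by (force simp: good_until_def b_def S_def)
  then obtain h where h: "h > 0" "good_until (b + h)" using good_step b0 by blast
  obtain r where r: "r \<in> S" "r < b + h"
    using cInf_lessD[of S "b + h"] S h by (auto simp: b_def)
  then show False using h by (auto simp: S_def good_until_def)
qed

lemma small_field: "0 \<le> T \<Longrightarrow> small_field \<mu> k0 T H"
  using profile_density_le by (intro small_field_if_good) (auto simp: good_until_def)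

end

section \<open>The limit profile\<close>

lemma exponential_cauchy_limit:
  fixes f :: "real \<Rightarrow> 'a::banach"
  assumes c: "0 < c" and cauchy: "\<And>t t'. 0 \<le> t \<Longrightarrow> t \<le> t' \<Longrightarrow> norm (f t' - f t) \<le> C * exp (- c * t)"
  shows "\<exists>l. (f \<longlongrightarrow> l) at_top \<and> (\<forall>t\<ge>0. norm (f t - l) \<le> C * exp (- c * t))"
proof -
  have lim0: "((\<lambda>t. C * exp (- c * t)) \<longlongrightarrow> 0) at_top"
  proof -
    have "((\<lambda>t. exp (- c * t)) \<longlongrightarrow> 0) at_top"
      using c by real_asymp
    then show "((\<lambda>t. C * exp (- c * t)) \<longlongrightarrow> 0) at_top" by (rule tendsto_mult_right_zero)
  qed
  have "Cauchy (\<lambda>n. f (real n))"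
  proof (rule metric_CauchyI)
    fix e :: real assume "0 < e"
    then have "eventually (\<lambda>t. C * exp (- c * t) < e) at_top"
      using order_tendstoD(2)[OF lim0] by auto
    then obtain t0 where t0: "\<And>t. t \<ge> t0 \<Longrightarrow> C * exp (- c * t) < e"
      by (auto simp: eventually_at_top_linorder)
    obtain M :: nat where M: "t0 \<le> real M" using real_arch_simple by blast
    have *: "norm (f (real n) - f (real m)) < e" if "M \<le> m" "m \<le> n" for m n
      using cauchy[of "real m" "real n"] t0[of "real m"] that M by auto
    then have "dist (f (real m)) (f (real n)) < e" if "M \<le> m" "M \<le> n" for m n
      using *[of m n] *[of n m] that by (cases "m \<le> n") (auto simp: dist_norm norm_minus_commute)
    then show "\<exists>M. \<forall>m\<ge>M. \<forall>n\<ge>M. dist (f (real m)) (f (real n)) < e" by blast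
  qed
  then obtain l where l: "(\<lambda>n. f (real n)) \<longlonglongrightarrow> l"
    using convergent_eq_Cauchy by blast
  have rate: "norm (f t - l) \<le> C * exp (- c * t)" if t: "0 \<le> t" for t
  proof (rule tendsto_upperbound)
    show "(\<lambda>n. norm (f t - f (real n))) \<longlonglongrightarrow> norm (f t - l)"
      by (intro tendsto_intros l)
    obtain M :: nat where M: "t \<le> real M" using real_arch_simple by blast
    show "eventually (\<lambda>n. norm (f t - f (real n)) \<le> C * exp (- c * t)) sequentially"
      unfolding eventually_sequentially norm_minus_commute[of "f t"]
      using M by (intro exI[of _ M] allI impI cauchy[OF t]) simp
  qed simp
  have "((\<lambda>t. f t - l) \<longlongrightarrow> 0) at_top"
    by (rule Lim_null_comparison[OF _ lim0])
      (use rate in \<open>auto simp: eventually_at_top_linorder intro!: exI[of _ 0]\<close>)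
  then show ?thesis using rate by (auto simp: LIM_zero_iff)
qed

lemma one_plus_norm_pos [simp]: "0 < 1 + norm y"
  by (simp add: add_pos_nonneg)

lemma one_plus_norm_neq_0 [simp]: "1 + norm y \<noteq> 0"
  using one_plus_norm_pos[of y] by linarith

lemma tail_weight_power: "tail_weight y ^ 2 = 1 / (1 + norm y) ^ 5" "tail_weight y ^ 6 = 1 / (1 + norm y) ^ 15"
proof -
  have *: "tail_weight y ^ n = (1 + norm y) powr (- (5 / 2 * real n))" for n
  proof -
    have "tail_weight y ^ n = tail_weight y powr real n"
      by (rule powr_realpow[symmetric]) (simp add: tail_weight_def)
    then show ?thesis by (simp add: tail_weight_def powr_powr)
  qed
  show "tail_weight y ^ 2 = 1 / (1 + norm y) ^ 5" "tail_weight y ^ 6 = 1 / (1 + norm y) ^ 15"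
    unfolding * by (simp_all add: powr_minus_divide)
qed

context profile_flow
begin

lemma norm_drift_growth: "0 \<le> t \<Longrightarrow> norm (drift \<mu> H w t) \<le> k0 / 2 * t"
  using small_field.norm_drift_le[OF small_field] by auto

text \<open>The trajectory through the point starts at a distance at least comparable to \<open>|s|\<close> from the axis \<open>\<sigma> = 0\<close>, whatever the elapsed time.\<close>

lemma decay:
  assumes t: "0 \<le> t" and B: "0 \<le> B" and u: "norm (u - w) \<le> exp (- t) * (B + norm s)"
  shows "F t (s + drift \<mu> H w t) u \<le> K * (3 + B) ^ 6 / (1 + norm s) ^ 6"
proof -
  interpret small_field \<mu> k0 t H by (rule small_field[OF t])
  obtain \<sigma> \<nu> where tr: "trajectory \<mu> H t \<sigma> \<nu>" and fin: "\<sigma> t = s + drift \<mu> H w t" "\<nu> t = u"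
    and F: "\<And>r. r \<in> {0..t} \<Longrightarrow> F r (\<sigma> r) (\<nu> r) = F t (s + drift \<mu> H w t) u"
    using trajectory_ex[OF t] by blast
  have "1 + norm s \<le> (3 + B) * (1 + norm (\<sigma> 0))"
    by (rule shadowing_start[OF tr B]) (use u fin in auto)
  then have W: "(1 + norm s) ^ 6 \<le> ((3 + B) * (1 + norm (\<sigma> 0))) ^ 6"
    by (rule power_mono) simp
  have pos: "0 < (1 + norm s) ^ 6" "0 < (3 + B) ^ 6" "0 < (1 + norm (\<sigma> 0)) ^ 6"
    using B by (auto intro!: zero_less_power add_pos_nonneg)
  have "F t (s + drift \<mu> H w t) u = F 0 (\<sigma> 0) (\<nu> 0)" using F[of 0] t by simp
  also have "\<dots> \<le> K / ((1 + norm (\<sigma> 0)) ^ 6 * (1 + norm (\<nu> 0)) ^ 6)" by (rule F0_le)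
  also have "\<dots> \<le> K / ((1 + norm (\<sigma> 0)) ^ 6 * 1)"
    using K pos by (intro divide_left_mono mult_left_mono mult_pos_pos one_le_power)
      (auto intro!: zero_less_power add_pos_nonneg)
  also have "\<dots> = K * (3 + B) ^ 6 / ((3 + B) * (1 + norm (\<sigma> 0))) ^ 6"
    using pos by (simp add: power_mult_distrib)
  also have "\<dots> \<le> K * (3 + B) ^ 6 / (1 + norm s) ^ 6"
    using K B pos by (intro divide_left_mono[OF W] mult_nonneg_nonneg mult_pos_pos)
      (auto simp: power_mult_distrib)
  finally show ?thesis .
qed

lemma exp_growth_le: "exp ((t + 1 :: real) / 200) \<le> 2 * exp (t / 200)"
proof -
  have "exp (1 / 200 :: real) \<le> 2"
    using exp_bound[of "1 / 200 :: real"] by (simp add: power2_eq_square)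
  then have "exp (t / 200) * exp (1 / 200) \<le> exp (t / 200) * 2"
    by (intro mult_left_mono) auto
  moreover have "exp ((t + 1) / 200) = exp (t / 200) * exp (1 / 200)"
    by (simp add: add_divide_distrib exp_add)
  ultimately show ?thesis by (simp add: mult.commute)
qed

lemma profile_stability:
  assumes t: "0 \<le> t"
  shows "\<bar>F t s1 u1 - F t s2 u2\<bar>
    \<le> 4 * L * (norm (s1 - s2) + exp (t / 2) * norm (u1 - u2) + exp (- t)) * exp (t / 200)"
proof -
  interpret small_field \<mu> k0 t H by (rule small_field[OF t])
  obtain \<sigma>1 \<nu>1 where 1: "trajectory \<mu> H t \<sigma>1 \<nu>1" "\<sigma>1 t = s1" "\<nu>1 t = u1"
    "\<And>r. r \<in> {0..t} \<Longrightarrow> F r (\<sigma>1 r) (\<nu>1 r) = F t s1 u1"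
    using trajectory_ex[OF t] by blast
  obtain \<sigma>2 \<nu>2 where 2: "trajectory \<mu> H t \<sigma>2 \<nu>2" "\<sigma>2 t = s2" "\<nu>2 t = u2"
    "\<And>r. r \<in> {0..t} \<Longrightarrow> F r (\<sigma>2 r) (\<nu>2 r) = F t s2 u2"
    using trajectory_ex[OF t] by blast
  define N where "N = norm (s1 - s2) + exp (t / 2) * norm (u1 - u2) + exp (- t)"
  have N: "0 \<le> N" by (simp add: N_def)
  have "norm (\<sigma>1 0 - \<sigma>2 0) \<le> N * exp ((t + 1) / 200)" "norm (\<nu>1 0 - \<nu>2 0) \<le> N * exp ((t + 1) / 200)"
    using backward_stability[OF 1(1) 2(1)] by (simp_all add: 1 2 N_def)
  then have "norm (\<sigma>1 0 - \<sigma>2 0) + norm (\<nu>1 0 - \<nu>2 0) \<le> 2 * (N * exp ((t + 1) / 200))" by simp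
  also have "\<dots> \<le> 2 * (N * (2 * exp (t / 200)))"
    using N exp_growth_le by (intro mult_left_mono) auto
  finally have d: "norm (\<sigma>1 0 - \<sigma>2 0) + norm (\<nu>1 0 - \<nu>2 0) \<le> 2 * (N * (2 * exp (t / 200)))" .
  have "\<bar>F t s1 u1 - F t s2 u2\<bar> = \<bar>F 0 (\<sigma>1 0) (\<nu>1 0) - F 0 (\<sigma>2 0) (\<nu>2 0)\<bar>"
    using 1(4)[of 0] 2(4)[of 0] t by simp
  also have "\<dots> \<le> L * (norm (\<sigma>1 0 - \<sigma>2 0) + norm (\<nu>1 0 - \<nu>2 0))" by (rule F0_lipschitz)
  also have "\<dots> \<le> L * (2 * (N * (2 * exp (t / 200))))"
    using L d by (intro mult_left_mono)
  also have "\<dots> = 4 * L * N * exp (t / 200)" by simp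
  finally show ?thesis unfolding N_def .
qed

text \<open>The trajectory that ends at the later point is, at the earlier time, close to the earlier point by shadowing, with an error of order \<open>e\<^sup>-\<^sup>t\<^sup>/\<^sup>2 (1 + |s|)\<close>; the stability estimate then compares the two values of the profile at that time, losing only a factor \<open>e\<^sup>t\<^sup>/\<^sup>2\<^sup>0\<^sup>0\<close>.\<close>

lemma profile_cauchy:
  assumes t: "0 \<le> t" "t \<le> t'" and B: "0 \<le> B"
    and u: "norm (u - w) \<le> exp (- t) * (B + norm s)" and u': "norm (u' - w) \<le> exp (- t') * (B + norm s)"
  shows "\<bar>F t' (s + drift \<mu> H w t') u' - F t (s + drift \<mu> H w t) u\<bar>
     \<le> 12 * L * (1 + B) * (1 + norm s) * exp (- (1 / 4) * t)"
proof -
  have t': "0 \<le> t'" using t by simp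
  interpret small_field \<mu> k0 t' H by (rule small_field[OF t'])
  obtain \<sigma> \<nu> where tr: "trajectory \<mu> H t' \<sigma> \<nu>" and fin: "\<sigma> t' = s + drift \<mu> H w t'" "\<nu> t' = u'"
    and F: "\<And>r. r \<in> {0..t'} \<Longrightarrow> F r (\<sigma> r) (\<nu> r) = F t' (s + drift \<mu> H w t') u'"
    using trajectory_ex[OF t'] by blast
  have tt: "t \<in> {0..t'}" using t by simp
  have \<sigma>: "norm (\<sigma> t - (s + drift \<mu> H w t)) \<le> exp (- t / 2) * (1 / 200 * (2 * B + 4 * norm s + 2))"
  proof -
    have "norm (\<sigma> t - s - drift \<mu> H w t) \<le> 5 * k0 * exp (- t / 2) * (2 * B + 4 * norm s + 2)"
      using shadowing[OF tr B _ tt, of w s] u' by (simp add: fin)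
    also have "\<dots> \<le> 1 / 200 * exp (- t / 2) * (2 * B + 4 * norm s + 2)"
      using K B by (intro mult_right_mono) auto
    finally show ?thesis by (simp add: diff_diff_eq mult_ac)
  qed
  have ett': "exp (- t') \<le> exp (- t)" "exp (- 2 * t) \<le> exp (- t)" using t by auto
  have \<nu>: "norm (\<nu> t - u) \<le> exp (- t) * (1 / 4 + 2 * B + 2 * norm s)"
  proof -
    have eq: "\<nu> t - u = (\<nu> t - \<nu> t') + ((u' - w) - (u - w))" by (simp add: fin)
    have "norm (\<nu> t - u) \<le> norm (\<nu> t - \<nu> t') + (norm (u' - w) + norm (u - w))"
      unfolding eq by (intro order_trans[OF norm_triangle_ineq] add_left_mono norm_triangle_ineq4)
    also have "norm (u' - w) \<le> exp (- t) * (B + norm s)"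
      using ett' B by (intro order_trans[OF u'] mult_right_mono) auto
    also have "norm (\<nu> t - \<nu> t') \<le> 1 / 4 * exp (- t)"
      using norm_nu_increment_le[OF tr tt] ett'(2) by linarith
    finally show ?thesis using u by (simp add: algebra_simps)
  qed
  have half: "exp (t / 2) * exp (- t) = exp (- t / 2)" by (simp flip: exp_add)
  have "exp (t / 2) * norm (\<nu> t - u) \<le> exp (t / 2) * (exp (- t) * (1 / 4 + 2 * B + 2 * norm s))"
    using \<nu> by (intro mult_left_mono) auto
  also have "\<dots> = exp (- t / 2) * (1 / 4 + 2 * B + 2 * norm s)"
    by (simp only: mult.assoc[symmetric] half)
  finally have \<nu>': "exp (t / 2) * norm (\<nu> t - u) \<le> exp (- t / 2) * (1 / 4 + 2 * B + 2 * norm s)" .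
  have et: "exp (- t) \<le> exp (- t / 2) * 1" using t by simp
  have "norm (\<sigma> t - (s + drift \<mu> H w t)) + exp (t / 2) * norm (\<nu> t - u) + exp (- t)
     \<le> exp (- t / 2) * ((1 / 200 * (2 * B + 4 * norm s + 2)) + (1 / 4 + 2 * B + 2 * norm s) + 1)"
    using \<sigma> \<nu>' et unfolding distrib_left by linarith
  also have "\<dots> \<le> exp (- t / 2) * (3 * ((1 + B) * (1 + norm s)))"
  proof (intro mult_left_mono)
    have "0 \<le> B * norm s" using B by simp
    then show "(1 / 200 * (2 * B + 4 * norm s + 2)) + (1 / 4 + 2 * B + 2 * norm s) + 1 \<le> 3 * ((1 + B) * (1 + norm s))"
    proof -
      have "3 * ((1 + B) * (1 + norm s)) = 3 + 3 * B + 3 * norm s + 3 * (B * norm s)"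
        "1 / 200 * (2 * B + 4 * norm s + 2) = B / 100 + norm s / 50 + 1 / 100"
        by (simp_all add: algebra_simps)
      then show ?thesis using B norm_ge_zero[of s] \<open>0 \<le> B * norm s\<close> by linarith
    qed
  qed simp
  finally have N: "norm (\<sigma> t - (s + drift \<mu> H w t)) + exp (t / 2) * norm (\<nu> t - u) + exp (- t)
     \<le> exp (- t / 2) * (3 * ((1 + B) * (1 + norm s)))" .
  have "\<bar>F t' (s + drift \<mu> H w t') u' - F t (s + drift \<mu> H w t) u\<bar> = \<bar>F t (\<sigma> t) (\<nu> t) - F t (s + drift \<mu> H w t) u\<bar>"
    using F[OF tt] by simp
  also have "\<dots> \<le> 4 * L * (norm (\<sigma> t - (s + drift \<mu> H w t)) + exp (t / 2) * norm (\<nu> t - u) + exp (- t)) * exp (t / 200)"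
    by (rule profile_stability[OF t(1)])
  also have "\<dots> \<le> 4 * L * (exp (- t / 2) * (3 * ((1 + B) * (1 + norm s)))) * exp (t / 200)"
    using L by (intro mult_right_mono mult_left_mono N) auto
  also have "\<dots> = (12 * L * (1 + B) * (1 + norm s)) * (exp (- t / 2) * exp (t / 200))"
  proof -
    have "4 * l * (x * (3 * (p * q))) * y = 12 * l * p * q * (x * y)" for l p q x y :: real by simp
    then show ?thesis .
  qed
  also have "\<dots> \<le> (12 * L * (1 + B) * (1 + norm s)) * exp (- (1 / 4) * t)"
  proof (intro mult_left_mono)
    have "exp (- t / 2) * exp (t / 200) = exp (- t / 2 + t / 200)" by (rule exp_add[symmetric])
    also have "\<dots> \<le> exp (- (1 / 4) * t)" using t by simp
    finally show "exp (- t / 2) * exp (t / 200) \<le> exp (- (1 / 4) * t)" .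
  qed (use L B in auto)
  finally show ?thesis by simp
qed

definition limit_profile :: "real^2 \<Rightarrow> real^2 \<Rightarrow> real" where
  "limit_profile w s = Lim at_top (\<lambda>t. F t (s + drift \<mu> H w t) w)"

lemma limit_profile_tendsto: "((\<lambda>t. F t (s + drift \<mu> H w t) w) \<longlongrightarrow> limit_profile w s) at_top"
  and limit_profile_rate0: "0 \<le> t \<Longrightarrow>
    \<bar>F t (s + drift \<mu> H w t) w - limit_profile w s\<bar> \<le> 12 * L * (1 + norm s) * exp (- (1 / 4) * t)"
proof -
  have "\<exists>l. ((\<lambda>t. F t (s + drift \<mu> H w t) w) \<longlongrightarrow> l) at_top \<and>
    (\<forall>t\<ge>0. norm (F t (s + drift \<mu> H w t) w - l) \<le> 12 * L * (1 + norm s) * exp (- (1 / 4) * t))"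
    using profile_cauchy[of _ _ 0 w w s w] by (intro exponential_cauchy_limit) auto
  then obtain l where l: "((\<lambda>t. F t (s + drift \<mu> H w t) w) \<longlongrightarrow> l) at_top"
    "\<And>t. t \<ge> 0 \<Longrightarrow> \<bar>F t (s + drift \<mu> H w t) w - l\<bar> \<le> 12 * L * (1 + norm s) * exp (- (1 / 4) * t)"
    by auto
  have "limit_profile w s = l"
    unfolding limit_profile_def by (rule tendsto_Lim[OF _ l(1)]) simp
  then show "((\<lambda>t. F t (s + drift \<mu> H w t) w) \<longlongrightarrow> limit_profile w s) at_top"
    "0 \<le> t \<Longrightarrow> \<bar>F t (s + drift \<mu> H w t) w - limit_profile w s\<bar> \<le> 12 * L * (1 + norm s) * exp (- (1 / 4) * t)"
    using l by auto
qed

lemma limit_profile_rate: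
  assumes t: "0 \<le> t" and B: "0 \<le> B" and u: "norm (u - w) \<le> exp (- t) * (B + norm s)"
  shows "\<bar>F t (s + drift \<mu> H w t) u - limit_profile w s\<bar> \<le> 24 * L * (1 + B) * (1 + norm s) * exp (- (1 / 4) * t)"
proof -
  have "\<bar>F t (s + drift \<mu> H w t) w - F t (s + drift \<mu> H w t) u\<bar> \<le> 12 * L * (1 + B) * (1 + norm s) * exp (- (1 / 4) * t)"
    using u B by (intro profile_cauchy[OF t order_refl B]) auto
  moreover have "12 * L * (1 + norm s) * exp (- (1 / 4) * t) \<le> 12 * L * (1 + B) * (1 + norm s) * exp (- (1 / 4) * t)"
    using L B by (intro mult_right_mono) (auto simp: mult_le_cancel_left1)
  ultimately show ?thesis
    using limit_profile_rate0[OF t, of s w] by simp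
qed

lemma limit_profile_bounds: "0 \<le> limit_profile w s" "limit_profile w s \<le> K * 3 ^ 6 / (1 + norm s) ^ 6"
proof -
  have ev: "eventually (\<lambda>t::real. 0 \<le> t) at_top" by (rule eventually_ge_at_top)
  show "0 \<le> limit_profile w s"
    by (rule tendsto_lowerbound[OF limit_profile_tendsto]) (auto intro!: eventually_mono[OF ev] F_nonneg)
  have "F t (s + drift \<mu> H w t) w \<le> K * 3 ^ 6 / (1 + norm s) ^ 6" if "0 \<le> t" for t
    using decay[OF that order_refl, of w w s] by simp
  then show "limit_profile w s \<le> K * 3 ^ 6 / (1 + norm s) ^ 6"
    by (intro tendsto_upperbound[OF limit_profile_tendsto]) (auto intro!: eventually_mono[OF ev])
qed

lemma limit_profile_measurable [measurable]: "limit_profile w \<in> borel_measurable borel"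
proof (rule borel_measurable_LIMSEQ_real)
  show "(\<lambda>n. F (real n) (s + drift \<mu> H w (real n)) w) \<longlonglongrightarrow> limit_profile w s" for s
    by (rule filterlim_compose[OF limit_profile_tendsto filterlim_real_sequentially])
  show "(\<lambda>s. F (real n) (s + drift \<mu> H w (real n)) w) \<in> borel_measurable borel" for n
    by (intro F_measurable) auto
qed

text \<open>Geometric mean of the rate of convergence, which grows in \<open>s\<close>, and of the decay, which is uniform in time.\<close>

lemma limit_profile_rate_weighted:
  assumes t: "0 \<le> t" and B: "0 \<le> B" and u: "norm (u - w) \<le> exp (- t) * (B + norm s)"
  shows "\<bar>F t (s + drift \<mu> H w t) u - limit_profile w s\<bar>
     \<le> sqrt (24 * L * (1 + B) * (K * (3 + B) ^ 6)) * exp (- t / 8) * tail_weight s"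
proof (rule power2_le_imp_le)
  let ?x = "\<bar>F t (s + drift \<mu> H w t) u - limit_profile w s\<bar>"
  have F0: "0 \<le> F t (s + drift \<mu> H w t) u" using t by (rule F_nonneg)
  have "K * 3 ^ 6 / (1 + norm s) ^ 6 \<le> K * (3 + B) ^ 6 / (1 + norm s) ^ 6"
    using K B by (intro divide_right_mono mult_left_mono power_mono) auto
  then have x1: "?x \<le> K * (3 + B) ^ 6 / (1 + norm s) ^ 6"
    using F0 decay[OF t B u] limit_profile_bounds[of w s] by (auto simp: abs_le_iff)
  have "?x\<^sup>2 \<le> (24 * L * (1 + B) * (1 + norm s) * exp (- (1 / 4) * t)) * (K * (3 + B) ^ 6 / (1 + norm s) ^ 6)"
    unfolding power2_eq_square using x1 limit_profile_rate[OF t B u] L B by (intro mult_mono) auto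
  also have "\<dots> = (24 * L * (1 + B) * (K * (3 + B) ^ 6)) * exp (- (1 / 4) * t) * (1 / (1 + norm s) ^ 5)"
  proof -
    have "(1 + norm s) / (1 + norm s) ^ 6 = 1 / (1 + norm s) ^ 5"
    proof -
      have "a ^ 6 = a * a ^ 5" for a :: real by (simp add: eval_nat_numeral)
      from this[of "1 + norm s"] show ?thesis by simp
    qed
    moreover have "a * x * e * (k / z) = a * k * e * (x / z)" for a x e k z :: real by simp
    ultimately show ?thesis by metis
  qed
  also have "\<dots> = (sqrt (24 * L * (1 + B) * (K * (3 + B) ^ 6)) * exp (- t / 8) * tail_weight s)\<^sup>2"
  proof -
    have "(exp (- t / 8))\<^sup>2 = exp (- (1 / 4) * t)"
      unfolding exp_double[symmetric] by (rule arg_cong[of _ _ exp]) simp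
    moreover have "0 \<le> 24 * L * (1 + B) * (K * (3 + B) ^ 6)" using L B K by simp
    ultimately show ?thesis by (simp add: power_mult_distrib tail_weight_power)
  qed
  finally show "?x\<^sup>2 \<le> (sqrt (24 * L * (1 + B) * (K * (3 + B) ^ 6)) * exp (- t / 8) * tail_weight s)\<^sup>2" .
qed (use L B K in \<open>auto intro!: mult_nonneg_nonneg tail_weight_nonneg\<close>)

end

section \<open>The asymptotic field and the scattering state\<close>

lemma tendsto_exponential_rate:
  fixes f :: "real \<Rightarrow> 'a::real_normed_vector"
  assumes "\<And>t. 0 \<le> t \<Longrightarrow> norm (f t - l) \<le> C * exp (- t / 8)"
  shows "(f \<longlongrightarrow> l) at_top"
proof -
  have "((\<lambda>t::real. exp (- t / 8)) \<longlongrightarrow> 0) at_top" by real_asymp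
  then have "((\<lambda>t. C * exp (- t / 8)) \<longlongrightarrow> 0) at_top" by (rule tendsto_mult_right_zero)
  then have "((\<lambda>t. f t - l) \<longlongrightarrow> 0) at_top"
    by (rule Lim_null_comparison[rotated])
      (use assms in \<open>auto simp: eventually_at_top_linorder intro!: exI[of _ 0]\<close>)
  then show ?thesis by (simp add: LIM_zero_iff)
qed

context profile_flow
begin

lemma integrable_limit_profile: "integrable lborel (limit_profile w)"
proof (rule Bochner_Integration.integrable_bound)
  show "integrable lborel (\<lambda>s::real^2. (K * 3 ^ 6) * tail_weight s)"
    by (intro integrable_mult_right integrable_tail_weight)
  show "AE s in lborel. norm (limit_profile w s) \<le> norm (K * 3 ^ 6 * tail_weight s)"
  proof (intro AE_I2)
    fix s :: "real^2"
    have "limit_profile w s \<le> K * 3 ^ 6 * (1 / (1 + norm s) ^ 6)"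
      using limit_profile_bounds(2)[of w s] by simp
    also have "1 / (1 + norm s) ^ 6 \<le> 1 / (1 + norm s) ^ 3"
      by (intro divide_left_mono power_increasing mult_pos_pos zero_less_power) auto
    also have "\<dots> \<le> tail_weight s" by (rule inverse_cube_le_tail_weight)
    finally have "limit_profile w s \<le> K * 3 ^ 6 * tail_weight s"
      using K by (simp add: mult_left_mono)
    then show "norm (limit_profile w s) \<le> norm (K * 3 ^ 6 * tail_weight s)"
      using limit_profile_bounds(1)[of w s] by simp
  qed
qed simp

definition limit_density :: "real^2 \<Rightarrow> real" where
  "limit_density w = 4 * (LINT s|lborel. limit_profile w s)"

text \<open>The integral over a whole curve \<open>s \<mapsto> U s\<close> close to \<open>w\<close> is allowed, since the spatial density integrates the profile along slanted lines, whereas the asymptotic density integrates it along \<open>u = w\<close>.\<close>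

lemma line_integral_rate:
  assumes t: "0 \<le> t" and B: "0 \<le> B" and [measurable]: "U \<in> borel_measurable borel"
    and U: "\<And>s. norm (U s - w) \<le> exp (- t) * (B + norm s)"
  shows "\<bar>4 * (LINT s|lborel. F t (s + drift \<mu> H w t) (U s)) - limit_density w\<bar>
    \<le> 4 * sqrt (24 * L * (1 + B) * (K * (3 + B) ^ 6)) * field_const * exp (- t / 8)"
proof -
  define D where "D = sqrt (24 * L * (1 + B) * (K * (3 + B) ^ 6)) * exp (- t / 8)"
  have D: "0 \<le> D" using L B K by (simp add: D_def)
  define d where "d = (\<lambda>s. F t (s + drift \<mu> H w t) (U s) - limit_profile w s)"
  have d_le: "norm (d s) \<le> D * tail_weight s" for s
    using limit_profile_rate_weighted[OF t B U] by (simp add: d_def D_def)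
  have tw: "integrable lborel (\<lambda>s::real^2. D * tail_weight s)"
    by (intro integrable_mult_right integrable_tail_weight)
  have d_meas: "d \<in> borel_measurable lborel"
    unfolding d_def by (intro borel_measurable_diff F_measurable t) simp_all
  have int_d: "integrable lborel d"
    by (rule Bochner_Integration.integrable_bound[OF tw d_meas])
      (intro AE_I2, subst real_norm_def[of "D * _"], rule order_trans[OF d_le abs_ge_self])
  have "integrable lborel (\<lambda>s. d s + limit_profile w s)"
    by (rule Bochner_Integration.integrable_add[OF int_d integrable_limit_profile])
  then have int_F: "integrable lborel (\<lambda>s. F t (s + drift \<mu> H w t) (U s))"
    by (simp add: d_def)
  define I where "I = (LINT s|lborel. F t (s + drift \<mu> H w t) (U s))"
  define J where "J = (LINT s|lborel. limit_profile w s)"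
  have "I - J = (LINT s|lborel. d s)"
    unfolding I_def J_def d_def
    by (rule Bochner_Integration.integral_diff[symmetric, OF int_F integrable_limit_profile])
  then have "\<bar>I - J\<bar> \<le> (LINT s|lborel. norm (d s))"
    using integral_norm_bound[of lborel d] by simp
  also have "\<dots> \<le> (LINT s|lborel. D * tail_weight (s::real^2))"
    by (intro integral_mono integrable_norm int_d tw d_le)
  also have "\<dots> = D * (LINT s|lborel. tail_weight (s::real^2))" by simp
  also have "\<dots> \<le> D * field_const"
    unfolding field_const_def by (intro mult_left_mono D) simp
  finally have "4 * \<bar>I - J\<bar> \<le> 4 * (D * field_const)" by simp
  moreover have "\<bar>4 * I - 4 * J\<bar> = 4 * \<bar>I - J\<bar>" by (simp add: abs_if)
  moreover have "4 * (D * field_const) = 4 * sqrt (24 * L * (1 + B) * (K * (3 + B) ^ 6)) * field_const * exp (- t / 8)"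
    unfolding D_def by (simp only: mult_ac)
  ultimately show ?thesis
    unfolding limit_density_def I_def J_def by linarith
qed

lemma unslanted_density_tendsto:
  "((\<lambda>t. 4 * (LINT s|lborel. F t s w)) \<longlongrightarrow> limit_density w) at_top"
proof -
  define C where "C = 4 * sqrt (24 * L * (1 + 0) * (K * (3 + 0) ^ 6)) * field_const"
  show ?thesis
  proof (rule tendsto_exponential_rate)
    fix t :: real assume that: "0 \<le> t"
    have "(\<lambda>s. F t s w) \<in> borel_measurable borel"
      by (intro F_measurable that) auto
    from integral_translate[OF this, of "drift \<mu> H w t"]
    have eq: "(LINT s|lborel. F t s w) = (LINT s|lborel. F t (s + drift \<mu> H w t) w)" by simp
    show "norm (4 * (LINT s|lborel. F t s w) - limit_density w) \<le> C * exp (- t / 8)"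
      unfolding eq C_def real_norm_def by (rule line_integral_rate[OF that order_refl]) auto
  qed
qed

lemma density_rate: "\<exists>C\<ge>0. \<forall>t\<ge>0. \<forall>y. \<bar>profile_density F t y - limit_density y\<bar> \<le> C * exp (- t / 8)"
proof (intro exI conjI allI impI)
  let ?C = "4 * sqrt (24 * L * (1 + 1) * (K * (3 + 1) ^ 6)) * field_const"
  show "0 \<le> ?C" using L K field_const_ge_4 by (intro mult_nonneg_nonneg) auto
  fix t :: real and y assume t: "0 \<le> t"
  show "\<bar>profile_density F t y - limit_density y\<bar> \<le> ?C * exp (- t / 8)"
    unfolding profile_density_shift[OF t, of y "drift \<mu> H y t"]
  proof (rule line_integral_rate[OF t])
    fix s
    have "exp (- t) * (k0 / 2 * t) \<le> exp (- t) * (1 * exp t)"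
    proof (intro mult_left_mono mult_mono)
      show "t \<le> exp t" using exp_ge_add_one_self[of t] by linarith
    qed (use k0_nonneg K t in auto)
    then have kt: "exp (- t) * (k0 / 2 * t) \<le> 1" by (simp add: exp_minus)
    have "norm (y - exp (- 2 * t) *\<^sub>R (s + drift \<mu> H y t) - y) = exp (- 2 * t) * norm (s + drift \<mu> H y t)"
      by simp
    also have "\<dots> = exp (- t) * (exp (- t) * norm (s + drift \<mu> H y t))"
      by (simp add: mult.assoc[symmetric] flip: exp_add)
    also have "\<dots> \<le> exp (- t) * (1 + norm s)"
    proof (intro mult_left_mono)
      have "exp (- t) * norm (s + drift \<mu> H y t) \<le> exp (- t) * (norm s + k0 / 2 * t)"
        using norm_triangle_ineq[of s "drift \<mu> H y t"] norm_drift_growth[OF t, of y] by (intro mult_left_mono) auto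
      also have "\<dots> \<le> 1 * norm s + 1"
        unfolding distrib_left using kt t by (intro add_mono mult_right_mono) auto
      finally show "exp (- t) * norm (s + drift \<mu> H y t) \<le> 1 + norm s" by simp
    qed simp
    finally show "norm (y - exp (- 2 * t) *\<^sub>R (s + drift \<mu> H y t) - y) \<le> exp (- t) * (1 + norm s)" .
  qed auto
qed

lemma density_tendsto: "((\<lambda>t. profile_density F t y) \<longlongrightarrow> limit_density y) at_top"
proof -
  obtain C where C: "\<And>t y. t \<ge> 0 \<Longrightarrow> \<bar>profile_density F t y - limit_density y\<bar> \<le> C * exp (- t / 8)"
    using density_rate by blast
  show ?thesis
    by (rule tendsto_exponential_rate[where C=C]) (unfold real_norm_def, rule C)
qed

lemma limit_density_bounds: "0 \<le> limit_density y" "limit_density y \<le> A0 / (1 + norm y) ^ 3"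
proof -
  have ev: "eventually (\<lambda>t::real. 0 \<le> t) at_top" by (rule eventually_ge_at_top)
  show "0 \<le> limit_density y"
    by (rule tendsto_lowerbound[OF density_tendsto]) (auto intro!: eventually_mono[OF ev] profile_density_nonneg)
  show "limit_density y \<le> A0 / (1 + norm y) ^ 3"
    by (rule tendsto_upperbound[OF density_tendsto]) (auto intro!: eventually_mono[OF ev] profile_density_le)
qed

lemma limit_density_measurable [measurable]: "limit_density \<in> borel_measurable borel"
proof (rule borel_measurable_LIMSEQ_real)
  show "(\<lambda>n. profile_density F (real n) y) \<longlonglongrightarrow> limit_density y" for y
    by (rule filterlim_compose[OF density_tendsto filterlim_real_sequentially])
  show "profile_density F (real n) \<in> borel_measurable borel" for n
    by (intro profile_density_measurable) auto
qed

lemma limit_density_tail: "\<bar>limit_density y\<bar> \<le> A0 * tail_weight y"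
proof -
  have "\<bar>limit_density y\<bar> \<le> A0 * (1 / (1 + norm y) ^ 3)"
    using limit_density_bounds[of y] by simp
  also have "\<dots> \<le> A0 * tail_weight y"
    by (intro mult_left_mono inverse_cube_le_tail_weight A0_nonneg)
  finally show ?thesis .
qed

text \<open>The difference of the densities tends to 0 in the supremum norm only, which does not control its field; interpolation with the uniform bound \<open>A0 / (1 + |y|)\<^sup>3\<close> restores an integrable weight.\<close>

lemma field_rate: "\<exists>C\<ge>0. \<forall>t\<ge>0. \<forall>w. norm (H t w - field limit_density w) \<le> C * exp (- t / 48)"
proof -
  obtain C0 where C0: "0 \<le> C0" "\<And>t y. t \<ge> 0 \<Longrightarrow> \<bar>profile_density F t y - limit_density y\<bar> \<le> C0 * exp (- t / 8)"
    using density_rate by blast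
  define D where "D = root 6 (C0 * A0 ^ 5)"
  have D: "0 \<le> D" "D ^ 6 = C0 * A0 ^ 5"
    using C0 A0_nonneg by (auto simp: D_def)
  have "norm (H t w - field limit_density w) \<le> (D * field_const) * exp (- t / 48)" if t: "0 \<le> t" for t w
  proof -
    let ?d = "\<lambda>y. profile_density F t y - limit_density y"
    have tail: "\<bar>profile_density F t y\<bar> \<le> A0 * tail_weight y" for y
      by (rule density_bound_tail[OF t profile_density_le[OF t]])
    have H: "H t = field (profile_density F t)"
      using profile_density_le[OF t] profile_density_nonneg[OF t] by (intro H_field[OF t, of A0]) auto
    have "field (profile_density F t) w - field limit_density w = field ?d w"
      unfolding field_def scaleR_diff_left
      by (intro Bochner_Integration.integral_diff[symmetric] integrable_field_integrand[where q=A0] tail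
          profile_density_measurable[OF t] limit_density_tail limit_density_measurable)
    also have "norm \<dots> \<le> (D * exp (- t / 48)) * field_const"
    proof (rule norm_field_le)
      show "?d \<in> borel_measurable borel"
        by (intro borel_measurable_diff profile_density_measurable[OF t] limit_density_measurable)
      fix y
      have A: "\<bar>?d y\<bar> \<le> A0 / (1 + norm y) ^ 3"
        using limit_density_bounds[of y] profile_density_le[OF t, of y] profile_density_nonneg[OF t, of y]
        by (auto simp: abs_le_iff)
      \<comment> \<open>One factor supplies the decay in time and five supply \<open>(1 + |y|)\<^sup>-\<^sup>1\<^sup>5\<close>, the sixth power of the weight.\<close>
      have "\<bar>?d y\<bar> ^ 6 = \<bar>?d y\<bar> * \<bar>?d y\<bar> ^ 5"
        by (simp add: power_Suc[symmetric] del: power_Suc)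
      also have "\<dots> \<le> (C0 * exp (- t / 8)) * (A0 / (1 + norm y) ^ 3) ^ 5"
        using C0 t A by (intro mult_mono power_mono) auto
      also have "\<dots> = (D * exp (- t / 48) * tail_weight y) ^ 6"
      proof -
        have e: "exp (- t / 48) ^ 6 = exp (- t / 8)"
          unfolding exp_of_nat_mult[symmetric] by (rule arg_cong[of _ _ exp]) simp
        have "(A0 / (1 + norm y) ^ 3) ^ 5 = A0 ^ 5 * (1 / (1 + norm y) ^ 15)"
          by (simp add: power_divide flip: power_mult)
        then show ?thesis
          unfolding power_mult_distrib e D(2) tail_weight_power by (simp only: mult_ac)
      qed
      finally have "\<bar>?d y\<bar> ^ 6 \<le> (D * exp (- t / 48) * tail_weight y) ^ 6" .
      moreover have "(6::nat) = Suc 5" by simp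
      ultimately have "\<bar>?d y\<bar> ^ Suc 5 \<le> (D * exp (- t / 48) * tail_weight y) ^ Suc 5" by metis
      then show "\<bar>?d y\<bar> \<le> D * exp (- t / 48) * tail_weight y"
        by (rule power_le_imp_le_base) (intro mult_nonneg_nonneg D(1) tail_weight_nonneg exp_ge_zero)
    qed
    finally show ?thesis by (simp add: H mult_ac)
  qed
  moreover have "0 \<le> D * field_const" using D field_const_ge_4 by simp
  ultimately show ?thesis by blast
qed

lemma drift_asymptotics:
  "\<exists>a C. \<forall>t\<ge>0. norm (drift \<mu> H w t - (\<mu> / 2 * t) *\<^sub>R field limit_density w - a) \<le> C * exp (- (1 / 48) * t)"
proof -
  obtain C0 where C0: "0 \<le> C0" "\<And>t w. t \<ge> 0 \<Longrightarrow> norm (H t w - field limit_density w) \<le> C0 * exp (- t / 48)"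
    using field_rate by blast
  define a where "a = (\<lambda>t. drift \<mu> H w t - (\<mu> / 2 * t) *\<^sub>R field limit_density w)"
  have "norm (a t' - a t) \<le> 24 * C0 * exp (- (1 / 48) * t)" if t: "0 \<le> t" "t \<le> t'" for t t'
  proof -
    have "norm (a t' - a t) \<le> - (24 * C0) * exp (- t' / 48) - (- (24 * C0) * exp (- t / 48))"
    proof (rule vector_increment_le[where T=t' and \<phi>'="\<lambda>r. C0 / 2 * exp (- r / 48)"])
      show "(a has_vector_derivative (\<mu> / 2) *\<^sub>R (H r w - field limit_density w)) (at r within {0..t'})"
        if "r \<in> {0..t'}" for r
        unfolding a_def using drift_derivative[where \<mu>=\<mu> and w=w and H=H, OF H_cont_time that]
        by (auto intro!: derivative_eq_intros simp: scaleR_diff_right)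
      show "norm ((\<mu> / 2) *\<^sub>R (H r w - field limit_density w)) \<le> C0 / 2 * exp (- r / 48)" if "t < r" "r < t'" for r
        using C0(2)[of r w] that t mu by simp
    qed (use t in \<open>auto intro!: derivative_eq_intros\<close>)
    also have "\<dots> \<le> 24 * C0 * exp (- (1 / 48) * t)"
      using C0(1) by simp
    finally show ?thesis .
  qed
  then have "\<exists>l. (a \<longlongrightarrow> l) at_top \<and> (\<forall>t\<ge>0. norm (a t - l) \<le> 24 * C0 * exp (- (1 / 48) * t))"
    by (intro exponential_cauchy_limit) auto
  then show ?thesis unfolding a_def by blast
qed

text \<open>The asymptotic field multiplied by time and the true drift differ by a convergent shift, which only translates the limit.\<close>

lemma scattering_limit:
  "\<exists>a. \<forall>s. ((\<lambda>t. F t (s + (\<mu> / 2 * t) *\<^sub>R field limit_density w) w) \<longlongrightarrow> limit_profile w (s - a)) at_top"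
proof -
  obtain a C where a: "\<And>t. 0 \<le> t \<Longrightarrow> norm (drift \<mu> H w t - (\<mu> / 2 * t) *\<^sub>R field limit_density w - a) \<le> C * exp (- (1 / 48) * t)"
    using drift_asymptotics by blast
  have "((\<lambda>t. F t (s + (\<mu> / 2 * t) *\<^sub>R field limit_density w) w) \<longlongrightarrow> limit_profile w (s - a)) at_top" for s
  proof -
    have le: "\<bar>F t (s + (\<mu> / 2 * t) *\<^sub>R field limit_density w) w - F t ((s - a) + drift \<mu> H w t) w\<bar>
       \<le> 4 * L * (C * exp (- (1 / 48) * t) + exp (- t)) * exp (t / 200)" if t: "0 \<le> t" for t
    proof -
      have eq: "(s + (\<mu> / 2 * t) *\<^sub>R field limit_density w) - ((s - a) + drift \<mu> H w t)
          = - (drift \<mu> H w t - (\<mu> / 2 * t) *\<^sub>R field limit_density w - a)" by simp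
      have "\<bar>F t (s + (\<mu> / 2 * t) *\<^sub>R field limit_density w) w - F t ((s - a) + drift \<mu> H w t) w\<bar>
       \<le> 4 * L * (norm ((s + (\<mu> / 2 * t) *\<^sub>R field limit_density w) - ((s - a) + drift \<mu> H w t)) + exp (t / 2) * norm (w - w) + exp (- t)) * exp (t / 200)"
        by (rule profile_stability[OF t])
      also have "\<dots> \<le> 4 * L * (C * exp (- (1 / 48) * t) + exp (- t)) * exp (t / 200)"
        unfolding eq norm_minus_cancel using a[OF t] L by (intro mult_right_mono mult_left_mono) auto
      finally show ?thesis .
    qed
    have lim0: "((\<lambda>t. 4 * L * (C * exp (- (1 / 48) * t) + exp (- t)) * exp (t / 200)) \<longlongrightarrow> 0) at_top"
    proof -
      have 1: "((\<lambda>t::real. exp (- (1 / 48) * t) * exp (t / 200)) \<longlongrightarrow> 0) at_top" by real_asymp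
      have 2: "((\<lambda>t::real. exp (- t) * exp (t / 200)) \<longlongrightarrow> 0) at_top" by real_asymp
      have "((\<lambda>t. 4 * L * (C * (exp (- (1 / 48) * t) * exp (t / 200)) + exp (- t) * exp (t / 200))) \<longlongrightarrow> 4 * L * (C * 0 + 0)) at_top"
        by (intro tendsto_intros 1 2)
      then show "((\<lambda>t. 4 * L * (C * exp (- (1 / 48) * t) + exp (- t)) * exp (t / 200)) \<longlongrightarrow> 0) at_top"
        by (simp add: algebra_simps)
    qed
    have "((\<lambda>t. F t (s + (\<mu> / 2 * t) *\<^sub>R field limit_density w) w - F t ((s - a) + drift \<mu> H w t) w) \<longlongrightarrow> 0) at_top"
      by (rule Lim_null_comparison[OF _ lim0])
        (use le in \<open>auto simp: eventually_at_top_linorder intro!: exI[of _ 0]\<close>)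
    from tendsto_add[OF this limit_profile_tendsto[of "s - a" w]] show ?thesis by simp
  qed
  then show ?thesis by blast
qed

end

section \<open>Concentration of the mass\<close>

lemma integral_affine:
  fixes h :: "'a::euclidean_space \<Rightarrow> 'b::{banach, second_countable_topology}"
  assumes [measurable]: "h \<in> borel_measurable borel" and a: "a \<noteq> 0"
  shows "(LINT s|lborel. h s) = \<bar>a\<bar> ^ DIM('a) *\<^sub>R (LINT s|lborel. h (b + a *\<^sub>R s))"
proof -
  let ?T = "\<lambda>s. b + a *\<^sub>R s"
  have "(LINT s|lborel. h s)
     = (LINT s|Nonnegative_Lebesgue_Integration.density (distr lborel borel ?T) (\<lambda>_. ennreal (\<bar>a\<bar> ^ DIM('a))). h s)"
    using lborel_affine[OF a, of b] by simp
  also have "\<dots> = (LINT s|distr lborel borel ?T. \<bar>a\<bar> ^ DIM('a) *\<^sub>R h s)"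
    by (rule integral_density) auto
  also have "\<dots> = (LINT s|lborel. \<bar>a\<bar> ^ DIM('a) *\<^sub>R h (b + a *\<^sub>R s))"
    by (rule integral_distr) auto
  also have "\<dots> = \<bar>a\<bar> ^ DIM('a) *\<^sub>R (LINT s|lborel. h (b + a *\<^sub>R s))"
    by (rule integral_scaleR_right)
  finally show ?thesis .
qed

lemma has_bochner_integral_tensor:
  fixes a :: "'a::euclidean_space \<Rightarrow> real" and b :: "'b::euclidean_space \<Rightarrow> real"
  assumes a: "integrable lborel a" and b: "integrable lborel b"
  shows "has_bochner_integral (lborel \<Otimes>\<^sub>M lborel) (\<lambda>(x, y). a x * b y) ((LINT x|lborel. a x) * (LINT y|lborel. b y))"
proof -
  have [measurable]: "a \<in> borel_measurable lborel" "b \<in> borel_measurable lborel"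
    using a b by auto
  have "integrable lborel (\<lambda>x. \<bar>a x\<bar> * (LINT y|lborel. \<bar>b y\<bar>))"
    by (intro integrable_mult_left integrable_abs a)
  then have int: "integrable (lborel \<Otimes>\<^sub>M lborel) (\<lambda>(x, y). a x * b y)"
    by (intro lborel_pair.Fubini_integrable) (auto simp: abs_mult intro!: integrable_mult_right b)
  have "(LINT x|lborel. LINT y|lborel. a x * b y) = integral\<^sup>L (lborel \<Otimes>\<^sub>M lborel) (\<lambda>(x, y). a x * b y)"
    using lborel_pair.integral_fst[of "\<lambda>x y. a x * b y"] int by simp
  then show ?thesis using int by (simp add: has_bochner_integral_iff)
qed

context profile_flow
begin

text \<open>After the substitution \<open>s \<mapsto> e\<^sup>-\<^sup>t (s + drift)\<close> the integrand converges pointwise to \<open>limit_profile w s * \<psi> (0, u)\<close>, with an integrable majorant by the uniform decay of the profile.\<close>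

lemma concentration_limit:
  fixes \<psi> :: "(real^2) \<times> (real^2) \<Rightarrow> real"
  assumes \<psi>_cont: "continuous_on UNIV \<psi>"
    and supp: "\<And>s u. \<psi> (s, u) \<noteq> 0 \<Longrightarrow> norm s \<le> R \<and> norm u \<le> R" and R: "0 \<le> R"
    and \<psi>_le: "\<And>p. \<bar>\<psi> p\<bar> \<le> m"
  shows "((\<lambda>t. exp (2 * t) * (LINT (s, u)|lborel. F t (exp t *\<^sub>R s) (w + exp (- t) *\<^sub>R u) * \<psi> (s, u)))
     \<longlongrightarrow> (LINT s|lborel. limit_profile w s) * (LINT u|lborel. \<psi> (0, u))) at_top"
proof -
  have m: "0 \<le> m" using \<psi>_le[of 0] by simp
  have [measurable]: "\<psi> \<in> borel_measurable borel"
    using \<psi>_cont by (rule borel_measurable_continuous_onI)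
  have \<psi>_meas: "(\<lambda>x. \<psi> (f x, g x)) \<in> borel_measurable M"
    if [measurable]: "f \<in> borel_measurable M" "g \<in> borel_measurable M" for f g and M :: "'z measure"
    by measurable
  define c where "c = drift \<mu> H w"
  define G where "G = (\<lambda>t s u. F t (s + c t) (w + exp (- t) *\<^sub>R u) * \<psi> (exp (- t) *\<^sub>R (s + c t), u))"
  define D where "D = K * (3 + R) ^ 6"
  have D: "0 \<le> D" using K R by (simp add: D_def)
  define dom where "dom = (\<lambda>(s, u). (D * tail_weight (s::real^2)) * (m * indicator (cball 0 R) (u::real^2)))"
  have dom_int: "integrable (lborel \<Otimes>\<^sub>M lborel) dom"
  proof -
    have "integrable lborel (\<lambda>s::real^2. D * tail_weight s)"
      by (intro integrable_mult_right integrable_tail_weight)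
    moreover have "integrable lborel (\<lambda>u::real^2. m * indicator (cball 0 R) u)"
      using emeasure_bounded_finite[OF bounded_cball[of "0::real^2" R]]
      by (intro integrable_mult_right integrable_real_indicator) auto
    ultimately show ?thesis
      unfolding dom_def by (rule integrable.intros[OF has_bochner_integral_tensor])
  qed
  have G_meas: "(\<lambda>(s, u). G t s u) \<in> borel_measurable (lborel \<Otimes>\<^sub>M lborel)" if "0 \<le> t" for t
    unfolding G_def case_prod_beta
    by (intro borel_measurable_times F_measurable[OF that] \<psi>_meas) measurable
  have u_close: "norm (w + exp (- t) *\<^sub>R u - w) \<le> exp (- t) * (R + norm s)" if "norm u \<le> R" for t s u
    using that by (simp add: mult_left_mono add_increasing2)
  have G_le: "norm (G t s u) \<le> dom (s, u)" if t: "0 \<le> t" for t s u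
  proof (cases "norm u \<le> R")
    case True
    have "F t (s + c t) (w + exp (- t) *\<^sub>R u) \<le> D / (1 + norm s) ^ 6"
      unfolding c_def D_def by (rule decay[OF t R u_close[OF True]])
    also have "\<dots> = D * (1 / (1 + norm s) ^ 6)" by simp
    also have "\<dots> \<le> D * (1 / (1 + norm s) ^ 3)"
      by (intro mult_left_mono divide_left_mono power_increasing mult_pos_pos zero_less_power D) auto
    also have "\<dots> \<le> D * tail_weight s"
      by (intro mult_left_mono inverse_cube_le_tail_weight D)
    finally have "F t (s + c t) (w + exp (- t) *\<^sub>R u) * \<bar>\<psi> (exp (- t) *\<^sub>R (s + c t), u)\<bar> \<le> (D * tail_weight s) * m"
      using D F_nonneg[OF t] by (intro mult_mono \<psi>_le) (auto simp: tail_weight_nonneg)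
    then show ?thesis
      using True F_nonneg[OF t] by (simp add: G_def dom_def abs_mult)
  next
    case False
    then have "\<psi> (exp (- t) *\<^sub>R (s + c t), u) = 0" using supp by blast
    then show ?thesis using False by (simp add: G_def dom_def)
  qed
  have G_int: "integrable (lborel \<Otimes>\<^sub>M lborel) (\<lambda>(s, u). G t s u)" if t: "0 \<le> t" for t
  proof (rule Bochner_Integration.integrable_bound[OF dom_int G_meas[OF t]])
    show "AE p in lborel \<Otimes>\<^sub>M lborel. norm (case p of (s, u) \<Rightarrow> G t s u) \<le> norm (dom p)"
      using G_le[OF t] by (intro AE_I2) (force simp: case_prod_beta intro: order_trans[OF _ abs_ge_self])
  qed
  have change: "exp (2 * t) * (LINT (s, u)|lborel. F t (exp t *\<^sub>R s) (w + exp (- t) *\<^sub>R u) * \<psi> (s, u))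
      = (LINT (s, u)|(lborel \<Otimes>\<^sub>M lborel). G t s u)" if t: "0 \<le> t" for t
  proof -
    define g where "g = (\<lambda>s u. F t (exp t *\<^sub>R s) (w + exp (- t) *\<^sub>R u) * \<psi> (s, u))"
    have g_cont: "continuous_on UNIV (\<lambda>(s, u). g s u)"
    proof -
      have "continuous_on UNIV (\<lambda>p. (\<lambda>(s, u). F t s u) (exp t *\<^sub>R fst p, w + exp (- t) *\<^sub>R snd p))"
        by (rule continuous_on_compose2[OF F_cont[OF t]]) (auto intro!: continuous_intros)
      then have "continuous_on UNIV (\<lambda>p. (\<lambda>(s, u). F t s u) (exp t *\<^sub>R fst p, w + exp (- t) *\<^sub>R snd p) * \<psi> p)"
        by (intro continuous_on_mult \<psi>_cont)
      then show ?thesis by (simp add: g_def case_prod_beta)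
    qed
    have g_int: "integrable (lborel \<Otimes>\<^sub>M lborel) (\<lambda>(s, u). g s u)"
    proof -
      let ?S = "cball 0 R \<times> cball 0 R :: ((real^2) \<times> (real^2)) set"
      have "integrable lborel (\<lambda>p. indicator ?S p *\<^sub>R (case p of (s, u) \<Rightarrow> g s u))"
        by (intro borel_integrable_compact compact_Times compact_cball continuous_on_subset[OF g_cont]) auto
      moreover have eq: "indicator ?S p *\<^sub>R (case p of (s, u) \<Rightarrow> g s u) = (case p of (s, u) \<Rightarrow> g s u)" for p
        using supp[of "fst p" "snd p"] by (cases p) (auto simp: g_def indicator_def)
      ultimately show ?thesis unfolding eq lborel_prod by simp
    qed
    have g_slice: "(LINT s|lborel. g s u) = exp (- 2 * t) * (LINT s|lborel. G t s u)" for u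
    proof -
      have "(\<lambda>s. g s u) \<in> borel_measurable borel"
        unfolding g_def by (intro borel_measurable_times F_measurable[OF t] \<psi>_meas) auto
      from integral_affine[OF this, of "exp (- t)" "exp (- t) *\<^sub>R c t"]
      have "(LINT s|lborel. g s u) = exp (- t) ^ 2 * (LINT s|lborel. g (exp (- t) *\<^sub>R c t + exp (- t) *\<^sub>R s) u)"
        by simp
      moreover have "g (exp (- t) *\<^sub>R c t + exp (- t) *\<^sub>R s) u = G t s u" for s
      proof -
        have 1: "exp (- t) *\<^sub>R c t + exp (- t) *\<^sub>R s = exp (- t) *\<^sub>R (s + c t)"
          by (simp add: scaleR_add_right add.commute)
        have 2: "exp t *\<^sub>R exp (- t) *\<^sub>R (s + c t) = s + c t"
          by (simp add: exp_minus)
        show ?thesis unfolding g_def G_def 1 2 ..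
      qed
      moreover have "exp (- t) ^ 2 = exp (- 2 * t)"
        unfolding exp_double[symmetric] by simp
      ultimately show ?thesis by simp
    qed
    have "(LINT (s, u)|lborel. g s u) = (LINT (s, u)|(lborel \<Otimes>\<^sub>M lborel). g s u)"
      by (simp add: lborel_prod)
    also have "\<dots> = (LINT u|lborel. LINT s|lborel. g s u)"
      using lborel_pair.integral_snd[OF g_int] by simp
    also have "\<dots> = exp (- 2 * t) * (LINT u|lborel. LINT s|lborel. G t s u)"
      unfolding g_slice by (rule integral_mult_right_zero)
    also have "(LINT u|lborel. LINT s|lborel. G t s u) = (LINT (s, u)|(lborel \<Otimes>\<^sub>M lborel). G t s u)"
      using lborel_pair.integral_snd[OF G_int[OF t]] by simp
    finally have "exp (2 * t) * (LINT (s, u)|lborel. g s u)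
        = (exp (2 * t) * exp (- 2 * t)) * (LINT (s, u)|(lborel \<Otimes>\<^sub>M lborel). G t s u)"
      by (simp only: mult.assoc)
    also have "exp (2 * t) * exp (- 2 * t) = 1" by (simp flip: exp_add)
    finally show ?thesis by (simp add: g_def)
  qed
  have pointwise: "((\<lambda>t. G t s u) \<longlongrightarrow> limit_profile w s * \<psi> (0, u)) at_top" for s u
  proof -
    define B where "B = max R (norm u)"
    have B: "0 \<le> B" "norm u \<le> B" using R by (auto simp: B_def)
    define C where "C = sqrt (24 * L * (1 + B) * (K * (3 + B) ^ 6)) * tail_weight s"
    have "((\<lambda>t. F t (s + c t) (w + exp (- t) *\<^sub>R u)) \<longlongrightarrow> limit_profile w s) at_top"
    proof (rule tendsto_exponential_rate[where C=C])
      fix t :: real assume t: "0 \<le> t"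
      have "norm (w + exp (- t) *\<^sub>R u - w) \<le> exp (- t) * (B + norm s)"
        using B by (simp add: mult_left_mono add_increasing2)
      from limit_profile_rate_weighted[OF t B(1) this]
      show "norm (F t (s + c t) (w + exp (- t) *\<^sub>R u) - limit_profile w s) \<le> C * exp (- t / 8)"
        by (simp only: real_norm_def c_def C_def mult_ac)
    qed
    moreover have "((\<lambda>t. \<psi> (exp (- t) *\<^sub>R (s + c t), u)) \<longlongrightarrow> \<psi> (0, u)) at_top"
    proof -
      have "((\<lambda>t. exp (- t) * (norm s + k0 / 2 * t)) \<longlongrightarrow> 0) at_top"
        by real_asymp
      then have "((\<lambda>t. exp (- t) *\<^sub>R (s + c t)) \<longlongrightarrow> 0) at_top"
      proof (rule Lim_null_comparison[rotated])
        have "norm (exp (- t) *\<^sub>R (s + c t)) \<le> exp (- t) * (norm s + k0 / 2 * t)" if "0 \<le> t" for t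
          using norm_triangle_ineq[of s "c t"] norm_drift_growth[OF that, of w]
          by (simp add: c_def)
        then show "\<forall>\<^sub>F t in at_top. norm (exp (- t) *\<^sub>R (s + c t)) \<le> exp (- t) * (norm s + k0 / 2 * t)"
          by (auto simp: eventually_at_top_linorder intro!: exI[of _ 0])
      qed
      then have "((\<lambda>t. (exp (- t) *\<^sub>R (s + c t), u)) \<longlongrightarrow> (0, u)) at_top"
        by (intro tendsto_Pair tendsto_const)
      moreover have "isCont \<psi> (0, u)"
        using \<psi>_cont by (simp add: continuous_on_eq_continuous_at)
      ultimately show ?thesis
        by (rule isCont_tendsto_compose[rotated])
    qed
    ultimately show ?thesis unfolding G_def by (rule tendsto_mult)
  qed
  have \<psi>0: "integrable lborel (\<lambda>u. \<psi> (0, u))"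
  proof -
    have "continuous_on UNIV (\<lambda>u. \<psi> (0, u))"
      by (rule continuous_on_compose2[OF \<psi>_cont]) (auto intro!: continuous_intros)
    then have "integrable lborel (\<lambda>u. indicator (cball 0 R) u *\<^sub>R \<psi> (0, u))"
      by (intro borel_integrable_compact compact_cball) (auto intro: continuous_on_subset)
    moreover have eq: "indicator (cball 0 R) u *\<^sub>R \<psi> (0, u) = \<psi> (0, u)" for u
      using supp[of 0 u] by (auto simp: indicator_def)
    ultimately show ?thesis unfolding eq by simp
  qed
  \<comment> \<open>Times before 0, about which nothing is known, are replaced by 0.\<close>
  have lim: "((\<lambda>t. integral\<^sup>L (lborel \<Otimes>\<^sub>M lborel) (\<lambda>(s, u). G (max 0 t) s u))
     \<longlongrightarrow> integral\<^sup>L (lborel \<Otimes>\<^sub>M lborel) (\<lambda>(s, u). limit_profile w s * \<psi> (0, u))) at_top"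
  proof (rule integral_dominated_convergence_at_top[where w=dom])
    show "(\<lambda>(s, u). limit_profile w s * \<psi> (0, u)) \<in> borel_measurable (lborel \<Otimes>\<^sub>M lborel)"
      using has_bochner_integral_tensor[OF integrable_limit_profile \<psi>0, of w]
      by (auto simp: has_bochner_integral_iff)
    show "(\<lambda>(s, u). G (max 0 t) s u) \<in> borel_measurable (lborel \<Otimes>\<^sub>M lborel)" for t
      by (rule G_meas) simp
    show "AE p in lborel \<Otimes>\<^sub>M lborel. ((\<lambda>t. case p of (s, u) \<Rightarrow> G (max 0 t) s u)
       \<longlongrightarrow> (case p of (s, u) \<Rightarrow> limit_profile w s * \<psi> (0, u))) at_top"
    proof (intro AE_I2)
      fix p :: "(real^2) \<times> (real^2)"
      obtain s u where p: "p = (s, u)" by (cases p)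
      have "\<forall>\<^sub>F t in at_top. G t s u = G (max 0 t) s u"
        using eventually_ge_at_top[of "0::real"] by eventually_elim simp
      then show "((\<lambda>t. case p of (s, u) \<Rightarrow> G (max 0 t) s u)
         \<longlongrightarrow> (case p of (s, u) \<Rightarrow> limit_profile w s * \<psi> (0, u))) at_top"
        using pointwise[of s u] unfolding p by (simp add: tendsto_cong)
    qed
    show "\<forall>\<^sub>F t in at_top. AE p in lborel \<Otimes>\<^sub>M lborel. norm (case p of (s, u) \<Rightarrow> G (max 0 t) s u) \<le> dom p"
      using G_le by (intro always_eventually allI AE_I2) (auto simp: case_prod_beta simp del: real_norm_def)
  qed (rule dom_int)
  have "\<forall>\<^sub>F t in at_top. integral\<^sup>L (lborel \<Otimes>\<^sub>M lborel) (\<lambda>(s, u). G (max 0 t) s u)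
     = exp (2 * t) * (LINT (s, u)|lborel. F t (exp t *\<^sub>R s) (w + exp (- t) *\<^sub>R u) * \<psi> (s, u))"
    using eventually_ge_at_top[of "0::real"] by eventually_elim (simp add: change)
  from tendsto_cong[OF this, THEN iffD1, OF lim] show ?thesis
    using has_bochner_integral_tensor[OF integrable_limit_profile \<psi>0, of w]
    by (simp add: has_bochner_integral_iff)
qed

end

section \<open>Gradients and small initial data\<close>

lemma dir_deriv_eq:
  assumes "(g has_derivative g') (at x)"
  shows "dir_deriv b g x = g' b"
  using frechet_derivative_at[OF assms] by (simp add: dir_deriv_def)

lemma inner_grad_eq:
  assumes g: "(g has_derivative g') (at x)"
  shows "h \<bullet> grad g x = g' h"
proof -
  have lin: "linear g'" using g by (rule has_derivative_linear)
  have "g' h = g' (\<Sum>b\<in>Basis. (h \<bullet> b) *\<^sub>R b)" by (simp add: euclidean_representation)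
  also have "\<dots> = (\<Sum>b\<in>Basis. (h \<bullet> b) * g' b)"
    by (simp add: linear_sum[OF lin] linear_cmul[OF lin])
  finally show ?thesis
    by (simp add: grad_def dir_deriv_eq[OF g] inner_sum_right mult.commute)
qed

lemma grad_eqI:
  assumes "(g has_derivative (\<lambda>h. h \<bullet> w)) (at x)"
  shows "grad g x = w"
proof (rule vector_eq_ldot[THEN iffD1], rule allI)
  show "z \<bullet> grad g x = z \<bullet> w" for z by (rule inner_grad_eq[OF assms])
qed

lemma lipschitz_if_dir_derivs_bounded:
  fixes g :: "'a::euclidean_space \<Rightarrow> real"
  assumes S: "convex S" "x \<in> S" "y \<in> S" and diff: "\<And>x. g differentiable (at x)"
    and B: "\<And>x b. x \<in> S \<Longrightarrow> b \<in> Basis \<Longrightarrow> \<bar>dir_deriv b g x\<bar> \<le> B"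
  shows "\<bar>g x - g y\<bar> \<le> (real DIM('a) * B) * norm (x - y)"
proof -
  have "norm (g x - g y) \<le> (real DIM('a) * B) * norm (x - y)"
  proof (rule differentiable_bound[OF S(1) _ _ S(2,3)])
    fix x assume x: "x \<in> S"
    have d: "(g has_derivative frechet_derivative g (at x)) (at x)"
      using diff by (simp add: frechet_derivative_works)
    then show "(g has_derivative frechet_derivative g (at x)) (at x within S)"
      by (rule has_derivative_at_withinI)
    have B0: "0 \<le> B" using B[OF x SOME_Basis] by linarith
    show "onorm (frechet_derivative g (at x)) \<le> real DIM('a) * B"
    proof (rule onorm_le)
      fix h
      have "frechet_derivative g (at x) h = h \<bullet> grad g x"
        by (rule inner_grad_eq[OF d, symmetric])
      also have "\<dots> = (\<Sum>b\<in>Basis. (h \<bullet> b) * dir_deriv b g x)"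
        by (simp add: grad_def inner_sum_right mult.commute)
      also have "norm \<dots> \<le> (\<Sum>b\<in>(Basis::'a set). norm h * B)"
        using B[OF x] B0 by (intro sum_norm_le) (auto simp: abs_mult Basis_le_norm intro!: mult_mono)
      also have "\<dots> = real DIM('a) * B * norm h" by (simp add: mult_ac)
      finally show "norm (frechet_derivative g (at x) h) \<le> real DIM('a) * B * norm h" .
    qed
  qed
  then show ?thesis by simp
qed

lemma small_data_nonneg: "small_data N M \<epsilon> f0 \<Longrightarrow> 0 \<le> f0 x v"
  by (simp add: small_data_def)

lemma jbracket_ge_1: "1 \<le> jbracket y"
  by (simp add: jbracket_def)

text \<open>The index set is finite, so the sum is not the default value 0 and dominates each of its terms.\<close>

lemma small_data_term:
  assumes sd: "small_data N M \<epsilon> f0" and \<epsilon>: "0 \<le> \<epsilon>" and ord: "mi_order \<beta> + mi_order \<kappa> \<le> N"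
  shows "jbracket s ^ (M + mi_order \<beta>) * jbracket u ^ (M + mi_order \<kappa>) *
    \<bar>mixed_deriv \<beta> \<kappa> (\<lambda>(s, u). bar f0 s u) (s, u)\<bar> \<le> \<epsilon>"
proof -
  let ?I = "{(\<beta>, \<kappa>). mi_order \<beta> + mi_order \<kappa> \<le> N}"
  let ?t = "\<lambda>\<beta> \<kappa> s u. ennreal (jbracket s ^ (M + mi_order \<beta>) * jbracket u ^ (M + mi_order \<kappa>) *
    \<bar>mixed_deriv \<beta> \<kappa> (\<lambda>(s, u). bar f0 s u) (s, u)\<bar>)"
  have "?I \<subseteq> ({..N} \<times> {..N}) \<times> ({..N} \<times> {..N})"
    by (auto simp: mi_order_def)
  then have fin: "finite ?I" by (rule finite_subset) auto
  have "?t \<beta> \<kappa> s u \<le> (SUP (s, u). ?t \<beta> \<kappa> s u)"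
    by (rule SUP_upper2[of "(s, u)"]) auto
  also have "\<dots> \<le> (\<Sum>(\<beta>, \<kappa>)\<in>?I. SUP (s, u). ?t \<beta> \<kappa> s u)"
    using member_le_sum[of "(\<beta>, \<kappa>)" ?I "\<lambda>(\<beta>, \<kappa>). SUP (s, u). ?t \<beta> \<kappa> s u"] fin ord by simp
  also have "\<dots> \<le> ennreal \<epsilon>"
    using sd by (simp add: small_data_def)
  finally show ?thesis using \<epsilon> by (simp add: ennreal_le_iff)
qed

lemma small_data_decay:
  assumes sd: "small_data N M \<epsilon> f0" and \<epsilon>: "0 \<le> \<epsilon>" and M: "6 \<le> M"
  shows "bar f0 s u \<le> 64 * \<epsilon> / ((1 + norm s) ^ 6 * (1 + norm u) ^ 6)"
proof -
  have jb: "(1 + norm y) ^ 6 \<le> 8 * jbracket y ^ M" for y :: "real^2"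
  proof -
    have "(1 + norm y)\<^sup>2 \<le> 2 * (jbracket y)\<^sup>2"
      using sum_squares_bound[of 1 "norm y"] by (simp add: jbracket_def power2_sum)
    then have "((1 + norm y)\<^sup>2) ^ 3 \<le> (2 * (jbracket y)\<^sup>2) ^ 3"
      by (rule power_mono) simp
    then have "(1 + norm y) ^ 6 \<le> 8 * jbracket y ^ 6"
      by (simp add: power_mult_distrib flip: power_mult)
    also have "\<dots> \<le> 8 * jbracket y ^ M"
      using jbracket_ge_1 M by (intro mult_left_mono power_increasing) auto
    finally show ?thesis .
  qed
  have nn: "0 \<le> bar f0 s u" using small_data_nonneg[OF sd] by (simp add: bar_def)
  have "jbracket s ^ M * jbracket u ^ M * bar f0 s u \<le> \<epsilon>"
    using small_data_term[OF sd \<epsilon>, of "(0, 0)" "(0, 0)" s u] nn by (simp add: mi_order_def mixed_deriv_def)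
  have "(1 + norm s) ^ 6 * (1 + norm u) ^ 6 * bar f0 s u \<le> (8 * jbracket s ^ M) * (8 * jbracket u ^ M) * bar f0 s u"
    by (intro mult_right_mono mult_mono jb nn) (auto simp: jbracket_def)
  also have "\<dots> = 64 * (jbracket s ^ M * jbracket u ^ M * bar f0 s u)" by simp
  also have "\<dots> \<le> 64 * \<epsilon>"
    using \<open>jbracket s ^ M * jbracket u ^ M * bar f0 s u \<le> \<epsilon>\<close> by simp
  finally show ?thesis
    by (subst pos_le_divide_eq) (auto intro!: mult_pos_pos zero_less_power simp: mult_ac)
qed

lemma Basis_plane: "(Basis :: (real^2) set) = {axis 1 1, axis 2 1}"
  by (auto simp: Basis_vec_def) (metis exhaust_2)

lemma small_data_lipschitz:
  assumes sd: "small_data N M \<epsilon> f0" and \<epsilon>: "0 \<le> \<epsilon>" and N: "1 \<le> N"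
  shows "\<bar>bar f0 s1 u1 - bar f0 s2 u2\<bar> \<le> 4 * \<epsilon> * (norm (s1 - s2) + norm (u1 - u2))"
proof -
  let ?g = "\<lambda>(s, u). bar f0 s u"
  have diff: "?g differentiable (at p)" for p
  proof -
    obtain n where "N = Suc n" using N by (cases N) auto
    then have d: "(\<lambda>(x, v). f0 x v) differentiable (at q)" for q
      using sd unfolding small_data_def by (cases q) simp
    have "((\<lambda>(x, v). f0 x v) \<circ> (\<lambda>p. (fst p + snd p, snd p - fst p))) differentiable (at p)"
    proof (rule differentiable_chain_at)
      show "(\<lambda>p::(real^2) \<times> (real^2). (fst p + snd p, snd p - fst p)) differentiable (at p)"
        unfolding differentiable_def by (rule exI) (rule derivative_intros | simp)+
    qed (rule d)
    then show ?thesis by (simp add: comp_def bar_def case_prod_unfold)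
  qed
  have bd: "\<bar>dir_deriv b ?g p\<bar> \<le> \<epsilon>" if b: "b \<in> Basis" for b p
  proof -
    obtain s u where p: "p = (s, u)" by (cases p)
    have one: "1 \<le> jbracket s ^ i * jbracket u ^ j" for i j
      using mult_mono[OF one_le_power[OF jbracket_ge_1] one_le_power[OF jbracket_ge_1], of s i u j]
        jbracket_ge_1[of s] by simp
    have *: "\<bar>mixed_deriv \<beta> \<kappa> ?g (s, u)\<bar> \<le> \<epsilon>" if "mi_order \<beta> + mi_order \<kappa> \<le> N" for \<beta> \<kappa>
    proof -
      have "1 * \<bar>mixed_deriv \<beta> \<kappa> ?g (s, u)\<bar>
        \<le> (jbracket s ^ (M + mi_order \<beta>) * jbracket u ^ (M + mi_order \<kappa>)) * \<bar>mixed_deriv \<beta> \<kappa> ?g (s, u)\<bar>"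
        by (intro mult_right_mono one) simp
      also have "\<dots> \<le> \<epsilon>" by (rule small_data_term[OF sd \<epsilon> that])
      finally show ?thesis by simp
    qed
    have "b \<in> {(axis 1 1, 0), (axis 2 1, 0), (0, axis 1 1), (0, axis 2 1)}"
      using b by (auto simp: Basis_prod_def Basis_plane)
    then show ?thesis
      using *[of "(1, 0)" "(0, 0)"] *[of "(0, 1)" "(0, 0)"] *[of "(0, 0)" "(1, 0)"] *[of "(0, 0)" "(0, 1)"] N
      by (auto simp: mixed_deriv_def mi_order_def p)
  qed
  have "\<bar>?g (s1, u1) - ?g (s2, u2)\<bar> \<le> (real DIM((real^2) \<times> (real^2)) * \<epsilon>) * norm ((s1, u1) - (s2, u2))"
    by (rule lipschitz_if_dir_derivs_bounded[of UNIV]) (auto intro: diff bd)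
  also have "\<dots> \<le> (4 * \<epsilon>) * (norm (s1 - s2) + norm (u1 - u2))"
    using \<epsilon> norm_Pair_le[of "s1 - s2" "u1 - u2"] by (auto intro!: mult_left_mono)
  finally show ?thesis by simp
qed

section \<open>Logarithmic potentials of decaying densities\<close>

text \<open>For large distances the logarithm is estimated by \<open>ln (1 + |x|) + 2 (1 + |y|)\<^sup>1\<^sup>/\<^sup>2\<close>, and the square root lowers the decay of order 3 to that of \<^const>\<open>tail_weight\<close>.\<close>

lemma integrable_log_kernel:
  fixes \<rho> :: "real^2 \<Rightarrow> real"
  assumes [measurable]: "\<rho> \<in> borel_measurable borel" and le: "\<And>y. \<bar>\<rho> y\<bar> \<le> A / (1 + norm y) ^ 3"
  shows "integrable lborel (\<lambda>y. ln (norm (x - y)) * \<rho> y)"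
proof -
  have A: "0 \<le> A" using le[of 0] by simp
  define g where "g = (\<lambda>y. A * (indicator {..<1} (norm (x - y)) / norm (x - y) + (ln (1 + norm x) + 2) * tail_weight y))"
  have g_int: "integrable lborel g"
    unfolding g_def using integrable.intros[OF has_bochner_integral_inverse_norm[of 1 x]]
    by (intro integrable_mult_right Bochner_Integration.integrable_add integrable_tail_weight) simp_all
  have *: "norm (ln (norm (x - y)) * \<rho> y) \<le> g y" for y
  proof -
    have lx: "0 \<le> ln (1 + norm x)" by simp
    have pos: "0 \<le> indicator {..<1} (norm (x - y)) / norm (x - y)" by simp
    have tw: "0 \<le> (ln (1 + norm x) + 2) * tail_weight y"
      using lx by (intro mult_nonneg_nonneg tail_weight_nonneg) auto
    show ?thesis
    proof (cases "norm (x - y) < 1")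
      case True
      have "\<bar>ln (norm (x - y))\<bar> \<le> 1 / norm (x - y)"
      proof (cases "x = y")
        case False
        then have "ln (1 / norm (x - y)) \<le> 1 / norm (x - y) - 1"
          by (intro ln_le_minus_one) auto
        then show ?thesis using True False by (simp add: ln_div)
      qed simp
      moreover have "\<bar>\<rho> y\<bar> \<le> A"
      proof -
        have "A / (1 + norm y) ^ 3 \<le> A / 1"
          using A by (intro divide_left_mono one_le_power) auto
        then show ?thesis using le[of y] by simp
      qed
      ultimately have "\<bar>ln (norm (x - y))\<bar> * \<bar>\<rho> y\<bar> \<le> 1 / norm (x - y) * A"
        by (intro mult_mono) auto
      also have "\<dots> \<le> g y"
        unfolding g_def distrib_left using True A mult_nonneg_nonneg[OF A tw] by (simp add: mult.commute)
      finally show ?thesis by (simp add: abs_mult)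
    next
      case False
      have prod: "norm (x - y) \<le> (1 + norm x) * (1 + norm y)"
      proof -
        have "(1 + norm x) * (1 + norm y) = 1 + norm x + norm y + norm x * norm y"
          by (simp add: algebra_simps)
        then show ?thesis
          using norm_triangle_ineq4[of x y] mult_nonneg_nonneg[OF norm_ge_zero[of x] norm_ge_zero[of y]]
          by linarith
      qed
      have "ln (norm (x - y)) \<le> ln ((1 + norm x) * (1 + norm y))"
        using prod False by (subst ln_le_cancel_iff) (auto intro!: mult_pos_pos)
      also have "\<dots> = ln (1 + norm x) + ln (1 + norm y)"
        by (simp add: ln_mult)
      also have "ln (1 + norm y) \<le> 2 * (1 + norm y) powr (1 / 2)"
      proof -
        have "ln (1 + norm y) = 2 * ln ((1 + norm y) powr (1 / 2))"
          by (simp add: ln_powr)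
        also have "\<dots> \<le> 2 * (1 + norm y) powr (1 / 2)"
          using ln_le_minus_one[of "(1 + norm y) powr (1 / 2)"] by simp
        finally show ?thesis .
      qed
      also have "ln (1 + norm x) \<le> ln (1 + norm x) * (1 + norm y) powr (1 / 2)"
        using mult_left_mono[OF ge_one_powr_ge_zero[of "1 + norm y" "1 / 2"] lx] by simp
      finally have "\<bar>ln (norm (x - y))\<bar> \<le> (ln (1 + norm x) + 2) * (1 + norm y) powr (1 / 2)"
        using False by (simp add: distrib_right)
      then have "\<bar>ln (norm (x - y))\<bar> * \<bar>\<rho> y\<bar> \<le> ((ln (1 + norm x) + 2) * (1 + norm y) powr (1 / 2)) * (A / (1 + norm y) ^ 3)"
        using le lx by (intro mult_mono) auto
      also have "\<dots> = A * ((ln (1 + norm x) + 2) * ((1 + norm y) powr (1 / 2) * (1 / (1 + norm y) ^ 3)))"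
        by simp
      also have "(1 + norm y) powr (1 / 2) * (1 / (1 + norm y) ^ 3) = tail_weight y"
      proof -
        have "1 / (1 + norm y) ^ 3 = (1 + norm y) powr (- 3)"
          by (simp add: powr_minus_divide)
        then show ?thesis by (simp add: tail_weight_def flip: powr_add)
      qed
      also have "A * ((ln (1 + norm x) + 2) * tail_weight y) \<le> g y"
        unfolding g_def using A pos by (intro mult_left_mono) auto
      finally show ?thesis by (simp add: abs_mult)
    qed
  qed
  show ?thesis
  proof (rule Bochner_Integration.integrable_bound[OF g_int])
    show "AE y in lborel. norm (ln (norm (x - y)) * \<rho> y) \<le> norm (g y)"
    proof (rule AE_I2)
      show "norm (ln (norm (x - y)) * \<rho> y) \<le> norm (g y)" for y
        using order_trans[OF *[of y] abs_ge_self[of "g y"]] by simp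
    qed
  qed simp
qed

section \<open>The profile of a Vlasov--Poisson solution\<close>

lemma C1_half_space_derivative:
  assumes "C1_half_space g"
  shows "\<exists>D. (\<forall>t\<ge>0. \<forall>x. ((\<lambda>(t, x). g t x) has_derivative blinfun_apply (D (t, x))) (at (t, x) within {0..} \<times> UNIV))
    \<and> continuous_on ({0..} \<times> UNIV) D
    \<and> (\<forall>t\<ge>0. \<forall>x. (g t has_derivative (\<lambda>h. blinfun_apply (D (t, x)) (0::real, h))) (at x))"
proof -
  obtain D where D: "\<And>p. p \<in> {0..} \<times> UNIV \<Longrightarrow>
      ((\<lambda>(t, x). g t x) has_derivative blinfun_apply (D p)) (at p within {0..} \<times> UNIV)"
    and cont: "continuous_on ({0..} \<times> UNIV) D"
    using assms unfolding C1_half_space_def by blast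
  have D': "((\<lambda>(t, x). g t x) has_derivative blinfun_apply (D (t, x))) (at (t, x) within {0..} \<times> UNIV)"
    if "0 \<le> t" for t x
    by (rule D) (use that in auto)
  have "(g t has_derivative (\<lambda>h. blinfun_apply (D (t, x)) (0::real, h))) (at x)" if t: "0 \<le> t" for t x
  proof -
    have 1: "((\<lambda>y. (t, y)) has_derivative (\<lambda>h. (0, h))) (at x within UNIV)"
      by (auto intro!: derivative_eq_intros)
    have 2: "((\<lambda>(t, x). g t x) has_derivative blinfun_apply (D (t, x))) (at (t, x) within range (\<lambda>y. (t, y)))"
      by (rule has_derivative_subset[OF D'[OF t]]) (use t in auto)
    from has_derivative_in_compose[OF 1 2] show ?thesis by simp
  qed
  with D' cont show ?thesis by (intro exI[of _ D]) simp
qed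

lemma C1_half_space_continuous_on:
  assumes "C1_half_space g"
  shows "continuous_on ({0..} \<times> UNIV) (\<lambda>(t, x). g t x)"
  using assms unfolding C1_half_space_def
  by (auto simp: continuous_on_eq_continuous_within intro: has_derivative_continuous)

lemma C1_half_space_slice_continuous:
  assumes "C1_half_space g" "0 \<le> t"
  shows "continuous_on UNIV (g t)"
  by (rule continuous_on_compose2[OF C1_half_space_continuous_on[OF assms(1)], where f="\<lambda>x. (t, x)", simplified])
    (use assms in \<open>auto intro!: continuous_intros\<close>)

lemma at_within_atLeast_neq_bot:
  fixes t :: real
  assumes "0 \<le> t"
  shows "at t within {0..} \<noteq> bot"
proof -
  have "at_right t \<le> at t within {0..}"
    using assms by (intro at_le) auto
  moreover have "at_right t \<noteq> bot" by (rule trivial_limit_at_right_real)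
  ultimately show ?thesis by (auto simp: bot_unique)
qed

locale vlasov_poisson =
  fixes \<mu> :: real and f0 :: "real^2 \<Rightarrow> real^2 \<Rightarrow> real" and f :: "real \<Rightarrow> real^2 \<Rightarrow> real^2 \<Rightarrow> real"
  assumes mu: "\<bar>\<mu>\<bar> = 1" and VP: "VP_solution \<mu> f0 f"
begin

abbreviation "rho \<equiv> \<lambda>t. density (f t)"

abbreviation "phi \<equiv> \<lambda>t. log_potential (rho t)"

lemma VP_parts:
  shows f_C1: "C1_half_space (\<lambda>t (x, v). f t x v)"
    and log_int: "0 \<le> t \<Longrightarrow> integrable lborel (\<lambda>y. ln (norm (x - y)) * rho t y)"
    and rho_C1: "C1_half_space rho" and phi_C1: "C1_half_space phi"
    and phi_C2: "0 \<le> t \<Longrightarrow> C_class 2 (phi t)"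
    and hessian_cont: "b \<in> Basis \<Longrightarrow> c \<in> Basis \<Longrightarrow>
       continuous_on ({0..} \<times> UNIV) (\<lambda>(t, x). dir_deriv c (dir_deriv b (phi t)) x)"
    and grad_bounded: "\<exists>C. \<forall>t\<in>{0..T}. \<forall>x. norm (grad (phi t) x) \<le> C"
    and vlasov: "0 \<le> t \<Longrightarrow> vector_derivative (\<lambda>\<tau>. f \<tau> x v) (at t within {0..})
         + v \<bullet> grad (\<lambda>y. f t y v) x + x \<bullet> grad (f t x) v
         - \<mu> * (grad (phi t) x \<bullet> grad (f t x) v) = 0"
    and initial: "f 0 x v = f0 x v"
proof -
  note p1 = VP[unfolded VP_solution_def Let_def]
  note p3 = p1[THEN conjunct2, THEN conjunct2]
  note p4 = p3[THEN conjunct2]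
  note p5 = p4[THEN conjunct2]
  note p6 = p5[THEN conjunct2]
  note p7 = p6[THEN conjunct2]
  note p8 = p7[THEN conjunct2]
  note p9 = p8[THEN conjunct2]
  show "C1_half_space (\<lambda>t (x, v). f t x v)" by (rule p1[THEN conjunct1])
  show "integrable lborel (\<lambda>y. ln (norm (x - y)) * rho t y)" if "0 \<le> t"
    using p3[THEN conjunct1, rule_format, OF that] .
  show "C1_half_space rho" by (rule p4[THEN conjunct1])
  show "C1_half_space phi" by (rule p5[THEN conjunct1])
  show "C_class 2 (phi t)" if "0 \<le> t" by (rule p6[THEN conjunct1, rule_format, OF that])
  show "continuous_on ({0..} \<times> UNIV) (\<lambda>(t, x). dir_deriv c (dir_deriv b (phi t)) x)"
    if "b \<in> Basis" "c \<in> Basis" by (rule p7[THEN conjunct1, rule_format, OF that])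
  show "\<exists>C. \<forall>t\<in>{0..T}. \<forall>x. norm (grad (phi t) x) \<le> C" by (rule p8[THEN conjunct1, THEN spec])
  show "vector_derivative (\<lambda>\<tau>. f \<tau> x v) (at t within {0..})
         + v \<bullet> grad (\<lambda>y. f t y v) x + x \<bullet> grad (f t x) v
         - \<mu> * (grad (phi t) x \<bullet> grad (f t x) v) = 0" if "0 \<le> t"
    using p9[THEN conjunct1, rule_format, OF that] .
  show "f 0 x v = f0 x v" using p9[THEN conjunct2, THEN conjunct2] by blast
qed

definition profile :: "real \<Rightarrow> real^2 \<Rightarrow> real^2 \<Rightarrow> real" where
  "profile t s u = bar (f t) (exp (- t) *\<^sub>R s) (exp t *\<^sub>R u)"

definition profile_field :: "real \<Rightarrow> real^2 \<Rightarrow> real^2" where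
  "profile_field t y = exp t *\<^sub>R grad (phi t) (exp t *\<^sub>R y)"

lemma grad_phi_cont: "continuous_on ({0..} \<times> UNIV) (\<lambda>(t, x). grad (phi t) x)"
proof -
  from C1_half_space_derivative[OF phi_C1] obtain D where D: "continuous_on ({0..} \<times> UNIV) D"
    and D': "\<forall>t\<ge>0. \<forall>x. (phi t has_derivative (\<lambda>h. blinfun_apply (D (t, x)) (0::real, h))) (at x)"
    by (elim exE conjE) (rule that, assumption+)
  have "continuous_on ({0..} \<times> UNIV) (\<lambda>p. \<Sum>b\<in>Basis. blinfun_apply (D p) (0, b) *\<^sub>R b)"
    by (intro continuous_intros D)
  then show ?thesis
  proof (rule continuous_on_eq)
    fix p :: "real \<times> (real^2)" assume "p \<in> {0..} \<times> UNIV"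
    then obtain t x where p: "p = (t, x)" and t: "0 \<le> t" by auto
    show "(\<Sum>b\<in>Basis. blinfun_apply (D p) (0, b) *\<^sub>R b) = (case p of (t, x) \<Rightarrow> grad (phi t) x)"
      unfolding grad_def p prod.case dir_deriv_eq[OF D'[rule_format, OF t]] ..
  qed
qed

lemma profile_field_cont: "continuous_on ({0..} \<times> UNIV) (\<lambda>(t, y). profile_field t y)"
proof -
  have "continuous_on ({0..} \<times> UNIV) (\<lambda>p. exp (fst p) *\<^sub>R (\<lambda>(t, x). grad (phi t) x) (fst p, exp (fst p) *\<^sub>R snd p))"
    by (intro continuous_intros continuous_on_compose2[OF grad_phi_cont]) (auto intro!: continuous_intros)
  then show ?thesis by (simp add: profile_field_def case_prod_unfold)
qed

lemma profile_cont:
  assumes t: "0 \<le> t"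
  shows "continuous_on UNIV (\<lambda>(s, u). profile t s u)"
proof -
  have "continuous_on UNIV (\<lambda>p. (\<lambda>(x, v). f t x v)
     (exp (- t) *\<^sub>R fst p + exp t *\<^sub>R snd p, exp t *\<^sub>R snd p - exp (- t) *\<^sub>R fst p))"
    by (rule continuous_on_compose2[OF C1_half_space_slice_continuous[OF f_C1 t]]) (auto intro!: continuous_intros)
  then show ?thesis by (simp add: profile_def bar_def case_prod_unfold)
qed

lemma profile_field_bounded: "\<exists>C. \<forall>t\<in>{0..T}. \<forall>y. norm (profile_field t y) \<le> C"
proof -
  obtain C where C: "\<forall>t\<in>{0..T}. \<forall>x. norm (grad (phi t) x) \<le> C" using grad_bounded by blast
  have "norm (profile_field t y) \<le> exp T * C" if "t \<in> {0..T}" for t y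
  proof -
    have "norm (profile_field t y) = exp t * norm (grad (phi t) (exp t *\<^sub>R y))"
      by (simp add: profile_field_def)
    also have "\<dots> \<le> exp T * C" using C that by (intro mult_mono) auto
    finally show ?thesis .
  qed
  then show ?thesis by blast
qed

text \<open>The second derivatives are jointly continuous, hence bounded on compact sets; no uniform bound over the plane is available at this stage.\<close>

lemma grad_phi_lipschitz:
  assumes T: "0 \<le> T"
  shows "\<exists>L\<ge>0. \<forall>t\<in>{0..T}. \<forall>x\<in>cball 0 R. \<forall>y\<in>cball 0 R. norm (grad (phi t) x - grad (phi t) y) \<le> L * norm (x - y)"
proof -
  have "\<exists>B. \<forall>t\<in>{0..T}. \<forall>x\<in>cball 0 R. \<bar>dir_deriv c (dir_deriv b (phi t)) x\<bar> \<le> B"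
    if "b \<in> Basis" "c \<in> Basis" for b c
  proof -
    have "continuous_on ({0..T} \<times> cball 0 R) (\<lambda>(t, x). dir_deriv c (dir_deriv b (phi t)) x)"
      by (rule continuous_on_subset[OF hessian_cont[OF that]]) auto
    then have "bounded ((\<lambda>(t, x). dir_deriv c (dir_deriv b (phi t)) x) ` ({0..T} \<times> cball 0 R))"
      by (intro compact_imp_bounded compact_continuous_image compact_Times) auto
    then show ?thesis unfolding bounded_iff by fastforce
  qed
  then obtain B where B: "\<And>b c t x. b \<in> Basis \<Longrightarrow> c \<in> Basis \<Longrightarrow> t \<in> {0..T} \<Longrightarrow> x \<in> cball 0 R \<Longrightarrow>
      \<bar>dir_deriv c (dir_deriv b (phi t)) x\<bar> \<le> B b c"
    by metis
  define C where "C = (\<Sum>b\<in>Basis. \<Sum>c\<in>Basis. \<bar>B b c\<bar>)"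
  have C: "\<bar>dir_deriv c (dir_deriv b (phi t)) x\<bar> \<le> C"
    if "b \<in> Basis" "c \<in> Basis" "t \<in> {0..T}" "x \<in> cball 0 R" for b c t x
  proof -
    have "\<bar>dir_deriv c (dir_deriv b (phi t)) x\<bar> \<le> \<bar>B b c\<bar>" using B[OF that] by linarith
    also have "\<dots> \<le> (\<Sum>c\<in>Basis. \<bar>B b c\<bar>)"
      using that by (intro member_le_sum) auto
    also have "\<dots> \<le> C"
      unfolding C_def using that by (intro member_le_sum) (auto intro: sum_nonneg)
    finally show ?thesis .
  qed
  have C0: "0 \<le> C" by (auto simp: C_def intro!: sum_nonneg)
  have "norm (grad (phi t) x - grad (phi t) y) \<le> (2 * (2 * C)) * norm (x - y)"
    if t: "t \<in> {0..T}" and xy: "x \<in> cball 0 R" "y \<in> cball 0 R" for t x y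
  proof -
    have "C_class (Suc (Suc 0)) (phi t)"
      using phi_C2[of t] t by (simp add: numeral_2_eq_2)
    then have diff: "dir_deriv b (phi t) differentiable (at z)" if "b \<in> Basis" for b z
      using that by auto
    have "grad (phi t) x - grad (phi t) y = (\<Sum>b\<in>Basis. (dir_deriv b (phi t) x - dir_deriv b (phi t) y) *\<^sub>R b)"
      by (simp add: grad_def scaleR_diff_left sum_subtractf)
    also have "norm \<dots> \<le> (\<Sum>b\<in>(Basis :: (real^2) set). (2 * C) * norm (x - y))"
    proof (rule sum_norm_le)
      fix b :: "real^2" assume b: "b \<in> Basis"
      have "\<bar>dir_deriv b (phi t) x - dir_deriv b (phi t) y\<bar> \<le> (real DIM(real^2) * C) * norm (x - y)"
        by (rule lipschitz_if_dir_derivs_bounded[of "cball 0 R"]) (use xy diff[OF b] C[OF b _ t] in auto)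
      then show "norm ((dir_deriv b (phi t) x - dir_deriv b (phi t) y) *\<^sub>R b) \<le> (2 * C) * norm (x - y)"
        using b by simp
    qed
    also have "\<dots> = (2 * (2 * C)) * norm (x - y)" by simp
    finally show ?thesis .
  qed
  then show ?thesis using C0 by (intro exI[of _ "2 * (2 * C)"]) auto
qed

text \<open>The chain rule turns the Vlasov equation into the vanishing of this derivative; at the end points of the interval all derivatives are one-sided.\<close>

lemma constant_along_characteristics:
  assumes t: "t \<in> {0..T}"
    and X: "(X has_vector_derivative V t) (at t within {0..T})"
    and V: "(V has_vector_derivative X t - \<mu> *\<^sub>R grad (phi t) (X t)) (at t within {0..T})"
  shows "((\<lambda>r. f r (X r) (V r)) has_vector_derivative 0) (at t within {0..T})"
proof -
  from C1_half_space_derivative[OF f_C1] obtain D where D: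
    "\<forall>t\<ge>0. \<forall>p. ((\<lambda>(t, p). (case p of (x, v) \<Rightarrow> f t x v)) has_derivative blinfun_apply (D (t, p))) (at (t, p) within {0..} \<times> UNIV)"
    by (elim exE conjE) (rule that, assumption+)
  define x where "x = X t"
  define v where "v = V t"
  define W where "W = x - \<mu> *\<^sub>R grad (phi t) x"
  have t0: "0 \<le> t" using t by simp
  define D0 where "D0 = blinfun_apply (D (t, (x, v)))"
  have D0: "((\<lambda>(t, p). (case p of (x, v) \<Rightarrow> f t x v)) has_derivative D0) (at (t, (x, v)) within {0..} \<times> UNIV)"
    unfolding D0_def by (rule D[rule_format, OF t0])
  have lin: "linear D0" unfolding D0_def by (rule bounded_linear.linear[OF blinfun.bounded_linear_right])
  have slice: "((\<lambda>z. (\<lambda>(t, p). (case p of (x, v) \<Rightarrow> f t x v)) (g z)) has_derivative (\<lambda>h. D0 (g' h))) (at z0 within S)"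
    if g: "(g has_derivative g') (at z0 within S)" and "g z0 = (t, (x, v))" "g ` S \<subseteq> {0..} \<times> UNIV"
    for g :: "'z::real_normed_vector \<Rightarrow> real \<times> (real^2) \<times> (real^2)" and g' z0 S
  proof (rule has_derivative_in_compose[OF g])
    show "((\<lambda>(t, p). (case p of (x, v) \<Rightarrow> f t x v)) has_derivative D0) (at (g z0) within g ` S)"
      unfolding that(2) by (rule has_derivative_subset[OF D0 that(3)])
  qed
  have dt: "vector_derivative (\<lambda>\<tau>. f \<tau> x v) (at t within {0..}) = D0 (1, 0)"
  proof (rule vector_derivative_within[OF at_within_atLeast_neq_bot[OF t0]])
    have "((\<lambda>\<tau>. (\<tau>, (x, v))) has_derivative (\<lambda>h. (h, 0))) (at t within {0..})"
      by (rule has_derivative_Pair[OF has_derivative_ident has_derivative_const])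
    from slice[OF this] have hD: "((\<lambda>\<tau>. f \<tau> x v) has_derivative (\<lambda>h. D0 (h, 0))) (at t within {0..})"
      by (simp add: image_subset_iff)
    have "D0 (h, 0) = h *\<^sub>R D0 (1, 0)" for h
      using linear_cmul[OF lin, of h "(1, 0)"] by simp
    then have eq: "(\<lambda>h. D0 (h, 0)) = (\<lambda>h. h *\<^sub>R D0 (1, 0))" by (rule ext)
    show "((\<lambda>\<tau>. f \<tau> x v) has_vector_derivative D0 (1, 0)) (at t within {0..})"
      unfolding has_vector_derivative_def by (rule has_derivative_eq_rhs[OF hD eq])
  qed
  have dx: "h \<bullet> grad (\<lambda>y. f t y v) x = D0 (0, (h, 0))" for h
  proof (rule inner_grad_eq)
    have "((\<lambda>y. (t, (y, v))) has_derivative (\<lambda>h. (0, (h, 0)))) (at x within UNIV)"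
      by (rule has_derivative_Pair[OF has_derivative_const has_derivative_Pair[OF has_derivative_ident has_derivative_const]])
    from slice[OF this] show "((\<lambda>y. f t y v) has_derivative (\<lambda>h. D0 (0, (h, 0)))) (at x)"
      using t0 by (simp add: image_subset_iff)
  qed
  have dv: "h \<bullet> grad (f t x) v = D0 (0, (0, h))" for h
  proof (rule inner_grad_eq)
    have "((\<lambda>y. (t, (x, y))) has_derivative (\<lambda>h. (0, (0, h)))) (at v within UNIV)"
      by (rule has_derivative_Pair[OF has_derivative_const has_derivative_Pair[OF has_derivative_const has_derivative_ident]])
    from slice[OF this] show "((f t x) has_derivative (\<lambda>h. D0 (0, (0, h)))) (at v)"
      using t0 by (simp add: image_subset_iff)
  qed
  have "(1::real, (v, W)) = (1, 0) + ((0, (v, 0)) + (0, (0, W)))" by simp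
  then have "D0 (1, (v, W)) = D0 (1, 0) + (D0 (0, (v, 0)) + D0 (0, (0, W)))"
    by (simp only: linear_add[OF lin])
  also have "\<dots> = 0"
  proof -
    have "W \<bullet> grad (f t x) v = x \<bullet> grad (f t x) v - \<mu> * (grad (phi t) x \<bullet> grad (f t x) v)"
      by (simp add: W_def inner_diff_left)
    then show ?thesis
      using vlasov[OF t0, of x v] unfolding dt dx[symmetric] dv[symmetric] by linarith
  qed
  finally have zero: "D0 (1, (v, W)) = 0" .
  have "((\<lambda>r. (r, (X r, V r))) has_derivative (\<lambda>h. (h, (h *\<^sub>R v, h *\<^sub>R W)))) (at t within {0..T})"
    using X V unfolding has_vector_derivative_def v_def W_def x_def
    by (rule has_derivative_Pair[OF has_derivative_ident has_derivative_Pair])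
  from slice[OF this] have hD: "((\<lambda>r. f r (X r) (V r)) has_derivative (\<lambda>h. D0 (h, (h *\<^sub>R v, h *\<^sub>R W)))) (at t within {0..T})"
    by (simp add: image_subset_iff x_def v_def)
  have "D0 (h, (h *\<^sub>R v, h *\<^sub>R W)) = h *\<^sub>R 0" for h
    using linear_cmul[OF lin, of h "(1, (v, W))"] zero by simp
  then have eq: "(\<lambda>h. D0 (h, (h *\<^sub>R v, h *\<^sub>R W))) = (\<lambda>h. h *\<^sub>R 0)" by (rule ext)
  show ?thesis unfolding has_vector_derivative_def by (rule has_derivative_eq_rhs[OF hD eq])
qed

lemma profile_trajectory_ex:
  assumes t: "0 \<le> t"
  shows "\<exists>\<sigma> \<nu>. trajectory \<mu> profile_field t \<sigma> \<nu> \<and> \<sigma> t = s \<and> \<nu> t = u \<and>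
     (\<forall>r\<in>{0..t}. profile r (\<sigma> r) (\<nu> r) = profile t s u)"
proof -
  define G where "G = (\<lambda>r (z::(real^2) \<times> (real^2)). profile_field r (snd z + exp (- 2 * r) *\<^sub>R fst z))"
  define g where "g = (\<lambda>r z. ((\<mu> / 2) *\<^sub>R G r z, (- (\<mu> / 2) * exp (- 2 * r)) *\<^sub>R G r z))"
  have "continuous_on ({0..t} \<times> UNIV) (\<lambda>p. (\<lambda>(t, y). profile_field t y) (fst p, snd (snd p) + exp (- 2 * fst p) *\<^sub>R fst (snd p)))"
    by (rule continuous_on_compose2[OF profile_field_cont]) (auto intro!: continuous_intros)
  then have G_cont: "continuous_on ({0..t} \<times> UNIV) (\<lambda>p. G (fst p) (snd p))"
    by (simp add: G_def)
  obtain C where C: "\<And>r y. r \<in> {0..t} \<Longrightarrow> norm (profile_field r y) \<le> C"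
    using profile_field_bounded by blast
  have pair_le: "norm ((\<mu> / 2) *\<^sub>R a, (- (\<mu> / 2) * exp (- 2 * r)) *\<^sub>R a) \<le> norm a" if "0 \<le> r" for a :: "real^2" and r
  proof -
    have "norm ((\<mu> / 2) *\<^sub>R a, (- (\<mu> / 2) * exp (- 2 * r)) *\<^sub>R a) \<le> norm ((\<mu> / 2) *\<^sub>R a) + norm ((- (\<mu> / 2) * exp (- 2 * r)) *\<^sub>R a)"
      by (rule norm_Pair_le)
    also have "\<dots> = 1 / 2 * norm a + 1 / 2 * (exp (- 2 * r) * norm a)"
      using mu by (simp add: abs_mult)
    also have "exp (- 2 * r) * norm a \<le> 1 * norm a"
      using that by (intro mult_right_mono) auto
    finally show ?thesis by simp
  qed
  have "\<exists>z. z t = (s, u) \<and> (\<forall>r\<in>{0..t}. (z has_vector_derivative g r (z r)) (at r within {0..t}))"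
  proof (rule ode_exists_terminal[OF t])
    show "continuous_on ({0..t} \<times> UNIV) (\<lambda>(r, z). g r z)"
      unfolding g_def case_prod_unfold by (intro continuous_intros G_cont)
    show "norm (g r z) \<le> C" if "r \<in> {0..t}" for r z
      unfolding g_def using pair_le[of r "G r z"] C[OF that] that by (auto simp: G_def intro: order_trans)
    fix R :: real
    define R' where "R' = exp t * (2 * R)"
    obtain L where L: "0 \<le> L" "\<And>r x y. r \<in> {0..t} \<Longrightarrow> x \<in> cball 0 R' \<Longrightarrow> y \<in> cball 0 R' \<Longrightarrow>
        norm (grad (phi r) x - grad (phi r) y) \<le> L * norm (x - y)"
      using grad_phi_lipschitz[OF t, of R'] by blast
    have "norm (g r z1 - g r z2) \<le> (exp t * (L * (exp t * 2))) * norm (z1 - z2)"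
      if r: "r \<in> {0..t}" and z: "z1 \<in> cball 0 R" "z2 \<in> cball 0 R" for r z1 z2
    proof -
      define y where "y = (\<lambda>z::(real^2) \<times> (real^2). snd z + exp (- 2 * r) *\<^sub>R fst z)"
      have y_le: "norm (y z) \<le> 2 * norm z" for z
      proof -
        have "norm (y z) \<le> norm (snd z) + exp (- 2 * r) * norm (fst z)"
          unfolding y_def by (rule order_trans[OF norm_triangle_ineq]) simp
        also have "\<dots> \<le> norm z + 1 * norm z"
          using r norm_fst_le[of "fst z" "snd z"] norm_snd_le[of "snd z" "fst z"]
          by (intro add_mono mult_mono) auto
        finally show ?thesis by simp
      qed
      have in_ball: "exp r *\<^sub>R y z \<in> cball 0 R'" if "z \<in> cball 0 R" for z
      proof -
        have "exp r * norm (y z) \<le> exp t * (2 * R)"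
          using r y_le[of z] that by (intro mult_mono) auto
        then show ?thesis by (simp add: R'_def)
      qed
      have y_diff: "y z1 - y z2 = y (z1 - z2)"
        by (simp add: y_def algebra_simps)
      have "g r z1 - g r z2 = ((\<mu> / 2) *\<^sub>R (G r z1 - G r z2), (- (\<mu> / 2) * exp (- 2 * r)) *\<^sub>R (G r z1 - G r z2))"
        by (simp add: g_def scaleR_diff_right)
      then have "norm (g r z1 - g r z2) \<le> norm (G r z1 - G r z2)"
        using pair_le[of r "G r z1 - G r z2"] r by simp
      also have "\<dots> = exp r * norm (grad (phi r) (exp r *\<^sub>R y z1) - grad (phi r) (exp r *\<^sub>R y z2))"
        by (simp add: G_def profile_field_def y_def flip: scaleR_diff_right)
      also have "\<dots> \<le> exp t * (L * norm (exp r *\<^sub>R y z1 - exp r *\<^sub>R y z2))"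
        using r z by (intro mult_mono L in_ball) auto
      also have "norm (exp r *\<^sub>R y z1 - exp r *\<^sub>R y z2) = exp r * norm (y (z1 - z2))"
        by (simp add: y_diff flip: scaleR_diff_right)
      also have "exp t * (L * (exp r * norm (y (z1 - z2)))) \<le> exp t * (L * (exp t * (2 * norm (z1 - z2))))"
        using r L(1) y_le by (intro mult_left_mono mult_mono) auto
      finally show ?thesis by (simp add: mult_ac)
    qed
    then show "\<exists>L. \<forall>r\<in>{0..t}. \<forall>x\<in>cball 0 R. \<forall>y\<in>cball 0 R. norm (g r x - g r y) \<le> L * norm (x - y)"
      by blast
  qed
  then obtain z where z: "z t = (s, u)" "\<And>r. r \<in> {0..t} \<Longrightarrow> (z has_vector_derivative g r (z r)) (at r within {0..t})"
    by blast
  define \<sigma> where "\<sigma> = (\<lambda>r. fst (z r))"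
  define \<nu> where "\<nu> = (\<lambda>r. snd (z r))"
  define h where "h = (\<lambda>r. profile_field r (\<nu> r + exp (- 2 * r) *\<^sub>R \<sigma> r))"
  have d\<sigma>: "(\<sigma> has_vector_derivative (\<mu> / 2) *\<^sub>R h r) (at r within {0..t})"
    and d\<nu>: "(\<nu> has_vector_derivative (- (\<mu> / 2) * exp (- 2 * r)) *\<^sub>R h r) (at r within {0..t})"
    if "r \<in> {0..t}" for r
    using bounded_linear.has_vector_derivative[OF bounded_linear_fst z(2)[OF that]]
      bounded_linear.has_vector_derivative[OF bounded_linear_snd z(2)[OF that]]
    by (simp_all add: \<sigma>_def \<nu>_def h_def g_def G_def)
  have tr: "trajectory \<mu> profile_field t \<sigma> \<nu>"
    unfolding trajectory_def using d\<sigma> d\<nu> by (auto simp: h_def)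
  define X where "X = (\<lambda>r. exp (- r) *\<^sub>R \<sigma> r + exp r *\<^sub>R \<nu> r)"
  define V where "V = (\<lambda>r. exp r *\<^sub>R \<nu> r - exp (- r) *\<^sub>R \<sigma> r)"
  have fX: "profile r (\<sigma> r) (\<nu> r) = f r (X r) (V r)" for r
    by (simp add: profile_def bar_def X_def V_def)
  have const: "((\<lambda>r. f r (X r) (V r)) has_vector_derivative 0) (at r within {0..t})" if r: "r \<in> {0..t}" for r
  proof (rule constant_along_characteristics[OF r])
    have e: "exp r * exp (- 2 * r) = exp (- r)" by (simp flip: exp_add)
    have hX: "exp (- r) *\<^sub>R h r = grad (phi r) (X r)"
    proof -
      have "exp r *\<^sub>R (\<nu> r + exp (- 2 * r) *\<^sub>R \<sigma> r) = X r"
        using e by (simp add: X_def scaleR_add_right add.commute)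
      then show ?thesis by (simp add: h_def profile_field_def flip: exp_add)
    qed
    have A: "((\<lambda>r. exp (- r) *\<^sub>R \<sigma> r) has_vector_derivative
        exp (- r) *\<^sub>R ((\<mu> / 2) *\<^sub>R h r) + (- exp (- r)) *\<^sub>R \<sigma> r) (at r within {0..t})"
      by (rule has_vector_derivative_scaleR[OF _ d\<sigma>[OF r]])
        (auto intro!: derivative_eq_intros)
    have B: "((\<lambda>r. exp r *\<^sub>R \<nu> r) has_vector_derivative
        exp r *\<^sub>R ((- (\<mu> / 2) * exp (- 2 * r)) *\<^sub>R h r) + exp r *\<^sub>R \<nu> r) (at r within {0..t})"
      by (rule has_vector_derivative_scaleR[OF _ d\<nu>[OF r]])
        (auto intro!: derivative_eq_intros)
    have B': "exp r *\<^sub>R ((- (\<mu> / 2) * exp (- 2 * r)) *\<^sub>R h r) = - ((\<mu> / 2) *\<^sub>R (exp (- r) *\<^sub>R h r))"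
      using e by (simp add: mult.commute mult.left_commute)
    have A': "exp (- r) *\<^sub>R ((\<mu> / 2) *\<^sub>R h r) = (\<mu> / 2) *\<^sub>R (exp (- r) *\<^sub>R h r)"
      by (simp add: mult.commute)
    have half: "\<mu> *\<^sub>R a = (\<mu> / 2) *\<^sub>R a + (\<mu> / 2) *\<^sub>R a" for a :: "real^2"
      by (simp flip: scaleR_add_left)
    show "(X has_vector_derivative V r) (at r within {0..t})"
      using has_vector_derivative_add[OF A B] unfolding A' B' X_def V_def by simp
    show "(V has_vector_derivative X r - \<mu> *\<^sub>R grad (phi r) (X r)) (at r within {0..t})"
      using has_vector_derivative_diff[OF B A]
      unfolding A' B' hX half unfolding V_def[abs_def] by (simp add: X_def add.commute)
  qed
  have eq: "f r (X r) (V r) = f t (X t) (V t)" if "r \<in> {0..t}" for r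
    by (rule has_derivative_zero_unique[of "{0..t}" "\<lambda>r. f r (X r) (V r)"])
      (use const that t in \<open>auto simp: has_vector_derivative_def\<close>)
  have fin: "\<sigma> t = s" "\<nu> t = u" by (simp_all add: \<sigma>_def \<nu>_def z(1))
  have "profile r (\<sigma> r) (\<nu> r) = profile t s u" if "r \<in> {0..t}" for r
    unfolding fX[of r] eq[OF that] fX[of t, symmetric] fin ..
  with tr fin show ?thesis by blast
qed

end

section \<open>The weak limits\<close>

lemma grad_kernel_scale:
  assumes "0 < c"
  shows "grad_kernel (c *\<^sub>R a) = (1 / c) *\<^sub>R grad_kernel a"
  using assms by (simp add: grad_kernel_def power2_eq_square)

lemma test_function_compact_support:
  fixes \<psi> :: "(real^2) \<times> (real^2) \<Rightarrow> real"
  assumes "test_function \<psi>"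
  obtains R m where "continuous_on UNIV \<psi>" "0 \<le> R"
    "\<And>s u. \<psi> (s, u) \<noteq> 0 \<Longrightarrow> norm s \<le> R \<and> norm u \<le> R" "\<And>p. \<bar>\<psi> p\<bar> \<le> m"
proof -
  let ?S = "closure {x. \<psi> x \<noteq> 0}"
  have C0: "C_class 0 \<psi>" and S: "compact ?S"
    using assms unfolding test_function_def by blast+
  have cont: "continuous_on UNIV \<psi>"
    using C0 by (simp only: C_class.simps)
  obtain R where R: "\<And>p. p \<in> ?S \<Longrightarrow> norm p \<le> R" "0 < R"
    using compact_imp_bounded[OF S] by (auto simp: bounded_pos)
  have "bounded (\<psi> ` ?S)"
    by (intro compact_imp_bounded compact_continuous_image S continuous_on_subset[OF cont]) auto
  then obtain m where m: "\<And>p. p \<in> ?S \<Longrightarrow> \<bar>\<psi> p\<bar> \<le> m" "0 < m"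
    by (auto simp: bounded_pos)
  have in_S: "p \<in> ?S" if "\<psi> p \<noteq> 0" for p
    using that closure_subset[of "{x. \<psi> x \<noteq> 0}"] by auto
  have "norm s \<le> R \<and> norm u \<le> R" if "\<psi> (s, u) \<noteq> 0" for s u
    using R(1)[OF in_S[OF that]] norm_fst_le[of s u] norm_snd_le[of u s] by simp
  moreover have "\<bar>\<psi> p\<bar> \<le> m" for p
    using m in_S[of p] by (cases "\<psi> p = 0") auto
  ultimately show ?thesis using cont R(2) by (intro that[of R m]) auto
qed

context vlasov_poisson
begin

lemma f_slice_measurable:
  assumes t: "0 \<le> t" and [measurable]: "a \<in> borel_measurable M" "b \<in> borel_measurable M"
  shows "(\<lambda>x. f t (a x) (b x)) \<in> borel_measurable M"
proof -
  have [measurable]: "(\<lambda>(x, v). f t x v) \<in> borel_measurable borel"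
    by (rule borel_measurable_continuous_onI[OF C1_half_space_slice_continuous[OF f_C1 t]])
  have "(\<lambda>x. (\<lambda>(x, v). f t x v) (a x, b x)) \<in> borel_measurable M" by measurable
  then show ?thesis by simp
qed

text \<open>For fixed position \<open>x\<close> the substitution \<open>v = x - 2 e\<^sup>-\<^sup>t s\<close> has Jacobian \<open>4 e\<^sup>-\<^sup>2\<^sup>t\<close> in the plane.\<close>

lemma profile_density_eq:
  assumes t: "0 \<le> t"
  shows "profile_density profile t y = exp (2 * t) * rho t (exp t *\<^sub>R y)"
proof -
  define x where "x = exp t *\<^sub>R y"
  have e1: "exp t * exp (- 2 * t) = exp (- t)" by (simp flip: exp_add)
  have e2: "exp (2 * t) * (exp (- t) * exp (- t)) = 1" by (simp flip: exp_add)
  have slice: "f t x (x + (- 2 * exp (- t)) *\<^sub>R s) = profile t s (y - exp (- 2 * t) *\<^sub>R s)" for s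
  proof -
    have u: "exp t *\<^sub>R (y - exp (- 2 * t) *\<^sub>R s) = x - exp (- t) *\<^sub>R s"
      using e1 by (simp add: x_def scaleR_diff_right)
    have two: "(- 2 * exp (- t)) *\<^sub>R s = - (exp (- t) *\<^sub>R s) - exp (- t) *\<^sub>R s"
    proof -
      have "(- 2 * exp (- t)) *\<^sub>R s = (- exp (- t) - exp (- t)) *\<^sub>R s" by simp
      then show ?thesis by (simp only: scaleR_diff_left scaleR_minus_left)
    qed
    show ?thesis unfolding profile_def bar_def u two by simp
  qed
  have "f t x \<in> borel_measurable borel"
    by (rule f_slice_measurable[OF t]) auto
  from integral_affine[OF this, of "- 2 * exp (- t)" x]
  have "rho t x = (2 * exp (- t))\<^sup>2 * (LINT s|lborel. profile t s (y - exp (- 2 * t) *\<^sub>R s))"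
    unfolding slice by (simp add: density_def)
  then have "exp (2 * t) * rho t x = (exp (2 * t) * (exp (- t) * exp (- t))) * (4 * (LINT s|lborel. profile t s (y - exp (- 2 * t) *\<^sub>R s)))"
    by (simp add: power2_eq_square)
  then show ?thesis
    unfolding e2 by (simp add: profile_density_def x_def)
qed

lemma rho_measurable: "0 \<le> t \<Longrightarrow> rho t \<in> borel_measurable borel"
  by (rule borel_measurable_continuous_onI[OF C1_half_space_slice_continuous[OF rho_C1]])

text \<open>The kernel is homogeneous of degree \<open>-1\<close> and the plane has dimension 2, so the field of the rescaled density is the rescaled field.\<close>

lemma profile_field_eq:
  assumes t: "0 \<le> t" and le: "\<And>y. \<bar>profile_density profile t y\<bar> \<le> A / (1 + norm y) ^ 3"
  shows "profile_field t = field (profile_density profile t)"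
proof (rule ext)
  fix y :: "real^2"
  have A: "0 \<le> A" using order_trans[OF abs_ge_zero le[of 0]] by simp
  have rho_le: "\<bar>rho t x\<bar> \<le> (A * exp t) * tail_weight x" for x
  proof -
    have xe: "exp t *\<^sub>R (exp (- t) *\<^sub>R x) = x" by (simp add: exp_minus)
    have "exp (2 * t) * \<bar>rho t x\<bar> \<le> A / (1 + norm (exp (- t) *\<^sub>R x)) ^ 3"
      using le[of "exp (- t) *\<^sub>R x"] unfolding profile_density_eq[OF t] xe abs_mult by simp
    also have "\<dots> \<le> A / (exp (- t) * (1 + norm x)) ^ 3"
    proof (rule divide_left_mono[OF power_mono])
      show "exp (- t) * (1 + norm x) \<le> 1 + norm (exp (- t) *\<^sub>R x)"
        using t by (simp add: distrib_left)
      show "0 < (1 + norm (exp (- t) *\<^sub>R x)) ^ 3 * (exp (- t) * (1 + norm x)) ^ 3"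
        by (intro mult_pos_pos zero_less_power one_plus_norm_pos) auto
    qed (use A in auto)
    also have "\<dots> = A * exp (3 * t) * (1 / (1 + norm x) ^ 3)"
    proof -
      have "exp (- t) ^ 3 = exp (- (3 * t))" by (simp flip: exp_of_nat_mult)
      then show ?thesis by (simp add: power_mult_distrib exp_minus field_simps)
    qed
    also have "\<dots> \<le> A * exp (3 * t) * tail_weight x"
      using A by (intro mult_left_mono inverse_cube_le_tail_weight) auto
    also have "A * exp (3 * t) = exp (2 * t) * (A * exp t)"
      by (simp flip: exp_add)
    finally have "exp (2 * t) * \<bar>rho t x\<bar> \<le> exp (2 * t) * ((A * exp t) * tail_weight x)"
      by (simp only: mult.assoc)
    then show ?thesis by simp
  qed
  have "(phi t has_derivative (\<lambda>h. h \<bullet> field (rho t) x)) (at x)" for x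
    by (rule log_potential_has_derivative[OF rho_measurable[OF t] rho_le log_int[OF t]])
  then have grad_eq: "grad (phi t) x = field (rho t) x" for x
    by (rule grad_eqI)
  define x where "x = exp t *\<^sub>R y"
  have meas: "(\<lambda>z. rho t z *\<^sub>R grad_kernel (x - z)) \<in> borel_measurable borel"
    by (intro borel_measurable_scaleR rho_measurable t) measurable
  have "field (rho t) x = exp t ^ 2 *\<^sub>R (LINT z|lborel. rho t (exp t *\<^sub>R z) *\<^sub>R grad_kernel (x - exp t *\<^sub>R z))"
    unfolding field_def using integral_affine[OF meas, of "exp t" 0] by simp
  also have "(\<lambda>z. rho t (exp t *\<^sub>R z) *\<^sub>R grad_kernel (x - exp t *\<^sub>R z))
     = (\<lambda>z. (exp (- 3 * t)) *\<^sub>R (profile_density profile t z *\<^sub>R grad_kernel (y - z)))"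
  proof (rule ext)
    fix z :: "real^2"
    have k: "grad_kernel (x - exp t *\<^sub>R z) = exp (- t) *\<^sub>R grad_kernel (y - z)"
      unfolding x_def scaleR_diff_right[symmetric] by (subst grad_kernel_scale) (auto simp: exp_minus inverse_eq_divide)
    have e: "exp (- 3 * t) * exp (2 * t) = exp (- t)" by (simp flip: exp_add)
    show "rho t (exp t *\<^sub>R z) *\<^sub>R grad_kernel (x - exp t *\<^sub>R z)
       = exp (- 3 * t) *\<^sub>R (profile_density profile t z *\<^sub>R grad_kernel (y - z))"
      unfolding k profile_density_eq[OF t] scaleR_scaleR mult.assoc[symmetric] e by (simp add: mult.commute)
  qed
  also have "(LINT z|lborel. (exp (- 3 * t)) *\<^sub>R (profile_density profile t z *\<^sub>R grad_kernel (y - z)))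
     = exp (- 3 * t) *\<^sub>R field (profile_density profile t) y"
    unfolding field_def by (rule integral_scaleR_right)
  finally have "exp t *\<^sub>R field (rho t) x = (exp t * exp t ^ 2 * exp (- 3 * t)) *\<^sub>R field (profile_density profile t) y"
    by simp
  also have "exp t * exp t ^ 2 * exp (- 3 * t) = 1"
    by (simp add: power2_eq_square flip: exp_add)
  finally show "profile_field t y = field (profile_density profile t) y"
    by (simp add: profile_field_def grad_eq x_def)
qed

lemma profile_flow:
  assumes sd: "small_data N M \<epsilon> f0" and N: "1 \<le> N" and M: "6 \<le> M" and \<epsilon>: "0 < \<epsilon>"
    and small: "density_const (64 * \<epsilon>) * field_const \<le> 1 / 1000"
  shows "profile_flow \<mu> (64 * \<epsilon>) (4 * \<epsilon>) profile profile_field"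
proof
  have p0: "profile 0 s u = bar f0 s u" for s u
    by (simp add: profile_def bar_def initial)
  show "0 \<le> profile 0 s u" for s u
    using small_data_nonneg[OF sd] by (simp add: p0 bar_def)
  show "profile 0 s u \<le> 64 * \<epsilon> / ((1 + norm s) ^ 6 * (1 + norm u) ^ 6)" for s u
    unfolding p0 by (rule small_data_decay[OF sd _ M]) (use \<epsilon> in simp)
  show "\<bar>profile 0 s1 u1 - profile 0 s2 u2\<bar> \<le> 4 * \<epsilon> * (norm (s1 - s2) + norm (u1 - u2))" for s1 u1 s2 u2
    unfolding p0 by (rule small_data_lipschitz[OF sd _ N]) (use \<epsilon> in simp)
  show "profile_field t = field (profile_density profile t)"
    if "0 \<le> t" "\<And>y. \<bar>profile_density profile t y\<bar> \<le> A / (1 + norm y) ^ 3" for t A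
    by (rule profile_field_eq[OF that])
qed (use mu \<epsilon> small profile_cont profile_field_cont profile_field_bounded profile_trajectory_ex in auto)

lemma weak_limit:
  assumes flow: "profile_flow \<mu> K L profile profile_field" and \<psi>: "test_function \<psi>"
  shows "((\<lambda>t. exp (2 * t) * (LINT (s, u)|lborel. bar (f t) s (u + exp t *\<^sub>R w) * \<psi> (s, u)))
         \<longlongrightarrow> (LINT s|lborel. f_inf \<mu> f s w) * (LINT u|lborel. \<psi> (0, u))) at_top"
proof -
  interpret P: profile_flow \<mu> K L profile profile_field by (rule flow)
  have pos: "eventually (\<lambda>t::real. 0 \<le> t) at_top" by (rule eventually_ge_at_top)
  have Q: "Q_inf f u = P.limit_density u" for u
    unfolding Q_inf_def
  proof (rule tendsto_Lim)
    show "((\<lambda>t. 4 * exp (2 * t) * (LINT s|lborel. bar (f t) s (exp t *\<^sub>R u))) \<longlongrightarrow> P.limit_density u) at_top"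
    proof (rule Lim_transform_eventually[OF P.unslanted_density_tendsto])
      show "\<forall>\<^sub>F t in at_top. 4 * (LINT s|lborel. profile t s u) = 4 * exp (2 * t) * (LINT s|lborel. bar (f t) s (exp t *\<^sub>R u))"
        using pos
      proof eventually_elim
        case (elim t)
        have "(\<lambda>s. bar (f t) s (exp t *\<^sub>R u)) \<in> borel_measurable borel"
          unfolding bar_def by (intro f_slice_measurable[OF elim]) measurable
        from integral_affine[OF this, of "exp (- t)" 0]
        have "(LINT s|lborel. bar (f t) s (exp t *\<^sub>R u)) = exp (- t) ^ 2 * (LINT s|lborel. profile t s u)"
          by (simp add: profile_def)
        moreover have "exp (2 * t) * exp (- t) ^ 2 = 1"
          by (simp add: power2_eq_square flip: exp_add)
        ultimately show ?case
          by (simp add: mult.assoc[symmetric])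
      qed
    qed
  qed simp
  have grad_asymp: "grad (phi_asymp f) u = field P.limit_density u" for u
  proof (rule grad_eqI)
    have "Q_inf f = P.limit_density" using Q by (rule ext)
    then have "phi_asymp f = log_potential P.limit_density" by (simp add: phi_asymp_def)
    moreover have "(log_potential P.limit_density has_derivative (\<lambda>h. h \<bullet> field P.limit_density u)) (at u)"
    proof (rule log_potential_has_derivative[OF P.limit_density_measurable P.limit_density_tail])
      show "integrable lborel (\<lambda>y. ln (norm (x - y)) * P.limit_density y)" for x
        by (rule integrable_log_kernel[OF P.limit_density_measurable, of "density_const K"])
          (use P.limit_density_bounds in auto)
    qed
    ultimately show "(phi_asymp f has_derivative (\<lambda>h. h \<bullet> field P.limit_density u)) (at u)" by simp
  qed
  obtain a where a: "\<And>s. ((\<lambda>t. profile t (s + (\<mu> / 2 * t) *\<^sub>R field P.limit_density w) w) \<longlongrightarrow> P.limit_profile w (s - a)) at_top"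
    using P.scattering_limit[of w] by blast
  have f_inf_eq: "f_inf \<mu> f s w = P.limit_profile w (s - a)" for s
    unfolding f_inf_def
  proof (rule tendsto_Lim)
    show "((\<lambda>t. bar (f t) (S_corr \<mu> f t s w) (exp t *\<^sub>R w)) \<longlongrightarrow> P.limit_profile w (s - a)) at_top"
      using a[of s] by (simp add: profile_def S_corr_def grad_asymp)
  qed simp
  have mass: "(LINT s|lborel. f_inf \<mu> f s w) = (LINT s|lborel. P.limit_profile w s)"
    unfolding f_inf_eq using integral_translate[OF P.limit_profile_measurable, of w "- a"] by simp
  obtain R m where \<psi>': "continuous_on UNIV \<psi>" "0 \<le> R"
    "\<And>s u. \<psi> (s, u) \<noteq> 0 \<Longrightarrow> norm s \<le> R \<and> norm u \<le> R" "\<And>p. \<bar>\<psi> p\<bar> \<le> m"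
    by (rule test_function_compact_support[OF \<psi>]) (rule that, assumption+)
  have eq: "profile t (exp t *\<^sub>R s) (w + exp (- t) *\<^sub>R u) = bar (f t) s (u + exp t *\<^sub>R w)" for t s u
  proof -
    have "exp (- t) *\<^sub>R exp t *\<^sub>R s = s" "exp t *\<^sub>R (w + exp (- t) *\<^sub>R u) = u + exp t *\<^sub>R w"
      by (simp_all add: exp_minus scaleR_add_right)
    then show ?thesis by (simp only: profile_def)
  qed
  show ?thesis
    unfolding mass using P.concentration_limit[OF \<psi>'(1,3,2,4), of w] unfolding eq .
qed

end

theorem theorem3p4:
  fixes N M :: nat
  assumes "N \<ge> 3" and "M \<ge> 6"
  shows "\<exists>\<epsilon>0>0. \<forall>\<mu>\<in>{1, -1}. \<forall>\<epsilon> f0 f.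
    0 < \<epsilon> \<and> \<epsilon> \<le> \<epsilon>0 \<and> small_data N M \<epsilon> f0 \<and> VP_solution \<mu> f0 f \<longrightarrow>
    (\<forall>(\<psi> :: (real^2) \<times> (real^2) \<Rightarrow> real) (w :: real^2). test_function \<psi> \<longrightarrow>
      ((\<lambda>t. exp (2 * t) * (LINT (s, u)|lborel. bar (f t) s u * \<psi> (s, u)))
         \<longlongrightarrow> (LINT s|lborel. f_inf \<mu> f s 0) * (LINT u|lborel. \<psi> (0, u))) at_top \<and>
      ((\<lambda>t. exp (2 * t) * (LINT (s, u)|lborel. bar (f t) s (u + exp t *\<^sub>R w) * \<psi> (s, u)))
         \<longlongrightarrow> (LINT s|lborel. f_inf \<mu> f s w) * (LINT u|lborel. \<psi> (0, u))) at_top)"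
proof -
  define c where "c = density_const 64 * field_const"
  \<comment> \<open>The smallness condition is linear in \<open>\<epsilon>\<close>, with factor \<open>c\<close>; adding 1 makes the denominator positive without knowing that \<open>c\<close> is.\<close>
  define \<epsilon>0 where "\<epsilon>0 = 1 / (1000 * (c + 1))"
  have c: "0 \<le> c" using field_const_ge_4 by (simp add: c_def density_const_def)
  have main: "((\<lambda>t. exp (2 * t) * (LINT (s, u)|lborel. bar (f t) s (u + exp t *\<^sub>R w) * \<psi> (s, u)))
         \<longlongrightarrow> (LINT s|lborel. f_inf \<mu> f s w) * (LINT u|lborel. \<psi> (0, u))) at_top"
    if mu: "\<mu> \<in> {1, -1}" and \<epsilon>: "0 < \<epsilon>" "\<epsilon> \<le> \<epsilon>0" and sd: "small_data N M \<epsilon> f0"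
      and VP: "VP_solution \<mu> f0 f" and \<psi>: "test_function \<psi>"
    for \<mu> \<epsilon> f0 f w and \<psi> :: "(real^2) \<times> (real^2) \<Rightarrow> real"
  proof -
    interpret vlasov_poisson \<mu> f0 f
      by standard (use mu VP in auto)
    have "density_const (64 * \<epsilon>) * field_const = c * \<epsilon>"
      by (simp add: c_def density_const_def)
    also have "\<dots> \<le> (c + 1) * \<epsilon>0"
      using c \<epsilon> by (intro mult_mono) auto
    also have "\<dots> = 1 / 1000"
      using c by (simp add: \<epsilon>0_def)
    finally have "profile_flow \<mu> (64 * \<epsilon>) (4 * \<epsilon>) profile profile_field"
      using assms by (intro profile_flow[OF sd _ _ \<epsilon>(1)]) auto
    then show ?thesis by (rule weak_limit[OF _ \<psi>])
  qed
  show ?thesis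
  proof (intro exI[of _ \<epsilon>0] conjI ballI allI impI)
    show "0 < \<epsilon>0" using c by (simp add: \<epsilon>0_def)
  next
    fix \<mu> :: real and \<epsilon> f0 f and \<psi> :: "(real^2) \<times> (real^2) \<Rightarrow> real" and w :: "real^2"
    assume "\<mu> \<in> {1, -1}" and H: "0 < \<epsilon> \<and> \<epsilon> \<le> \<epsilon>0 \<and> small_data N M \<epsilon> f0 \<and> VP_solution \<mu> f0 f"
      and "test_function \<psi>"
    then show "((\<lambda>t. exp (2 * t) * (LINT (s, u)|lborel. bar (f t) s u * \<psi> (s, u)))
         \<longlongrightarrow> (LINT s|lborel. f_inf \<mu> f s 0) * (LINT u|lborel. \<psi> (0, u))) at_top"
      using main[of \<mu> \<epsilon> f0 f \<psi> 0] by simp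
    show "((\<lambda>t. exp (2 * t) * (LINT (s, u)|lborel. bar (f t) s (u + exp t *\<^sub>R w) * \<psi> (s, u)))
         \<longlongrightarrow> (LINT s|lborel. f_inf \<mu> f s w) * (LINT u|lborel. \<psi> (0, u))) at_top"
      using main \<open>\<mu> \<in> {1, -1}\<close> H \<open>test_function \<psi>\<close> by blast
  qed
qed

end
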